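(* For $\alpha\ge0$, let $$M_\alpha=\sup_{z\ge0}|J_\alpha(z)|,\qquad \Lambda_\alpha=\sup_{k\in\mathbb N_0,\,u\ge0}|\mathcal L_k^{(\alpha)}(u)|,\qquad A_\alpha=\left(\frac{\alpha^\alpha e^{-\alpha}}{\Gamma(\alpha+1)}\right)^{1/2}\ (\alpha>0),\quad A_0=1.$$ Then $$0<A_\alpha\le\Lambda_\alpha\le\liminf_{|t|\to\infty}|t|\left\|e^{-itH_\alpha}\right\|_{\ell^1\to\ell^\infty}\le\limsup_{|t|\to\infty}|t|\left\|e^{-itH_\alpha}\right\|_{\ell^1\to\ell^\infty}\le1.$$ Moreover, $M_\alpha\le\Lambda_\alpha$. Thus the temporal decay exponent $1$ is optimal for every $\alpha\ge0$.
   Context: For $\alpha>-1$, the discrete Laguerre operator $H_\alpha$ is the self-adjoint Jacobi operator on $\ell^2(\mathbb N_0)$ (with its maximal domain) associated with $$(H_\alpha u)_n=\sqrt{n(n+\alpha)}\,u_{n-1}+(2n+1+\alpha)u_n+\sqrt{(n+1)(n+1+\alpha)}\,u_{n+1},\quad u_{-1}=0.$$ $\|e^{-itH_\alpha}\|_{\ell^1\to\ell^\infty}$ is the operator norm from $\ell^1(\mathbb N_0)$ to $\ell^\infty(\mathbb N_0)$, equal to $\sup_{n,m}|\langle\delta_n,e^{-itH_\alpha}\delta_m\rangle|$. $J_\alpha$ is the Bessel function of the first kind. $L_k^{(\alpha)}$ is the standard Laguerre polynomial and $$\mathcal L_k^{(\alpha)}(u)=\left[\frac{k!}{\Gamma(k+\alpha+1)}\right]^{1/2}u^{\alpha/2}e^{-u/2}L_k^{(\alpha)}(u),\quad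 u\ge0,$$ with endpoint value at $u=0$ by continuous extension. *)

theory Defs
  imports "HOL-Analysis.Analysis"
begin

type_synonym seq = "nat \<Rightarrow> complex"

definition ell1 :: "seq set" where
  "ell1 = {u. summable (\<lambda>n. cmod (u n))}"

definition ell1_norm :: "seq \<Rightarrow> real" where
  "ell1_norm u = (\<Sum>n. cmod (u n))"

definition ell2 :: "seq set" where
  "ell2 = {u. summable (\<lambda>n. (cmod (u n))\<^sup>2)}"

definition ell2_norm :: "seq \<Rightarrow> real" where
  "ell2_norm u = sqrt (\<Sum>n. (cmod (u n))\<^sup>2)"

definition ell_inf_norm :: "seq \<Rightarrow> ereal" where
  "ell_inf_norm u = (SUP n. ereal (cmod (u n)))"

definition opnorm_1_inf :: "(seq \<Rightarrow> seq) \<Rightarrow> ereal" where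
  "opnorm_1_inf T = (SUP u \<in> {u \<in> ell1. ell1_norm u \<le> 1}. ell_inf_norm (T u))"

text \<open>Extensionality (the value \<^term>\<open>undefined\<close> off \<^term>\<open>ell2\<close>) is only there to make
  an operator on \<^term>\<open>ell2\<close> a unique HOL function.\<close>

definition unitary_on_ell2 :: "(seq \<Rightarrow> seq) \<Rightarrow> bool" where
  "unitary_on_ell2 V \<longleftrightarrow>
     V \<in> extensional ell2 \<and> bij_betw V ell2 ell2 \<and>
     (\<forall>u\<in>ell2. \<forall>v\<in>ell2. V (\<lambda>n. u n + v n) = (\<lambda>n. V u n + V v n)) \<and>
     (\<forall>c. \<forall>u\<in>ell2. V (\<lambda>n. c * u n) = (\<lambda>n. c * V u n)) \<and>
     (\<forall>u\<in>ell2. ell2_norm (V u) = ell2_norm u)"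

text \<open>\<open>U\<close> is a strongly continuous one-parameter unitary group whose infinitesimal generator
  is the operator \<open>-\<i>A\<close> with domain exactly \<open>D\<close>. By Stone's theorem such a group exists
  if and only if \<open>A\<close> with domain \<open>D\<close> is self-adjoint; it is then unique and equals
  \<open>exp(-\<i>tA)\<close>.\<close>

definition unitary_group_of :: "seq set \<Rightarrow> (seq \<Rightarrow> seq) \<Rightarrow> (real \<Rightarrow> seq \<Rightarrow> seq) \<Rightarrow> bool" where
  "unitary_group_of D A U \<longleftrightarrow>
     (\<forall>t. unitary_on_ell2 (U t)) \<and>
     (\<forall>u\<in>ell2. U 0 u = u) \<and>
     (\<forall>s t. \<forall>u\<in>ell2. U (s + t) u = U s (U t u)) \<and>
     (\<forall>u\<in>ell2. \<forall>s. ((\<lambda>t. ell2_norm (\<lambda>n. U t u n - U s u n)) \<longlongrightarrow> 0) (at s)) \<and>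
     (\<forall>u\<in>ell2. \<forall>v\<in>ell2.
        ((\<lambda>h. ell2_norm (\<lambda>n. (U h u n - u n) / of_real h - v n)) \<longlongrightarrow> 0) (at 0)
        \<longleftrightarrow> u \<in> D \<and> v = (\<lambda>n. - \<i> * A u n))"

definition exp_minus_it :: "seq set \<Rightarrow> (seq \<Rightarrow> seq) \<Rightarrow> real \<Rightarrow> seq \<Rightarrow> seq" where
  "exp_minus_it D A = (THE U. unitary_group_of D A U)"

definition laguerre_op :: "real \<Rightarrow> seq \<Rightarrow> seq" where
  "laguerre_op \<alpha> u n =
     of_real (sqrt (real n * (real n + \<alpha>))) * (if n = 0 then 0 else u (n - 1))
     + of_real (2 * real n + 1 + \<alpha>) * u n
     + of_real (sqrt ((real n + 1) * (real n + 1 + \<alpha>))) * u (n + 1)"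

definition laguerre_dom :: "real \<Rightarrow> seq set" where
  "laguerre_dom \<alpha> = {u \<in> ell2. laguerre_op \<alpha> u \<in> ell2}"

definition laguerre_propagator :: "real \<Rightarrow> real \<Rightarrow> seq \<Rightarrow> seq" where
  "laguerre_propagator \<alpha> = exp_minus_it (laguerre_dom \<alpha>) (laguerre_op \<alpha>)"

text \<open>In HOL \<^term>\<open>0 powr 0 = (0::real)\<close>; here the power is \<open>1\<close> for exponent \<open>0\<close>, so that
  for \<open>a \<ge> 0\<close> it is the continuous extension of \<open>x powr a\<close> to \<open>x = 0\<close>.\<close>

definition rpow :: "real \<Rightarrow> real \<Rightarrow> real" where
  "rpow x a = (if a = 0 then 1 else x powr a)"

text \<open>The Bessel function of the first kind, for \<open>z \<ge> 0\<close>.\<close>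

definition bessel_J :: "real \<Rightarrow> real \<Rightarrow> real" where
  "bessel_J \<alpha> z =
     rpow (z / 2) \<alpha> * (\<Sum>m. (-1) ^ m / (fact m * Gamma (real m + \<alpha> + 1)) * (z / 2) ^ (2 * m))"

definition laguerre_poly :: "nat \<Rightarrow> real \<Rightarrow> real \<Rightarrow> real" where
  "laguerre_poly k \<alpha> x =
     (\<Sum>i\<le>k. (-1) ^ i * ((real k + \<alpha>) gchoose (k - i)) * x ^ i / fact i)"

definition laguerre_fun :: "nat \<Rightarrow> real \<Rightarrow> real \<Rightarrow> real" where
  "laguerre_fun k \<alpha> u =
     sqrt (fact k / Gamma (real k + \<alpha> + 1)) * rpow u (\<alpha> / 2) * exp (- u / 2) * laguerre_poly k \<alpha> u"

definition M_const :: "real \<Rightarrow> ereal" where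
  "M_const \<alpha> = (SUP z \<in> {0..}. ereal \<bar>bessel_J \<alpha> z\<bar>)"

definition Lambda_const :: "real \<Rightarrow> ereal" where
  "Lambda_const \<alpha> = (SUP (k, u) \<in> UNIV \<times> {0..}. ereal \<bar>laguerre_fun k \<alpha> u\<bar>)"

definition A_const :: "real \<Rightarrow> real" where
  "A_const \<alpha> =
     (if \<alpha> = 0 then 1 else sqrt (\<alpha> powr \<alpha> * exp (- \<alpha>) / Gamma (\<alpha> + 1)))"

text \<open>For real \<open>t\<close>, the filter \<^term>\<open>at_infinity :: real filter\<close> is \<open>\<bar>t\<bar> \<rightarrow> \<infinity>\<close>.\<close>

definition decays_with_exponent :: "(real \<Rightarrow> ereal) \<Rightarrow> real \<Rightarrow> bool" where
  "decays_with_exponent f \<gamma> \<longleftrightarrow>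
     (\<exists>C::real. \<forall>\<^sub>F t in at_infinity. f t \<le> ereal (C * \<bar>t\<bar> powr (- \<gamma>)))"

definition optimal_decay_exponent :: "(real \<Rightarrow> ereal) \<Rightarrow> real \<Rightarrow> bool" where
  "optimal_decay_exponent f \<gamma> \<longleftrightarrow>
     decays_with_exponent f \<gamma> \<and> (\<forall>\<gamma>'>\<gamma>. \<not> decays_with_exponent f \<gamma>')"

end

theory Submission
  imports Defs
begin

text \<open>
  \<^bold>\<open>Propagator.\<close> With \<open>\<beta> = \<alpha> + 1\<close>, the operator \<open>H\<^sub>\<alpha>\<close> is a parabolic generator in the discrete series of
  su(1,1), realised on power series as \<open>(1 + z)\<^sup>2 d/dz + \<beta> (1 + z)\<close>; its flow acts by Moebius maps, which
  gives an explicit matrix \<open>lag_kernel\<close>. This matrix solves the Schroedinger equation entrywise and decays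
  geometrically along columns, so differentiating \<open>\<Sum>k. G (r - s) n k * G s k m\<close> in \<open>s\<close> and moving the
  symmetric Jacobi matrix from one factor to the other yields the group law and unitarity at once.

  \<^bold>\<open>Upper bound.\<close> For \<open>n \<le> m\<close> and \<open>y = 1 / (1 + t\<^sup>2)\<close>, the quantity \<open>(1 + t\<^sup>2) |G t n m|\<^sup>2\<close> is the square of the
  normalised Jacobi function with parameters \<open>(m - n, \<alpha>)\<close> at \<open>y\<close>, and this is at most 1: by a Sonin argument
  its maxima on one side of a point are dominated by the maximum \<open>x\<close> before the first zero; there the
  function divided by \<open>y\<^bsup>b/2\<^esup>\<close> is decreasing, so its square at \<open>x\<close> is at most \<open>b\<close> times its
  square integral against \<open>dy/y\<close>, and that integral is exactly \<open>1/b\<close>.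

  \<^bold>\<open>Lower bound.\<close> With \<open>n = k\<close> fixed and \<open>m \<approx> u (1 + t\<^sup>2)\<close> the Jacobi functions tend to the Laguerre function
  \<open>L\<^sub>k(u)\<close>; these tend to \<open>J\<^sub>\<alpha>(z)\<close> for \<open>u = z\<^sup>2/4k\<close>, and \<open>k = 0\<close>, \<open>u = \<alpha>\<close> gives \<open>A\<^sub>\<alpha>\<close>.
\<close>

section \<open>Jacobi polynomials on the unit interval\<close>

text \<open>\<open>exp_minus_it\<close> is a definite description, so an explicit kernel alone is
  not enough: the group must have a generator with exactly the maximal domain, and it must be
  unique. The domain comes out right because the coordinates of the evolved sequence are
  differentiable for every bounded u, with H moved onto u. A norm derivative v at 0 therefore
  satisfies v = - i H u coordinate by coordinate, which makes H u square summable. Jacobi functions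
  enter through the relation \<tau> - 1 = - i t \<tau>. It makes (\<tau> / (\<tau> - 1))^2 = - 1 /
  t^2 real, so up to a phase each kernel entry is a real function of y = |\<tau>|^2 = 1 / (1 + t^2).
  The Sonin argument works on the side of a point where an affine function of y is nonnegative. This
  function changes sign when (a, y) and (b, 1 - y) are exchanged, so for every n, m and t one of the
  two orientations applies and no parameter range needs a separate treatment.\<close>

definition jacobi_poly :: "nat \<Rightarrow> real \<Rightarrow> real \<Rightarrow> real poly" where
  "jacobi_poly n a b = (\<Sum>k\<le>n. monom ((-1) ^ k * real (n choose k) *
     pochhammer (real n + a + b + 1) k / pochhammer (b + 1) k) k)"

lemma coeff_jacobi_poly:
  "coeff (jacobi_poly n a b) k = (-1) ^ k * real (n choose k) *
     pochhammer (real n + a + b + 1) k / pochhammer (b + 1) k"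
  by (simp add: jacobi_poly_def coeff_sum if_distrib cong: if_cong)

lemma poly_jacobi_poly:
  "poly (jacobi_poly n a b) y = (\<Sum>k\<le>n. (-1) ^ k * real (n choose k) *
     pochhammer (real n + a + b + 1) k / pochhammer (b + 1) k * y ^ k)"
  by (simp add: jacobi_poly_def poly_sum poly_monom)

lemma poly_jacobi_poly_0 [simp]: "poly (jacobi_poly n a b) 0 = 1"
  by (simp add: poly_0_coeff_0 coeff_jacobi_poly)

lemma choose_Suc_real: "real (n choose Suc k) * (1 + real k) = real (n choose k) * (real n - real k)"
proof (cases "k \<le> n")
  case True
  have "Suc k * (n choose Suc k) = (n - k) * (n choose k)"
    by (metis binomial_absorb_comp binomial_absorption mult.commute)
  then have "real (Suc k) * real (n choose Suc k) = real (n - k) * real (n choose k)"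
    by (metis of_nat_mult)
  then show ?thesis using True by (simp add: of_nat_diff mult.commute)
qed (simp add: binomial_eq_0)

text \<open>The hypergeometric recurrence: \<open>jacobi_poly n a b\<close> is 2F1(-n, n + a + b +
  1; b + 1; y), a multiple of the Jacobi polynomial P_n^(b,a)(1 - 2 y). Denominators are cleared so
  that the indices k \<ge> n, where both sides vanish, are covered too.\<close>

lemma coeff_jacobi_poly_Suc:
  assumes "b \<ge> 0"
  shows "(1 + real k) * (b + 1 + real k) * coeff (jacobi_poly n a b) (Suc k)
    = - (real n - real k) * (real n + real k + a + b + 1) * coeff (jacobi_poly n a b) k"
proof -
  have p: "pochhammer (b + 1) k > 0" "b + 1 + real k > 0" using assms by (auto intro!: pochhammer_pos)
  have "(1 + real k) * (b + 1 + real k) * coeff (jacobi_poly n a b) (Suc k) =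
     - ((-1) ^ k) * (real (n choose Suc k) * (1 + real k)) *
     (pochhammer (real n + a + b + 1) k * (real n + a + b + 1 + real k)) / pochhammer (b + 1) k"
  proof -
    have "(1 + real k) * z * (- (c :: real) * C * (P * x) / (Q * z)) = - c * (C * (1 + real k)) * (P * x) / Q"
      if "z > 0" for z c C P Q x
      using that by (simp add: mult_ac)
    from this[OF p(2)] show ?thesis by (simp add: coeff_jacobi_poly pochhammer_Suc)
  qed
  also have "\<dots> = - (real n - real k) * (real n + real k + a + b + 1) * coeff (jacobi_poly n a b) k"
    unfolding choose_Suc_real coeff_jacobi_poly
  proof -
    have e: "- c * (C * d) * (P * x) / Q = - d * x' * (c * C * P / Q)" if "x' = x" for c C d P x x' Q :: real
      using that by simp
    show "- ((-1) ^ k) * (real (n choose k) * (real n - real k)) * (pochhammer (real n + a + b + 1) k *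
        (real n + a + b + 1 + real k)) / pochhammer (b + 1) k = - (real n - real k) * (real n + real k + a + b + 1) *
        ((-1) ^ k * real (n choose k) * pochhammer (real n + a + b + 1) k / pochhammer (b + 1) k)"
      by (rule e) simp
  qed
  finally show ?thesis .
qed

lemma jacobi_poly_ode:
  fixes a b y :: real and n :: nat
  defines "p \<equiv> jacobi_poly n a b"
  assumes "b \<ge> 0"
  shows "y * (1 - y) * poly (pderiv (pderiv p)) y + (b + 1 - (a + b + 2) * y) * poly (pderiv p) y
     + real n * (real n + a + b + 1) * poly p y = 0"
proof -
  have rec: "(1 + real k) * (b + 1 + real k) * coeff p (Suc k)
    = - (real n - real k) * (real n + real k + a + b + 1) * coeff p k" for k
    unfolding p_def by (rule coeff_jacobi_poly_Suc) fact
  have "pCons 0 (pderiv (pderiv p)) - pCons 0 (pCons 0 (pderiv (pderiv p))) + smult (b + 1) (pderiv p)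
     - smult (a + b + 2) (pCons 0 (pderiv p)) + smult (real n * (real n + a + b + 1)) p = 0"
  proof (rule poly_eqI)
    fix i
    show "coeff (pCons 0 (pderiv (pderiv p)) - pCons 0 (pCons 0 (pderiv (pderiv p))) + smult (b + 1) (pderiv p)
     - smult (a + b + 2) (pCons 0 (pderiv p)) + smult (real n * (real n + a + b + 1)) p) i = coeff 0 i"
    \<comment> \<open>The shifts by \<open>pCons 0\<close> make the indices 0 and 1 special; in each
      case the claim is the recurrence at k = i.\<close>
    proof (cases i)
      case 0
      then show ?thesis using rec[of 0] by (simp add: coeff_pderiv algebra_simps)
    next
      case (Suc j)
      show ?thesis
      proof (cases j)
        case 0
        then show ?thesis using rec[of 1] Suc by (simp add: coeff_pderiv algebra_simps)
      next
        case (Suc l)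
        then show ?thesis using rec[of "Suc (Suc l)"] \<open>i = Suc j\<close>
          by (simp add: coeff_pderiv) (simp add: algebra_simps)
      qed
    qed
  qed
  then have "poly (pCons 0 (pderiv (pderiv p)) - pCons 0 (pCons 0 (pderiv (pderiv p))) + smult (b + 1) (pderiv p)
     - smult (a + b + 2) (pCons 0 (pderiv p)) + smult (real n * (real n + a + b + 1)) p) y = 0"
    by simp
  then show ?thesis by (simp add: algebra_simps)
qed

section \<open>Finite differences and moments of Jacobi polynomials\<close>

text \<open>The left side is the operator f(x) - f(x + 1) iterated n + 1 times and evaluated at 0;
  Pascal's rule splits off one application. The evaluations of alternating sums below are inductions
  along this step.\<close>

lemma alternating_binomial_sum_Suc:
  fixes f :: "nat \<Rightarrow> 'a::comm_ring_1"
  shows "(\<Sum>j\<le>Suc n. (-1) ^ j * of_nat (Suc n choose j) * f j) =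
     (\<Sum>j\<le>n. (-1) ^ j * of_nat (n choose j) * (f j - f (Suc j)))"
proof -
  have "(\<Sum>j\<le>Suc n. (-1) ^ j * of_nat (Suc n choose j) * f j)
    = f 0 + (\<Sum>j\<le>n. - ((-1) ^ j) * of_nat ((n choose j) + (n choose Suc j)) * f (Suc j))"
    by (simp add: sum.atMost_Suc_shift del: sum.atMost_Suc of_nat_add)
  also have "\<dots> = (f 0 + (\<Sum>j\<le>n. (-1) ^ Suc j * of_nat (n choose Suc j) * f (Suc j)))
       - (\<Sum>j\<le>n. (-1) ^ j * of_nat (n choose j) * f (Suc j))"
    by (simp add: algebra_simps sum.distrib sum_negf sum_subtractf)
  also have "f 0 + (\<Sum>j\<le>n. (-1) ^ Suc j * of_nat (n choose Suc j) * f (Suc j)) =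
     (\<Sum>j\<le>Suc n. (-1) ^ j * of_nat (n choose j) * f j)"
    by (simp add: sum.atMost_Suc_shift del: sum.atMost_Suc)
  also have "\<dots> = (\<Sum>j\<le>n. (-1) ^ j * of_nat (n choose j) * f j)"
    by (simp add: binomial_eq_0)
  finally show ?thesis by (simp add: algebra_simps sum_subtractf)
qed

text \<open>Differencing lowers the degree. The alternative \<open>= 0\<close> covers constant
  polynomials, since the zero polynomial has degree 0, which is not below n = 0.\<close>

lemma degree_diff_offset_poly:
  fixes p :: "real poly"
  assumes "degree p < Suc n"
  shows "p - pcompose p [:1, 1:] = 0 \<or> degree (p - pcompose p [:1, 1:]) < n"
  using assms
proof (induction p arbitrary: n rule: pCons_induct)
  case 0
  then show ?case by simp
next
  case (pCons c p)
  show ?case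
  proof (cases "p = 0")
    case True then show ?thesis by simp
  next
    case False
    then obtain m where n: "n = Suc m" using pCons.prems by (cases n) auto
    have dp: "degree p < Suc m" using pCons.prems False n by simp
    let ?q = "p - pcompose p [:1, 1:]"
    have eq: "pCons c p - pcompose (pCons c p) [:1, 1:] = pCons 0 ?q - pcompose p [:1, 1:]"
      by (simp add: pcompose_pCons)
    have d1: "degree (pCons 0 ?q) < Suc m" using pCons.IH[OF dp] by auto
    have d2: "degree (pcompose p [:1, 1:]) < Suc m" using dp by (simp add: degree_pcompose)
    show ?thesis unfolding eq n using degree_diff_less[OF d1 d2] by simp
  qed
qed

lemma alternating_binomial_sum_poly:
  fixes p :: "real poly"
  assumes "degree p < n"
  shows "(\<Sum>j\<le>n. (-1) ^ j * real (n choose j) * poly p (real j)) = 0"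
  using assms
proof (induction n arbitrary: p)
  case (Suc n)
  let ?q = "p - pcompose p [:1, 1:]"
  have "(\<Sum>j\<le>Suc n. (-1) ^ j * real (Suc n choose j) * poly p (real j)) =
    (\<Sum>j\<le>n. (-1) ^ j * real (n choose j) * poly ?q (real j))"
    unfolding alternating_binomial_sum_Suc by (simp add: poly_pcompose add.commute)
  also have "\<dots> = 0"
    using degree_diff_offset_poly[OF Suc.prems]
  proof
    assume "?q = 0"
    then show ?thesis by (simp only: poly_0 mult_zero_right sum.neutral_const)
  qed (rule Suc.IH)
  finally show ?case .
qed simp

text \<open>The partial fraction expansion of n! / (b (b + 1) ... (b + n)). Differencing 1 / (b + x)
  compares b with b + 1, so the induction runs over all b.\<close>

lemma alternating_binomial_sum_inverse:
  fixes b :: real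
  assumes "b > 0"
  shows "(\<Sum>j\<le>n. (-1) ^ j * real (n choose j) * (1 / (b + real j))) = fact n / pochhammer b (Suc n)"
  using assms
proof (induction n arbitrary: b)
  case 0
  then show ?case by simp
next
  case (Suc n)
  have pos: "pochhammer b (Suc n) > 0" "pochhammer (b+1) n > 0" "pochhammer (b + 1) (Suc n) > 0"
    using Suc.prems by (auto intro!: pochhammer_pos)
  have "(\<Sum>j\<le>Suc n. (-1) ^ j * real (Suc n choose j) * (1 / (b + real j))) =
     (\<Sum>j\<le>n. (-1) ^ j * real (n choose j) * (1 / (b + real j))) -
     (\<Sum>j\<le>n. (-1) ^ j * real (n choose j) * (1 / ((b + 1) + real j)))"
    unfolding alternating_binomial_sum_Suc by (simp add: sum_subtractf algebra_simps)
  also have "\<dots> = fact n / pochhammer b (Suc n) - fact n / pochhammer (b + 1) (Suc n)"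
    using Suc.IH[of b] Suc.IH[of "b+1"] Suc.prems by simp
  also have "\<dots> = fact n / (b * pochhammer (b+1) n) - fact n / (pochhammer (b + 1) n * (b + 1 + real n))"
    by (simp only: pochhammer_rec[of b] pochhammer_Suc[of "b+1"])
  also have "\<dots> = fact (Suc n) / (b * (pochhammer (b + 1) n * (b + 1 + real n)))"
  proof -
    have "F / (b * P) - F / (P * z) = (z - b) * F / (b * (P * z))" if "P > 0" "z > 0" for F P z :: real
      using that Suc.prems by (simp add: field_simps)
    from this[OF pos(2), of "b + 1 + real n" "fact n"] show ?thesis using Suc.prems by simp
  qed
  also have "\<dots> = fact (Suc n) / pochhammer b (Suc (Suc n))"
    by (simp only: pochhammer_rec[of b "Suc n"] pochhammer_Suc[of "b+1" n])
  finally show ?case .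
qed

lemma pochhammer_as_poly:
  "\<exists>q :: real poly. degree q \<le> m \<and> (\<forall>y. poly q y = pochhammer (x + y) m)"
proof (induction m)
  case 0
  then show ?case by (intro exI[of _ 1]) simp
next
  case (Suc m)
  then obtain q :: "real poly" where q: "degree q \<le> m" "\<And>y. poly q y = pochhammer (x + y) m" by blast
  have "degree (q * [:x + real m, 1:]) \<le> Suc m"
    using degree_mult_le[of q "[:x + real m, 1:]"] q(1) by simp
  moreover have "poly (q * [:x + real m, 1:]) y = pochhammer (x + y) (Suc m)" for y
    by (simp add: q(2) pochhammer_Suc algebra_simps)
  ultimately show ?case by blast
qed

lemma pochhammer_Gamma_pos: "x > 0 \<Longrightarrow> pochhammer (x :: real) n = Gamma (x + real n) / Gamma x"
  by (rule pochhammer_Gamma) (auto elim!: nonpos_Ints_cases)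

lemma Gamma_pos_nonzero: "x > 0 \<Longrightarrow> Gamma (x :: real) \<noteq> 0"
  using Gamma_real_pos[of x] by linarith

lemma Gamma_plus1_pos: "x > 0 \<Longrightarrow> Gamma (x + 1 :: real) = x * Gamma x"
  by (rule Gamma_plus1) (auto elim!: nonpos_Ints_cases)

text \<open>The Beta value is the integral of y^(k + j) against y^(b - 1) (1 - y)^a. The dependence
  on j is gathered into an alternating binomial coefficient and two Gamma ratios, to which finite
  differences can be applied.\<close>

lemma coeff_jacobi_poly_Beta:
  assumes "a \<ge> 0" "b > 0"
  shows "coeff (jacobi_poly n a b) j * Beta (b + real k + real j) (a + 1) =
     Gamma (a + 1) * Gamma (b + 1) / Gamma (real n + a + b + 1) *
     ((-1) ^ j * real (n choose j) * (Gamma (real n + a + b + 1 + real j) / Gamma (a + b + real k + real j + 1)) *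
      (Gamma (b + real k + real j) / Gamma (b + 1 + real j)))"
proof -
  have "pochhammer (real n + a + b + 1) j = Gamma (real n + a + b + 1 + real j) / Gamma (real n + a + b + 1)"
    "pochhammer (b + 1) j = Gamma (b + 1 + real j) / Gamma (b + 1)"
    using assms by (auto intro!: pochhammer_Gamma_pos)
  moreover have "b + real k + real j + (a + 1) = a + b + real k + real j + 1" by simp
  ultimately show ?thesis by (simp only: coeff_jacobi_poly Beta_def) (simp add: mult_ac)
qed

text \<open>The sum is the integral of the Jacobi polynomial times y^k against y^(b - 1) (1 - y)^a.
  For 1 \<le> k \<le> n the two Gamma ratios are polynomials in j of degrees n - k and k - 1, so
  their product has degree below n and the n-th difference annihilates it.\<close>

lemma jacobi_poly_orthogonal:
  assumes "a \<ge> 0" "b > 0" "1 \<le> k" "k \<le> n"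
  shows "(\<Sum>j\<le>n. coeff (jacobi_poly n a b) j * Beta (b + real k + real j) (a + 1)) = 0"
proof -
  obtain p :: "real poly" where p: "degree p \<le> n - k" "\<And>y. poly p y = pochhammer (a + b + real k + 1 + y) (n - k)"
    using pochhammer_as_poly by blast
  obtain q :: "real poly" where q: "degree q \<le> k - 1" "\<And>y. poly q y = pochhammer (b + 1 + y) (k - 1)"
    using pochhammer_as_poly by blast
  have "coeff (jacobi_poly n a b) j * Beta (b + real k + real j) (a + 1) =
    Gamma (a + 1) * Gamma (b + 1) / Gamma (real n + a + b + 1) * ((-1) ^ j * real (n choose j) * poly (p * q) (real j))" for j
  proof -
    have "poly p (real j) = Gamma (real n + a + b + 1 + real j) / Gamma (a + b + real k + real j + 1)"
      unfolding p using assms by (subst pochhammer_Gamma_pos) (auto simp: of_nat_diff algebra_simps)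
    moreover have "poly q (real j) = Gamma (b + real k + real j) / Gamma (b + 1 + real j)"
      unfolding q using assms by (subst pochhammer_Gamma_pos) (auto simp: of_nat_diff algebra_simps)
    ultimately show ?thesis
      by (simp only: coeff_jacobi_poly_Beta[OF assms(1,2)] poly_mult mult.assoc)
  qed
  moreover have "degree (p * q) < n"
    using degree_mult_le[of p q] p(1) q(1) assms by linarith
  ultimately show ?thesis
    by (simp only: sum_distrib_left[symmetric] alternating_binomial_sum_poly mult_zero_right)
qed

text \<open>At k = 0 the second Gamma ratio degenerates to 1 / (b + j). Dividing \<open>q\<close> by
  x + b isolates the remainder q(-b) = (a + 1)_n; the quotient is annihilated, and the sum of the 1
  / (b + j) gives the value.\<close>

lemma jacobi_poly_moment:
  assumes "a \<ge> 0" "b > 0"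
  shows "(\<Sum>j\<le>n. coeff (jacobi_poly n a b) j * Beta (b + real j) (a + 1)) =
    fact n * Gamma (real n + a + 1) * Gamma (b + 1) * Gamma b / (Gamma (real n + a + b + 1) * Gamma (real n + b + 1))"
proof -
  obtain q :: "real poly" where q: "degree q \<le> n" "\<And>y. poly q y = pochhammer (a + b + 1 + y) n"
    using pochhammer_as_poly by blast
  define r where "r = synthetic_div q (- b)"
  have qr: "[:b, 1:] * r + [:poly q (- b):] = q"
    using synthetic_div_correct'[of "- b" q] by (simp add: r_def)
  have poly_q: "poly q (real j) * (1 / (b + real j)) = poly r (real j) + poly q (- b) * (1 / (b + real j))" for j
  proof -
    have "poly q (real j) = (b + real j) * poly r (real j) + poly q (- b)"
      by (subst qr[symmetric]) (simp add: algebra_simps)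
    then show ?thesis using assms(2) by (simp add: field_simps)
  qed
  have r0: "(\<Sum>j\<le>n. (-1) ^ j * real (n choose j) * poly r (real j)) = 0"
  proof (cases "n = 0")
    case True
    then have "r = 0" using q(1) by (simp add: r_def synthetic_div_eq_0_iff)
    then show ?thesis by simp
  next
    case False
    then have "degree r < n" using q(1) by (simp add: r_def degree_synthetic_div)
    then show ?thesis by (rule alternating_binomial_sum_poly)
  qed
  have "coeff (jacobi_poly n a b) j * Beta (b + real j) (a + 1) =
    Gamma (a + 1) * Gamma (b + 1) / Gamma (real n + a + b + 1) *
      ((-1) ^ j * real (n choose j) * (poly q (real j) * (1 / (b + real j))))" for j
  proof -
    have "poly q (real j) = Gamma (real n + a + b + 1 + real j) / Gamma (a + b + real j + 1)"
      unfolding q using assms by (subst pochhammer_Gamma_pos) (auto simp: algebra_simps)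
    moreover have "1 / (b + real j) = Gamma (b + real j) / Gamma (b + 1 + real j)"
    proof -
      have pos: "b + real j > 0" using assms by simp
      show ?thesis using Gamma_plus1_pos[OF pos] Gamma_pos_nonzero[OF pos] pos by (simp add: add_ac)
    qed
    ultimately show ?thesis
      using coeff_jacobi_poly_Beta[OF assms, of n j 0] by (simp only: of_nat_0 add_0_right mult.assoc)
  qed
  then have "(\<Sum>j\<le>n. coeff (jacobi_poly n a b) j * Beta (b + real j) (a + 1)) =
    Gamma (a + 1) * Gamma (b + 1) / Gamma (real n + a + b + 1) *
    (\<Sum>j\<le>n. (-1) ^ j * real (n choose j) * (poly q (real j) * (1 / (b + real j))))"
    by (simp only: sum_distrib_left)
  also have "(\<Sum>j\<le>n. (-1) ^ j * real (n choose j) * (poly q (real j) * (1 / (b + real j)))) =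
      (\<Sum>j\<le>n. (-1) ^ j * real (n choose j) * poly r (real j)) +
      poly q (- b) * (\<Sum>j\<le>n. (-1) ^ j * real (n choose j) * (1 / (b + real j)))"
    unfolding poly_q sum_distrib_left sum.distrib[symmetric] by (intro sum.cong) (auto simp: algebra_simps)
  also have "\<dots> = pochhammer (a + 1) n * (fact n / pochhammer b (Suc n))"
    using r0 alternating_binomial_sum_inverse[OF assms(2), of n] by (simp add: q(2))
  also have "pochhammer (a + 1) n = Gamma (real n + a + 1) / Gamma (a + 1)"
    using assms by (subst pochhammer_Gamma_pos) (auto simp: add_ac)
  also have "pochhammer b (Suc n) = Gamma (real n + b + 1) / Gamma b"
    using assms by (subst pochhammer_Gamma_pos) (auto simp: add_ac)
  finally show ?thesis using Gamma_pos_nonzero[of "a + 1"] assms by simp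
qed

lemma powr_times_power: "u \<ge> 0 \<Longrightarrow> (u :: real) powr x * u ^ k = u powr (x + real k)"
  by (cases "u = 0") (simp_all add: powr_add powr_realpow)

text \<open>The weight is u^(b - 1), not the orthogonality weight u^b. Expanding one of the two
  factors in powers u^k, all k \<ge> 1 integrate to zero against the other factor, and the constant
  coefficient is 1, so only the moment k = 0 is left.\<close>

lemma jacobi_poly_integral:
  assumes "a \<ge> 0" "b > 0"
  shows "((\<lambda>u. u powr (b - 1) * (1 - u) powr a * (poly (jacobi_poly n a b) u)\<^sup>2) has_integral
    fact n * Gamma (real n + a + 1) * Gamma (b + 1) * Gamma b / (Gamma (real n + a + b + 1) * Gamma (real n + b + 1))) {0..1}"
    (is "(_ has_integral ?V) _")
proof -
  define e where "e = coeff (jacobi_poly n a b)"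
  have F: "poly (jacobi_poly n a b) u = (\<Sum>j\<le>n. e j * u ^ j)" for u
    unfolding poly_jacobi_poly e_def coeff_jacobi_poly by simp
  have "((\<lambda>u. \<Sum>k\<le>n. \<Sum>j\<le>n. e k * (e j * (u powr (b + real k + real j - 1) * (1 - u) powr (a + 1 - 1)))) has_integral
     (\<Sum>k\<le>n. \<Sum>j\<le>n. e k * (e j * Beta (b + real k + real j) (a + 1)))) {0..1}"
    using assms by (intro has_integral_sum has_integral_mult_right has_integral_Beta_real) auto
  also have "(\<Sum>k\<le>n. \<Sum>j\<le>n. e k * (e j * Beta (b + real k + real j) (a + 1))) =
     (\<Sum>k\<le>n. e k * (\<Sum>j\<le>n. e j * Beta (b + real k + real j) (a + 1)))"
    by (simp only: sum_distrib_left)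
  also have "\<dots> = (\<Sum>k\<le>n. if k = 0 then ?V else 0)"
  proof (rule sum.cong)
    fix k assume "k \<in> {..n}"
    then show "e k * (\<Sum>j\<le>n. e j * Beta (b + real k + real j) (a + 1)) = (if k = 0 then ?V else 0)"
      using jacobi_poly_orthogonal[OF assms, of k n] jacobi_poly_moment[OF assms, of n]
      by (cases "k = 0") (auto simp: e_def coeff_jacobi_poly)
  qed simp
  also have "\<dots> = ?V" by simp
  finally show ?thesis
  proof (rule has_integral_eq[rotated])
    fix u :: real assume u: "u \<in> {0..1}"
    have "u powr (b - 1) * (1 - u) powr a * (poly (jacobi_poly n a b) u)\<^sup>2 =
      (\<Sum>k\<le>n. \<Sum>j\<le>n. e k * (e j * (u powr (b - 1) * u ^ k * u ^ j * (1 - u) powr a)))"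
      unfolding F power2_eq_square sum_product by (simp add: sum_distrib_left mult_ac)
    also have "\<dots> = (\<Sum>k\<le>n. \<Sum>j\<le>n. e k * (e j * (u powr (b + real k + real j - 1) * (1 - u) powr (a + 1 - 1))))"
    proof -
      have "u powr (b - 1) * u ^ k * u ^ j = u powr (b + real k + real j - 1)" for k j
        using u powr_times_power[of u "b - 1" k] powr_times_power[of u "b - 1 + real k" j]
        by (simp add: algebra_simps)
      then show ?thesis by simp
    qed
    finally show "(\<Sum>k\<le>n. \<Sum>j\<le>n. e k * (e j * (u powr (b + real k + real j - 1) * (1 - u) powr (a + 1 - 1)))) =
        u powr (b - 1) * (1 - u) powr a * (poly (jacobi_poly n a b) u)\<^sup>2" by simp
  qed
qed

section \<open>The Sonin energy and the maximum before the first zero\<close>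

lemma DERIV_powr_product:
  fixes u :: real
  assumes "0 < u" "u < 1"
  shows "((\<lambda>u. u powr b * (1 - u) powr a) has_real_derivative
     u powr b * (1 - u) powr a * (b / u - a / (1 - u))) (at u)"
proof -
  have "((\<lambda>u. u powr b) has_real_derivative b * u powr (b - 1)) (at u)"
    using assms by (intro has_real_derivative_powr) auto
  moreover have "((\<lambda>u. (1 - u) powr a) has_real_derivative a * (1 - u) powr (a - 1) * (- 1)) (at u)"
  proof (rule DERIV_chain2[where g = "\<lambda>u. 1 - u"])
    show "((\<lambda>x. x powr a) has_real_derivative a * (1 - u) powr (a - 1)) (at (1 - u))"
      using assms by (intro has_real_derivative_powr) auto
    show "((\<lambda>u. 1 - u) has_real_derivative - 1) (at u)"
      by (auto intro!: derivative_eq_intros)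
  qed
  ultimately have "((\<lambda>u. u powr b * (1 - u) powr a) has_real_derivative
      b * u powr (b - 1) * (1 - u) powr a + a * (1 - u) powr (a - 1) * (- 1) * u powr b) (at u)"
    by (rule DERIV_mult)
  also have "b * u powr (b - 1) * (1 - u) powr a + a * (1 - u) powr (a - 1) * (- 1) * u powr b =
      u powr b * (1 - u) powr a * (b / u - a / (1 - u))"
    using assms by (simp add: powr_diff field_simps)
  finally show ?thesis .
qed

lemma DERIV_square:
  "(f has_real_derivative d) (at x) \<Longrightarrow> ((\<lambda>x. (f x)\<^sup>2) has_real_derivative 2 * f x * d) (at x)"
  by (auto intro!: derivative_eq_intros)

text \<open>For E = w (L^2 + W F^2) with w = u^b (1 - u)^a, this says that E' / w reduces to the
  single term W' F^2. After multiplication by q = u (1 - u), the second derivative is eliminated by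
  the equation and q F1 by the definition of L.\<close>

lemma sonin_algebra:
  fixes u a b lam F F1 F2 B L q W w :: real
  assumes u: "0 < u" "u < 1"
    and ode: "u * (1 - u) * F2 + (b + 1 - (a + b + 2) * u) * F1 + Lam * F = 0"
    and lam: "lam = Lam + (a + b) * (a + b + 2) / 4"
    and L: "L = (b * (1 - u) - a * u) / 2 * F + u * (1 - u) * F1"
    and W: "W = lam * u * (1 - u) - a\<^sup>2 * u / 4 - b\<^sup>2 * (1 - u) / 4"
  shows "(b / u - a / (1 - u)) * (L\<^sup>2 + W * F\<^sup>2) +
    2 * L * (- (a + b) / 2 * F + (b * (1 - u) - a * u) / 2 * F1 + (1 - 2 * u) * F1 + u * (1 - u) * F2) +
     2 * W * F * F1 = 0"
proof -
  define B where "B = (b * (1 - u) - a * u) / 2"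
  define q where "q = u * (1 - u)"
  have q: "q > 0" using u by (simp add: q_def)
  have e1: "b / u - a / (1 - u) = 2 * B / q" using u by (simp add: B_def q_def field_simps)
  have e2: "q * F2 = - (2 * B + (1 - 2 * u)) * F1 - Lam * F"
    using ode by (simp add: B_def q_def field_simps)
  have e3: "- (a + b) / 2 * F + B * F1 + (1 - 2 * u) * F1 + q * F2 = - ((a + b) / 2 + Lam) * F - B * F1"
    unfolding e2 by (simp add: field_simps)
  have e4: "q * F1 = L - B * F" by (simp add: L B_def q_def)
  \<comment> \<open>The shift from \<open>Lam\<close> to \<open>lam\<close> is the one that
    completes the square.\<close>
  have e5: "W = q * (Lam + (a + b) / 2) - B\<^sup>2"
    unfolding W lam B_def q_def power2_eq_square by (simp add: field_simps)
  have "q * (2 * B / q * (L\<^sup>2 + W * F\<^sup>2) + 2 * L * (- ((a + b) / 2 + Lam) * F - B * F1) + 2 * W * F * F1)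
    = 2 * B * (L\<^sup>2 + W * F\<^sup>2) + 2 * L * (- q * ((a + b) / 2 + Lam) * F - B * (q * F1)) + 2 * W * F * (q * F1)"
    using q by (simp add: field_simps)
  also have "\<dots> = 0"
    unfolding e4 e5 power2_eq_square by (simp add: field_simps)
  finally have "2 * B / q * (L\<^sup>2 + W * F\<^sup>2) + 2 * L * (- ((a + b) / 2 + Lam) * F - B * F1) + 2 * W * F * F1 = 0"
    using q by simp
  then show ?thesis unfolding e1 e3[unfolded B_def q_def] by (simp only: B_def)
qed

text \<open>\<open>y0\<close> is the point at which the bound is wanted; the comparison of maxima
  stays in [0, y0] and thus away from the singular endpoint 1.\<close>

locale jacobi_sonin =
  fixes n :: nat and a b y0 :: real
  assumes a0: "a \<ge> 0" and b0: "b > 0" and y0: "0 < y0" "y0 < 1"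
begin

text \<open>With \<open>f = u\<^bsup>b/2\<^esup> (1 - u)\<^bsup>a/2\<^esup> F\<close> one has \<open>h = f\<^sup>2\<close> and \<open>w L\<^sup>2 = (u (1 - u) f')\<^sup>2\<close>, and \<open>f\<close> solves
  \<open>u (1 - u) (u (1 - u) f')' = - W f\<close>; hence \<open>E' = W' h\<close>.\<close>

definition F where "F = poly (jacobi_poly n a b)"
definition F1 where "F1 = poly (pderiv (jacobi_poly n a b))"
definition F2 where "F2 = poly (pderiv (pderiv (jacobi_poly n a b)))"
definition Lam where "Lam = real n * (real n + a + b + 1)"
definition lam where "lam = Lam + (a + b) * (a + b + 2) / 4"
definition w where "w u = u powr b * (1 - u) powr a" for u :: real
definition h where "h u = w u * (F u)\<^sup>2" for u :: real
definition L where "L u = (b * (1 - u) - a * u) / 2 * F u + u * (1 - u) * F1 u" for u :: real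
definition W where "W u = lam * u * (1 - u) - a\<^sup>2 * u / 4 - b\<^sup>2 * (1 - u) / 4" for u :: real
definition W' where "W' u = lam * (1 - 2 * u) - (a\<^sup>2 - b\<^sup>2) / 4" for u :: real
definition E where "E u = w u * ((L u)\<^sup>2 + W u * (F u)\<^sup>2)" for u :: real

lemma ode: "u * (1 - u) * F2 u + (b + 1 - (a + b + 2) * u) * F1 u + Lam * F u = 0"
  using jacobi_poly_ode[of b u n a] b0 by (simp add: F_def F1_def F2_def Lam_def)

lemma DERIV_F [derivative_intros]: "(F has_real_derivative F1 u) (at u)"
  unfolding F_def F1_def by (rule poly_DERIV)

lemma DERIV_F1 [derivative_intros]: "(F1 has_real_derivative F2 u) (at u)"
  unfolding F1_def F2_def by (rule poly_DERIV)

lemma DERIV_w: "0 < u \<Longrightarrow> u < 1 \<Longrightarrow> (w has_real_derivative w u * (b / u - a / (1 - u))) (at u)"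
  using DERIV_powr_product[of u b a] by (simp add: w_def[abs_def])

lemma DERIV_L: "(L has_real_derivative - (a + b) / 2 * F u + (b * (1 - u) - a * u) / 2 * F1 u
    + (1 - 2 * u) * F1 u + u * (1 - u) * F2 u) (at u)"
  unfolding L_def[abs_def]
  by (rule derivative_eq_intros refl | simp)+ (simp add: algebra_simps add_divide_distrib diff_divide_distrib)

lemma DERIV_W: "(W has_real_derivative W' u) (at u)"
  unfolding W_def[abs_def] W'_def
  by (rule derivative_eq_intros refl | simp)+ (simp add: algebra_simps add_divide_distrib diff_divide_distrib)

lemma DERIV_E:
  assumes "0 < u" "u < 1"
  shows "(E has_real_derivative W' u * h u) (at u)"
proof -
  let ?L' = "- (a + b) / 2 * F u + (b * (1 - u) - a * u) / 2 * F1 u + (1 - 2 * u) * F1 u + u * (1 - u) * F2 u"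
  have "(E has_real_derivative (w u * (b / u - a / (1 - u))) * ((L u)\<^sup>2 + W u * (F u)\<^sup>2)
     + (2 * L u * ?L' + (W' u * (F u)\<^sup>2 + 2 * F u * F1 u * W u)) * w u) (at u)"
    using DERIV_mult[OF DERIV_w[OF assms] DERIV_add[OF DERIV_square[OF DERIV_L] DERIV_mult[OF DERIV_W DERIV_square[OF DERIV_F]]]]
    by (simp only: E_def[abs_def])
  also have "(w u * (b / u - a / (1 - u))) * ((L u)\<^sup>2 + W u * (F u)\<^sup>2)
     + (2 * L u * ?L' + (W' u * (F u)\<^sup>2 + 2 * F u * F1 u * W u)) * w u
     = w u * ((b / u - a / (1 - u)) * ((L u)\<^sup>2 + W u * (F u)\<^sup>2) + 2 * L u * ?L' + 2 * W u * F u * F1 u)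
      + W' u * h u"
    by (simp only: h_def) (simp only: algebra_simps)
  also have "\<dots> = W' u * h u"
    by (subst sonin_algebra[OF assms ode lam_def L_def W_def]) simp
  finally show ?thesis .
qed

lemma DERIV_h:
  assumes "0 < u" "u < 1"
  shows "(h has_real_derivative w u / (u * (1 - u)) * (2 * F u * L u)) (at u)"
proof -
  have "(h has_real_derivative w u * (b / u - a / (1 - u)) * (F u)\<^sup>2 + (2 * F u * F1 u) * w u) (at u)"
    using DERIV_mult[OF DERIV_w[OF assms] DERIV_square[OF DERIV_F]] by (simp only: h_def[abs_def])
  also have "w u * (b / u - a / (1 - u)) * (F u)\<^sup>2 + (2 * F u * F1 u) * w u
      = w u / (u * (1 - u)) * (2 * F u * L u)"
    using assms by (simp add: L_def power2_eq_square divide_simps) (simp add: algebra_simps)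
  finally show ?thesis .
qed

lemma cont_F: "continuous_on S F" and cont_F1: "continuous_on S F1"
  unfolding F_def F1_def by (auto intro!: continuous_intros)

lemma cont_w: "continuous_on {0..y0} w"
  unfolding w_def[abs_def] using b0 y0 by (intro continuous_on_mult continuous_on_powr' continuous_intros) auto

lemma cont_h: "continuous_on {0..y0} h"
  unfolding h_def[abs_def] by (intro continuous_intros cont_w cont_F)

lemma cont_E: "continuous_on {0..y0} E"
  unfolding E_def[abs_def] L_def[abs_def] W_def[abs_def] by (intro continuous_intros cont_w cont_F cont_F1) auto

lemma w_pos: "0 < u \<Longrightarrow> u < 1 \<Longrightarrow> w u > 0"
  by (simp add: w_def)

lemma F_0: "F 0 = 1" by (simp add: F_def)

lemma Lam_nonneg: "Lam \<ge> 0" using a0 b0 by (simp add: Lam_def)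

lemma lam_pos: "lam > 0"
  unfolding lam_def using Lam_nonneg a0 b0 by (intro add_nonneg_pos divide_pos_pos mult_pos_pos) auto

lemma E_0: "E 0 = 0" and h_0: "h 0 = 0"
  using b0 by (simp_all add: E_def h_def w_def)

text \<open>\<open>W'\<close> is affine with slope -2 \<open>lam\<close> < 0, so a sign condition at
  the single point \<open>y0\<close> controls everything to its left.\<close>

lemma W'_pos:
  assumes "W' y0 \<ge> 0" "u < y0"
  shows "W' u > 0"
proof -
  have "W' u - W' y0 = 2 * lam * (y0 - u)" by (simp add: W'_def algebra_simps)
  moreover have "2 * lam * (y0 - u) > 0" using lam_pos assms by simp
  ultimately show ?thesis using assms by linarith
qed

text \<open>\<open>E\<close> vanishes at 0 and its derivative \<open>W' u * h u\<close> is positive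
  as long as F has no zero.\<close>

lemma E_pos:
  assumes "W' y0 \<ge> 0" "0 < x" "x \<le> y0" "\<And>u. 0 < u \<Longrightarrow> u < x \<Longrightarrow> F u > 0"
  shows "E x > 0"
proof -
  have "continuous_on {0..x} E" using cont_E by (rule continuous_on_subset) (use assms in auto)
  moreover have "(E has_derivative (\<lambda>t. W' u * h u * t)) (at u)" if "0 < u" "u < x" for u
    using DERIV_E[of u] that assms y0 by (simp add: has_field_derivative_def)
  ultimately obtain u where u: "0 < u" "u < x" "E x - E 0 = W' u * h u * (x - 0)"
    using mvt[of 0 x E "\<lambda>u t. W' u * h u * t"] assms by auto
  have "F u > 0" "w u > 0" "W' u > 0" using assms(4)[of u] w_pos[of u] W'_pos[of u] u assms(1-3) y0 by auto
  then have "W' u > 0" "h u > 0" by (simp_all add: h_def)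
  then show ?thesis using u E_0 assms by simp
qed

text \<open>If F has a zero in [0, y0], let xe be the place of the largest h before the first one.
  There L = 0, hence E = W h, and positivity of E forces W(xe) > 0. This sign is what makes the
  maximum at xe dominate all later values of h.\<close>

lemma max_before_first_zero:
  assumes "W' y0 \<ge> 0"
  obtains x where "0 < x" "x \<le> y0" "\<And>u. 0 \<le> u \<Longrightarrow> u \<le> x \<Longrightarrow> F u > 0" "h y0 \<le> h x"
proof (cases "\<exists>u\<in>{0..y0}. F u = 0")
  case False
  have "F u > 0" if "0 \<le> u" "u \<le> y0" for u
  proof (rule ccontr)
    assume "\<not> F u > 0"
    then have "\<exists>v. 0 \<le> v \<and> v \<le> u \<and> F v = 0"
      using that by (intro IVT2' cont_F) (auto simp: F_0)
    then show False using False that by auto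
  qed
  then show ?thesis using that[of y0] y0 by auto
next
  case True
  define Z where "Z = {u \<in> {0..y0}. F u = 0}"
  have "closed Z" unfolding Z_def
    by (intro continuous_closed_preimage_constant cont_F) auto
  moreover have Zb: "Z \<noteq> {}" "bdd_below Z" using True by (auto simp: Z_def)
  ultimately have "Inf Z \<in> Z" by (rule closed_contains_Inf[rotated 2])
  define z where "z = Inf Z"
  have z: "0 \<le> z" "z \<le> y0" "F z = 0" using \<open>Inf Z \<in> Z\<close> by (auto simp: z_def Z_def)
  then have z0: "0 < z" using F_0 by (cases "z = 0") auto
  have nz: "F u \<noteq> 0" if "0 \<le> u" "u < z" for u
    using that cInf_lower[OF _ Zb(2), of u] z by (auto simp: Z_def z_def)
  have pos: "F u > 0" if "0 \<le> u" "u < z" for u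
  proof (rule ccontr)
    assume "\<not> F u > 0"
    then have "\<exists>v. 0 \<le> v \<and> v \<le> u \<and> F v = 0"
      using that by (intro IVT2' cont_F) (auto simp: F_0)
    then show False using nz that by fastforce
  qed
  obtain xe where xe: "xe \<in> {0..z}" "\<And>u. u \<in> {0..z} \<Longrightarrow> h u \<le> h xe"
    using continuous_attains_sup[of "{0..z}" h] z z0 continuous_on_subset[OF cont_h, of "{0..z}"] by auto
  have "h (z / 2) > 0" using pos[of "z / 2"] w_pos[of "z / 2"] z z0 y0 by (simp add: h_def)
  then have "h xe > 0" using xe(2)[of "z / 2"] z0 by auto
  then have xe': "0 < xe" "xe < z" using xe(1) h_0 z(3)
    by (auto simp: less_le h_def)
  have Lxe: "L xe = 0"
  proof -
    have "w xe / (xe * (1 - xe)) * (2 * F xe * L xe) = 0"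
    proof (rule DERIV_local_max)
      show "(h has_real_derivative w xe / (xe * (1 - xe)) * (2 * F xe * L xe)) (at xe)"
        using xe' z y0 by (intro DERIV_h) auto
      show "0 < min xe (z - xe)" using xe' by simp
      show "\<forall>y. \<bar>xe - y\<bar> < min xe (z - xe) \<longrightarrow> h y \<le> h xe"
        by (intro allI impI xe(2)) (auto simp: abs_less_iff)
    qed
    then show ?thesis using pos[of xe] w_pos[of xe] xe' z y0 by auto
  qed
  have "E xe > 0" using assms xe' z pos by (intro E_pos) auto
  then have Wxe: "W xe > 0"
    using w_pos[of xe] xe' z y0 by (auto simp: E_def Lxe zero_less_mult_iff)
  obtain xm where xm: "xm \<in> {xe..y0}" "\<And>u. u \<in> {xe..y0} \<Longrightarrow> h u \<le> h xm"
    using continuous_attains_sup[of "{xe..y0}" h] z xe' continuous_on_subset[OF cont_h, of "{xe..y0}"] by auto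
  \<comment> \<open>A comparison function in place of the usual quotient by W. Its derivative is W'
    (h - c) \<le> 0 with c = \<open>h xm\<close>; its value is W(xe) (h(xe) - c) at xe and w L^2
    \<ge> 0 at xm.\<close>
  define D where "D u = E u - h xm * W u" for u
  have "D xm \<le> D xe"
  proof (rule DERIV_nonpos_imp_nonincreasing[of xe xm D])
    show "xe \<le> xm" using xm by auto
    fix u assume u: "xe \<le> u" "u \<le> xm"
    then have u': "0 < u" "u < 1" "u \<le> y0" using xe' xm y0 by auto
    have "(D has_real_derivative W' u * h u - h xm * W' u) (at u)"
      unfolding D_def[abs_def] by (intro DERIV_diff DERIV_E DERIV_cmult DERIV_W u')
    moreover have "W' u * h u - h xm * W' u \<le> 0"
    proof -
      have "h u \<le> h xm" using xm u by auto
      moreover have "W' u \<ge> 0" using W'_pos[of u] assms u' by (cases "u = y0") auto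
      ultimately show ?thesis by (simp add: mult.commute[of "h xm"] mult_left_mono)
    qed
    ultimately show "\<exists>y. (D has_real_derivative y) (at u) \<and> y \<le> 0" by blast
  qed
  moreover have "D xe = W xe * (h xe - h xm)" by (simp add: D_def E_def h_def Lxe algebra_simps)
  moreover have "D xm \<ge> 0"
  proof -
    have "D xm = w xm * (L xm)\<^sup>2" by (simp add: D_def E_def h_def algebra_simps)
    moreover have "w xm > 0" using xm xe' y0 by (intro w_pos) auto
    ultimately show ?thesis by simp
  qed
  ultimately have "h xm \<le> h xe" using Wxe by (metis diff_ge_0_iff_ge order_trans zero_le_mult_iff not_le)
  then have "h y0 \<le> h xe" using xm(2)[of y0] xe' z by auto
  then show ?thesis using that[of xe] xe' z pos by auto
qed

text \<open>In Sturm-Liouville form the equation reads (u^(b + 1) (1 - u)^(a + 1) F')' = - Lam w F.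
  The bracket vanishes at 0 and does not increase while F is positive.\<close>

lemma F1_nonpos:
  assumes "0 < x" "x \<le> y0" "\<And>u. 0 \<le> u \<Longrightarrow> u \<le> x \<Longrightarrow> F u > 0"
  shows "F1 x \<le> 0"
proof -
  define G where "G u = u powr (b + 1) * (1 - u) powr (a + 1) * F1 u" for u :: real
  have "\<exists>u\<in>{0<..<x}. G x - G 0 = - (Lam * w u * F u) * (x - 0)"
  proof (rule mvt)
    show "continuous_on {0..x} G"
      unfolding G_def[abs_def] using b0 y0 assms
      by (intro continuous_on_mult continuous_on_powr' continuous_intros cont_F1) auto
    fix u assume u: "0 < u" "u < x"
    have u': "0 < u" "u < 1" using u assms y0 by auto
    let ?v = "u powr (b + 1) * (1 - u) powr (a + 1)"
    have "(G has_real_derivative ?v * ((b + 1) / u - (a + 1) / (1 - u)) * F1 u + F2 u * ?v) (at u)"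
      unfolding G_def[abs_def] by (intro DERIV_mult DERIV_powr_product DERIV_F1 u')
    also have "?v * ((b + 1) / u - (a + 1) / (1 - u)) * F1 u + F2 u * ?v =
       w u * (u * (1 - u) * F2 u + (b + 1 - (a + b + 2) * u) * F1 u)"
    proof -
      have v: "?v = w u * (u * (1 - u))" using u' by (simp add: w_def powr_add mult_ac)
      have "u * (1 - u) * ((b + 1) / u - (a + 1) / (1 - u)) = b + 1 - (a + b + 2) * u"
        using u' by (simp add: field_simps)
      then have vK: "?v * ((b + 1) / u - (a + 1) / (1 - u)) = w u * (b + 1 - (a + b + 2) * u)"
        unfolding v by (simp only: mult.assoc)
      have "w u * (b + 1 - (a + b + 2) * u) * F1 u + F2 u * (w u * (u * (1 - u))) =
         w u * (u * (1 - u) * F2 u + (b + 1 - (a + b + 2) * u) * F1 u)"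
        by (simp only: ring_distribs mult_ac add_ac)
      then show ?thesis unfolding vK by (simp only: v)
    qed
    also have "\<dots> = - (Lam * w u * F u)"
    proof -
      have "u * (1 - u) * F2 u + (b + 1 - (a + b + 2) * u) * F1 u = - (Lam * F u)"
        using ode[of u] by linarith
      then show ?thesis by simp
    qed
    finally show "(G has_derivative (*) (- (Lam * w u * F u))) (at u)"
      by (simp add: has_field_derivative_def)
  qed (use assms in auto)
  then obtain u where u: "0 < u" "u < x" "G x - G 0 = - (Lam * w u * F u) * (x - 0)" by auto
  have "F u > 0" "w u > 0" using assms(3)[of u] w_pos[of u] u assms(1,2) y0 by auto
  then have "0 \<le> Lam * w u * F u"
    using Lam_nonneg by simp
  then have "G x \<le> 0" using u assms b0 by (simp add: G_def)
  then show ?thesis using assms y0 by (auto simp: G_def mult_le_0_iff)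
qed

text \<open>On [0, x] the factors (1 - u)^a and F^2 are at least their values at x. Hence the part
  of the integral over [0, x] is at least C x^b / b = h(x) / b.\<close>

lemma h_le_integral:
  assumes "W' y0 \<ge> 0"
    and V: "((\<lambda>u. u powr (b - 1) * (1 - u) powr a * (F u)\<^sup>2) has_integral V) {0..1}"
  shows "h y0 \<le> b * V"
proof -
  obtain x where x: "0 < x" "x \<le> y0" "\<And>u. 0 \<le> u \<Longrightarrow> u \<le> x \<Longrightarrow> F u > 0" "h y0 \<le> h x"
    using max_before_first_zero[OF assms(1)] by blast
  define C where "C = (1 - x) powr a * (F x)\<^sup>2"
  have decr: "F x \<le> F u" if "0 \<le> u" "u \<le> x" for u
  proof (rule DERIV_nonpos_imp_decreasing_open[of u x F])
    fix v assume v: "u < v" "v < x"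
    then show "\<exists>y. (F has_real_derivative y) (at v) \<and> y \<le> 0"
      using x that by (intro exI[of _ "F1 v"] conjI DERIV_F F1_nonpos) auto
  qed (use that in \<open>auto intro!: cont_F\<close>)
  let ?f = "\<lambda>u. u powr (b - 1) * (1 - u) powr a * (F u)\<^sup>2"
  have "((\<lambda>u. C * u powr (b - 1)) has_integral C * (x powr (b - 1 + 1) / (b - 1 + 1))) {0..x}"
    by (rule has_integral_mult_right[OF has_integral_powr_from_0]) (use b0 x(1) in simp_all)
  moreover have int: "?f integrable_on {0..x}"
  proof (rule integrable_on_subinterval)
    show "?f integrable_on {0..1}" using V by blast
    show "{0..x} \<subseteq> {0..1}" using x(1,2) y0 by auto
  qed
  ultimately have "C * (x powr (b - 1 + 1) / (b - 1 + 1)) \<le> integral {0..x} ?f"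
  proof (rule has_integral_le[OF _ integrable_integral])
    fix u assume u: "u \<in> {0..x}"
    have "C \<le> (1 - u) powr a * (F u)\<^sup>2"
      unfolding C_def using u x(3)[of x] decr[of u] x(1,2) y0 a0
      by (intro mult_mono powr_mono2 power_mono) auto
    then have "u powr (b - 1) * C \<le> u powr (b - 1) * ((1 - u) powr a * (F u)\<^sup>2)"
      by (rule mult_left_mono) simp
    then show "C * u powr (b - 1) \<le> ?f u"
      by (simp only: mult_ac)
  qed
  also have "\<dots> \<le> integral {0..1} ?f"
    using x(1,2) y0 V int by (intro integral_subset_le) auto
  also have "\<dots> = V" using V by blast
  finally have "C * x powr b \<le> b * V" using b0 by (simp add: field_simps)
  moreover have "h x = C * x powr b" by (simp add: h_def w_def C_def)
  ultimately show ?thesis using x by simp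
qed

end

text \<open>Unlike the power basis, this form is symmetric under exchanging \<open>(a, y)\<close> and \<open>(b, 1 - y)\<close>, which
  turns a bound on one side of a point into a bound on the other.\<close>

definition jacobi_bernstein :: "nat \<Rightarrow> real \<Rightarrow> real \<Rightarrow> real \<Rightarrow> real" where
  "jacobi_bernstein n a b y = (\<Sum>j\<le>n. (-1) ^ j * real (n choose j) * y ^ j * (1 - y) ^ (n - j) /
     (Gamma (b + 1 + real j) * Gamma (a + 1 + real (n - j))))"

text \<open>Kept squared, so that no roots of Gamma quotients appear; the prefactor is symmetric in
  a and b, as the reflection requires.\<close>

definition jacobi_fun_sq :: "nat \<Rightarrow> real \<Rightarrow> real \<Rightarrow> real \<Rightarrow> real" where
  "jacobi_fun_sq n a b y = Gamma (real n + a + 1) * Gamma (real n + b + 1) * Gamma (real n + a + b + 1) / fact n *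
     (y powr b * (1 - y) powr a * (jacobi_bernstein n a b y)\<^sup>2)"

section \<open>Reflection symmetry and the uniform bound for Jacobi functions\<close>

lemma jacobi_bernstein_reflect: "jacobi_bernstein n b a (1 - y) = (-1) ^ n * jacobi_bernstein n a b y"
  unfolding jacobi_bernstein_def sum_distrib_left
proof (rule sum.reindex_bij_witness[of _ "\<lambda>j. n - j" "\<lambda>j. n - j"])
  fix j assume j: "j \<in> {..n}"
  then have "(-1) ^ n * (-1) ^ (n - j) = ((-1) ^ j :: real)"
    by (metis atMost_iff diff_diff_cancel diff_le_self minus_one_power_iff mult.commute mult_minus1 power_add
        le_add_diff_inverse2 left_minus_one_mult_self)
  then show "(-1) ^ n * ((-1) ^ (n - j) * real (n choose (n - j)) * y ^ (n - j) * (1 - y) ^ (n - (n - j)) /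
         (Gamma (b + 1 + real (n - j)) * Gamma (a + 1 + real (n - (n - j))))) =
      (-1) ^ j * real (n choose j) * (1 - y) ^ j * (1 - (1 - y)) ^ (n - j) /
         (Gamma (a + 1 + real j) * Gamma (b + 1 + real (n - j)))"
    using j by (simp add: binomial_symmetric[symmetric] mult.assoc[symmetric]) (simp add: mult_ac)
qed auto

lemma jacobi_fun_sq_reflect: "jacobi_fun_sq n b a (1 - y) = jacobi_fun_sq n a b y"
  unfolding jacobi_fun_sq_def jacobi_bernstein_reflect by (simp add: power_mult_distrib add_ac mult_ac flip: power_mult)

text \<open>The signless twin of \<open>alternating_binomial_sum_Suc\<close>, obtained by absorbing
  (-1)^j into \<open>f\<close>.\<close>

lemma binomial_sum_Suc:
  fixes f :: "nat \<Rightarrow> 'a::comm_ring_1"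
  shows "(\<Sum>j\<le>Suc n. of_nat (Suc n choose j) * f j) = (\<Sum>j\<le>n. of_nat (n choose j) * (f j + f (Suc j)))"
proof -
  have sgn: "(-1) ^ j * c * ((-1) ^ j * z) = c * z" for j :: nat and c z :: 'a
  proof -
    have "(-1) ^ j * c * ((-1) ^ j * z) = ((-1) ^ j * (-1) ^ j) * (c * z)" by (simp only: mult_ac)
    then show ?thesis by (simp only: minus_one_mult_self mult_1_left)
  qed
  have diff: "(-1) ^ j * f j - (-1) ^ Suc j * f (Suc j) = (-1) ^ j * (f j + f (Suc j))" for j
    by (simp add: distrib_left)
  have "(\<Sum>j\<le>Suc n. of_nat (Suc n choose j) * f j) = (\<Sum>j\<le>Suc n. (-1) ^ j * of_nat (Suc n choose j) * ((-1) ^ j * f j))"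
    by (simp only: sgn)
  also have "\<dots> = (\<Sum>j\<le>n. of_nat (n choose j) * (f j + f (Suc j)))"
    by (subst alternating_binomial_sum_Suc) (simp only: diff sgn)
  finally show ?thesis .
qed

text \<open>Chu-Vandermonde for reciprocal Gamma values. Two neighbouring terms add up to x + c - 1
  times the term with x replaced by x + 1, so Pascal's rule gives an induction on k; c > k keeps all
  Gamma arguments positive.\<close>

lemma Vandermonde_Gamma:
  fixes x c :: real
  assumes "x > 0" "c > real k"
  shows "(\<Sum>j\<le>k. real (k choose j) * (1 / (Gamma (x + real j) * Gamma (c - real j)))) =
     pochhammer (x + c - 1) k / (Gamma (x + real k) * Gamma c)"
  using assms
proof (induction k arbitrary: x)
  case 0
  then show ?case by simp
next
  case (Suc k)
  have step: "1 / (Gamma (x + real j) * Gamma (c - real j)) + 1 / (Gamma (x + real (Suc j)) * Gamma (c - real (Suc j)))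
    = (x + c - 1) * (1 / (Gamma ((x + 1) + real j) * Gamma (c - real j)))" if "j \<le> k" for j
  proof -
    have p: "x + real j > 0" "c - real j - 1 > 0" using Suc.prems that by auto
    have g1: "Gamma ((x + 1) + real j) = (x + real j) * Gamma (x + real j)"
      using Gamma_plus1_pos[OF p(1)] by (simp add: add_ac)
    have g2: "Gamma (c - real j) = (c - real j - 1) * Gamma (c - real j - 1)"
      using Gamma_plus1_pos[OF p(2)] by simp
    have "1 / (A * (v * B)) + 1 / (u * A * B) = (u + v) * (1 / (u * A * (v * B)))"
      if "A \<noteq> 0" "B \<noteq> 0" "u \<noteq> 0" "v \<noteq> 0" for A B u v :: real
      using that by (simp add: field_simps)
    from this[OF Gamma_pos_nonzero[OF p(1)] Gamma_pos_nonzero[OF p(2)], of "x + real j" "c - real j - 1"]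
    show ?thesis using p g1 by (simp add: g1 g2 algebra_simps)
  qed
  have "(\<Sum>j\<le>Suc k. real (Suc k choose j) * (1 / (Gamma (x + real j) * Gamma (c - real j)))) =
     (\<Sum>j\<le>k. real (k choose j) * ((x + c - 1) * (1 / (Gamma ((x + 1) + real j) * Gamma (c - real j)))))"
    unfolding binomial_sum_Suc by (intro sum.cong refl) (simp only: step atMost_iff)
  also have "\<dots> = (x + c - 1) * (\<Sum>j\<le>k. real (k choose j) * (1 / (Gamma ((x + 1) + real j) * Gamma (c - real j))))"
    unfolding sum_distrib_left by (intro sum.cong refl) simp
  also have "\<dots> = (x + c - 1) * (pochhammer (x + 1 + c - 1) k / (Gamma (x + 1 + real k) * Gamma c))"
    using Suc.prems by (subst Suc.IH) auto
  also have "\<dots> = pochhammer (x + c - 1) (Suc k) / (Gamma (x + real (Suc k)) * Gamma c)"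
    by (simp add: pochhammer_rec add_ac)
  finally show ?case .
qed

text \<open>Expanding (1 - y)^(n - j) and collecting powers of y leaves, at y^k, a Vandermonde sum
  with x = b + 1 and c = a + 1 + n.\<close>

lemma jacobi_bernstein_eq:
  assumes "a \<ge> 0" "b \<ge> 0"
  shows "jacobi_bernstein n a b y = poly (jacobi_poly n a b) y / (Gamma (b + 1) * Gamma (real n + a + 1))"
proof -
  define u where "u j = 1 / (Gamma (b + 1 + real j) * Gamma (a + 1 + real n - real j))" for j
  have "jacobi_bernstein n a b y = (\<Sum>j\<le>n. \<Sum>i\<le>n - j. (-1) ^ (j + i) * real (n choose j) * real (n - j choose i) * y ^ (j + i) * u j)"
    unfolding jacobi_bernstein_def
  proof (intro sum.cong refl)
    fix j assume j: "j \<in> {..n}"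
    have "(1 - y) ^ (n - j) = (\<Sum>i\<le>n - j. real (n - j choose i) * ((-1) ^ i * y ^ i))"
      using binomial_ring[of "- y" 1 "n - j"] by (simp add: power_minus[of y])
    moreover have "1 / (Gamma (b + 1 + real j) * Gamma (a + 1 + real (n - j))) = u j"
      using j by (simp add: u_def of_nat_diff add_diff_eq)
    ultimately have "(-1) ^ j * real (n choose j) * y ^ j * (1 - y) ^ (n - j) *
        (1 / (Gamma (b + 1 + real j) * Gamma (a + 1 + real (n - j)))) =
        (-1) ^ j * real (n choose j) * y ^ j * (\<Sum>i\<le>n - j. real (n - j choose i) * ((-1) ^ i * y ^ i)) * u j"
      by (simp only:)
    also have "\<dots> = (\<Sum>i\<le>n - j. (-1) ^ (j + i) * real (n choose j) * real (n - j choose i) * y ^ (j + i) * u j)"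
      by (simp add: sum_distrib_left sum_distrib_right power_add mult_ac)
    finally show "(-1) ^ j * real (n choose j) * y ^ j * (1 - y) ^ (n - j) /
        (Gamma (b + 1 + real j) * Gamma (a + 1 + real (n - j))) =
      (\<Sum>i\<le>n - j. (-1) ^ (j + i) * real (n choose j) * real (n - j choose i) * y ^ (j + i) * u j)"
      by simp
  qed
  also have "\<dots> = (\<Sum>k\<le>n. \<Sum>j\<le>k. (-1) ^ k * real (n choose j) * real (n - j choose (k - j)) * y ^ k * u j)"
    unfolding sum.Sigma[OF finite_atMost ballI[OF finite_atMost]]
    by (rule sum.reindex_bij_witness[of _ "\<lambda>(k, j). (j, k - j)" "\<lambda>(j, i). (j + i, j)"]) auto
  also have "\<dots> = (\<Sum>k\<le>n. (-1) ^ k * real (n choose k) * y ^ k * (\<Sum>j\<le>k. real (k choose j) * u j))"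
  proof (intro sum.cong refl)
    fix k assume k: "k \<in> {..n}"
    have c: "real (n choose j) * real (n - j choose (k - j)) = real (n choose k) * real (k choose j)" if "j \<le> k" for j
      using choose_mult[of j k n] that k by (metis atMost_iff of_nat_mult)
    have "(\<Sum>j\<le>k. (-1) ^ k * real (n choose j) * real (n - j choose (k - j)) * y ^ k * u j) =
      (\<Sum>j\<le>k. (-1) ^ k * (real (n choose j) * real (n - j choose (k - j))) * y ^ k * u j)"
      by (simp only: mult.assoc)
    also have "\<dots> = (\<Sum>j\<le>k. (-1) ^ k * (real (n choose k) * real (k choose j)) * y ^ k * u j)"
      by (intro sum.cong refl) (simp add: c)
    finally show "(\<Sum>j\<le>k. (-1) ^ k * real (n choose j) * real (n - j choose (k - j)) * y ^ k * u j) =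
       (-1) ^ k * real (n choose k) * y ^ k * (\<Sum>j\<le>k. real (k choose j) * u j)"
      by (simp add: sum_distrib_left mult_ac)
  qed
  also have "\<dots> = (\<Sum>k\<le>n. (-1) ^ k * real (n choose k) * pochhammer (real n + a + b + 1) k / pochhammer (b + 1) k * y ^ k /
      (Gamma (b + 1) * Gamma (real n + a + 1)))"
  proof (intro sum.cong refl)
    fix k assume k: "k \<in> {..n}"
    have "(\<Sum>j\<le>k. real (k choose j) * u j) = pochhammer (b + 1 + (a + 1 + real n) - 1) k / (Gamma (b + 1 + real k) * Gamma (a + 1 + real n))"
      unfolding u_def using assms k by (intro Vandermonde_Gamma) auto
    also have "Gamma (b + 1 + real k) = pochhammer (b + 1) k * Gamma (b + 1)"
      using assms Gamma_pos_nonzero[of "b + 1"] by (subst pochhammer_Gamma_pos) auto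
    finally show "(-1) ^ k * real (n choose k) * y ^ k * (\<Sum>j\<le>k. real (k choose j) * u j) =
       (-1) ^ k * real (n choose k) * pochhammer (real n + a + b + 1) k / pochhammer (b + 1) k * y ^ k /
      (Gamma (b + 1) * Gamma (real n + a + 1))"
      by (simp add: add_ac mult_ac)
  qed
  also have "\<dots> = poly (jacobi_poly n a b) y / (Gamma (b + 1) * Gamma (real n + a + 1))"
    by (simp only: poly_jacobi_poly sum_divide_distrib)
  finally show ?thesis .
qed

lemma jacobi_fun_sq_eq:
  assumes "a \<ge> 0" "b \<ge> 0"
  shows "jacobi_fun_sq n a b y = Gamma (real n + b + 1) * Gamma (real n + a + b + 1) /
     (fact n * Gamma (real n + a + 1) * (Gamma (b + 1))\<^sup>2) * (y powr b * (1 - y) powr a * (poly (jacobi_poly n a b) y)\<^sup>2)"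
proof -
  have "g * X * Y / f * (v * (P / (B * g))\<^sup>2) = X * Y / (f * g * B\<^sup>2) * (v * P\<^sup>2)"
    if "g \<noteq> 0" "B \<noteq> 0" "f \<noteq> 0" for g X Y f v P B :: real
    using that by (simp add: field_simps power2_eq_square)
  then show ?thesis
    using Gamma_pos_nonzero[of "real n + a + 1"] Gamma_pos_nonzero[of "b + 1"] assms
    by (simp only: jacobi_fun_sq_def jacobi_bernstein_eq) auto
qed

text \<open>The last assumption is \<open>W'\<close> \<ge> 0 at y, written out. Since b Gamma(b) =
  Gamma(b + 1), the bound b V on h is exactly the reciprocal of the normalising constant.\<close>

lemma jacobi_fun_sq_le_1_half:
  assumes "a > 0" "b > 0" "0 < y" "y < 1"
    and "(real n * (real n + a + b + 1) + (a + b) * (a + b + 2) / 4) * (1 - 2 * y) - (a\<^sup>2 - b\<^sup>2) / 4 \<ge> 0"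
  shows "jacobi_fun_sq n a b y \<le> 1"
proof -
  interpret jacobi_sonin n a b y by unfold_locales (use assms in auto)
  have "h y \<le> b * (fact n * Gamma (real n + a + 1) * Gamma (b + 1) * Gamma b / (Gamma (real n + a + b + 1) * Gamma (real n + b + 1)))"
    using assms jacobi_poly_integral[of a b n]
    by (intro h_le_integral) (auto simp: W'_def lam_def Lam_def F_def)
  also have "\<dots> = fact n * Gamma (real n + a + 1) * (Gamma (b + 1))\<^sup>2 / (Gamma (real n + a + b + 1) * Gamma (real n + b + 1))"
    using Gamma_plus1_pos[OF assms(2)] by (simp add: power2_eq_square)
  finally have "y powr b * (1 - y) powr a * (poly (jacobi_poly n a b) y)\<^sup>2 \<le>
    fact n * Gamma (real n + a + 1) * (Gamma (b + 1))\<^sup>2 / (Gamma (real n + a + b + 1) * Gamma (real n + b + 1))"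
    by (simp add: h_def w_def F_def)
  moreover have "Gamma (real n + a + 1) > 0" "Gamma (real n + b + 1) > 0" "Gamma (real n + a + b + 1) > 0" "Gamma (b + 1) > 0"
    using assms by (auto intro!: Gamma_real_pos)
  moreover have "X * Y / (f * g * B\<^sup>2) * z \<le> 1"
    if "z \<le> f * g * B\<^sup>2 / (Y * X)" "X > 0" "Y > 0" "g > 0" "B > 0" "f > 0" for X Y f g B z :: real
    using that by (simp add: pos_le_divide_eq) (simp add: mult_ac)
  ultimately show ?thesis
    using assms fact_gt_zero[of n, where ?'a = real] by (simp only: jacobi_fun_sq_eq[OF less_imp_le less_imp_le])
qed

theorem jacobi_fun_sq_le_1:
  assumes "a \<ge> 0" "b \<ge> 0" "0 < y" "y < 1"
  shows "jacobi_fun_sq n a b y \<le> 1"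
proof -
  \<comment> \<open>The weight \<open>y\<^bsup>b-1\<^esup>\<close> is not integrable for \<open>b = 0\<close>, so the boundary cases are reached by a limit.\<close>
  have pos: "jacobi_fun_sq n a b y \<le> 1" if "a > 0" "b > 0" for a b
  proof (cases "(real n * (real n + a + b + 1) + (a + b) * (a + b + 2) / 4) * (1 - 2 * y) - (a\<^sup>2 - b\<^sup>2) / 4 \<ge> 0")
    case True
    then show ?thesis using that assms by (intro jacobi_fun_sq_le_1_half) auto
  next
    case False
    \<comment> \<open>The sign condition is negated by passing from (a, b, y) to (b, a, 1 - y), so
      it holds in at least one of the two orientations.\<close>
    have "(real n * (real n + b + a + 1) + (b + a) * (b + a + 2) / 4) * (1 - 2 * (1 - y)) - (b\<^sup>2 - a\<^sup>2) / 4 =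
      - ((real n * (real n + a + b + 1) + (a + b) * (a + b + 2) / 4) * (1 - 2 * y) - (a\<^sup>2 - b\<^sup>2) / 4)"
      by (simp add: field_simps)
    then have "jacobi_fun_sq n b a (1 - y) \<le> 1"
      using False that assms by (intro jacobi_fun_sq_le_1_half) auto
    then show ?thesis by (simp add: jacobi_fun_sq_reflect)
  qed
  have "((\<lambda>e. jacobi_fun_sq n (a + e) (b + e) y) \<longlongrightarrow> jacobi_fun_sq n (a + 0) (b + 0) y) (at_right 0)"
    unfolding jacobi_fun_sq_def jacobi_bernstein_def using assms
    by (intro tendsto_intros tendsto_Gamma) (auto intro!: Gamma_pos_nonzero mult_pos_pos elim!: nonpos_Ints_cases)
  moreover have "\<forall>\<^sub>F e in at_right 0. jacobi_fun_sq n (a + e) (b + e) y \<le> 1"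
    unfolding eventually_at_right_field using assms by (intro exI[of _ 1]) (auto intro!: pos)
  ultimately show ?thesis using tendsto_upperbound[of _ _ "at_right 0" 1] by force
qed

section \<open>The space of square summable sequences\<close>

lemma ell2_summable: "u \<in> ell2 \<Longrightarrow> summable (\<lambda>n. (cmod (u n))\<^sup>2)"
  by (simp add: ell2_def)

lemma ell2_norm_nonneg: "ell2_norm u \<ge> 0" if "u \<in> ell2"
  unfolding ell2_norm_def using ell2_summable[OF that] by (intro real_sqrt_ge_zero suminf_nonneg) auto

lemma ell2_norm_square: "u \<in> ell2 \<Longrightarrow> (ell2_norm u)\<^sup>2 = (\<Sum>n. (cmod (u n))\<^sup>2)"
  unfolding ell2_norm_def using ell2_summable[of u] by (intro real_sqrt_pow2 suminf_nonneg) auto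

lemma ell2_partial_sum_le: "u \<in> ell2 \<Longrightarrow> (\<Sum>n<K. (cmod (u n))\<^sup>2) \<le> (ell2_norm u)\<^sup>2"
  unfolding ell2_norm_square using ell2_summable[of u] by (intro sum_le_suminf) auto

lemma ell2_L2_set_le: "u \<in> ell2 \<Longrightarrow> L2_set (\<lambda>n. cmod (u n)) {..<K} \<le> ell2_norm u"
  unfolding L2_set_def using ell2_partial_sum_le[of u K] ell2_norm_nonneg[of u]
  by (intro real_le_lsqrt) (auto intro: sum_nonneg)

lemma ell2_boundedI:
  assumes "C \<ge> 0" "\<And>K. (\<Sum>n<K. (cmod (u n))\<^sup>2) \<le> C\<^sup>2"
  shows "u \<in> ell2" "ell2_norm u \<le> C"
proof -
  have s: "summable (\<lambda>n. (cmod (u n))\<^sup>2)" by (rule summableI_nonneg_bounded[of _ "C\<^sup>2"]) (use assms in auto)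
  then show "u \<in> ell2" by (simp add: ell2_def)
  have "(\<Sum>n. (cmod (u n))\<^sup>2) \<le> C\<^sup>2" using s assms by (intro suminf_le_const) auto
  then show "ell2_norm u \<le> C" unfolding ell2_norm_def using assms s by (intro real_le_lsqrt) (auto intro: suminf_nonneg)
qed

lemma ell2_boundedI_L2_set:
  assumes "\<And>K. L2_set (\<lambda>n. cmod (u n)) {..<K} \<le> C"
  shows "u \<in> ell2" "ell2_norm u \<le> C"
proof -
  have C: "C \<ge> 0" using assms[of 0] by simp
  have "(\<Sum>n<K. (cmod (u n))\<^sup>2) \<le> C\<^sup>2" for K
  proof -
    have "(L2_set (\<lambda>n. cmod (u n)) {..<K})\<^sup>2 \<le> C\<^sup>2" using assms[of K] by (intro power_mono) (auto simp: L2_set_nonneg)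
    then show ?thesis by (simp add: L2_set_def sum_nonneg)
  qed
  then show "u \<in> ell2" "ell2_norm u \<le> C" using ell2_boundedI[OF C] by auto
qed

lemma ell2_add:
  assumes "u \<in> ell2" "v \<in> ell2"
  shows "(\<lambda>n. u n + v n) \<in> ell2" "ell2_norm (\<lambda>n. u n + v n) \<le> ell2_norm u + ell2_norm v"
proof -
  have "L2_set (\<lambda>n. cmod (u n + v n)) {..<K} \<le> ell2_norm u + ell2_norm v" for K
  proof -
    have "L2_set (\<lambda>n. cmod (u n + v n)) {..<K} \<le> L2_set (\<lambda>n. cmod (u n) + cmod (v n)) {..<K}"
      by (intro L2_set_mono norm_triangle_ineq) auto
    also have "\<dots> \<le> L2_set (\<lambda>n. cmod (u n)) {..<K} + L2_set (\<lambda>n. cmod (v n)) {..<K}"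
      by (rule L2_set_triangle_ineq)
    also have "\<dots> \<le> ell2_norm u + ell2_norm v" using assms by (intro add_mono ell2_L2_set_le)
    finally show ?thesis .
  qed
  from ell2_boundedI_L2_set[OF this]
  show "(\<lambda>n. u n + v n) \<in> ell2" "ell2_norm (\<lambda>n. u n + v n) \<le> ell2_norm u + ell2_norm v" by auto
qed

lemma ell2_scale:
  assumes "u \<in> ell2"
  shows "(\<lambda>n. c * u n) \<in> ell2" "ell2_norm (\<lambda>n. c * u n) = cmod c * ell2_norm u"
proof -
  show "(\<lambda>n. c * u n) \<in> ell2"
    using summable_mult[OF ell2_summable[OF assms], of "(cmod c)\<^sup>2"] by (simp add: ell2_def norm_mult power_mult_distrib)
  have "(\<Sum>n. (cmod (c * u n))\<^sup>2) = (cmod c)\<^sup>2 * (\<Sum>n. (cmod (u n))\<^sup>2)"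
    unfolding norm_mult power_mult_distrib using ell2_summable[OF assms] by (rule suminf_mult)
  then show "ell2_norm (\<lambda>n. c * u n) = cmod c * ell2_norm u"
    by (simp add: ell2_norm_def real_sqrt_mult)
qed

lemma ell2_diff:
  assumes "u \<in> ell2" "v \<in> ell2"
  shows "(\<lambda>n. u n - v n) \<in> ell2" "ell2_norm (\<lambda>n. u n - v n) \<le> ell2_norm u + ell2_norm v"
  using ell2_add[OF assms(1) ell2_scale(1)[OF assms(2), of "-1"]] ell2_scale(2)[OF assms(2), of "-1"] by simp_all

lemma ell2_norm_minus_commute: "ell2_norm (\<lambda>n. u n - v n) = ell2_norm (\<lambda>n. v n - u n)"
  by (simp add: ell2_norm_def norm_minus_commute)

lemma ell2_norm_triangle_diff:
  assumes "u \<in> ell2" "v \<in> ell2" "w \<in> ell2"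
  shows "ell2_norm (\<lambda>n. u n - w n) \<le> ell2_norm (\<lambda>n. u n - v n) + ell2_norm (\<lambda>n. v n - w n)"
  using ell2_add(2)[OF ell2_diff(1)[OF assms(1,2)] ell2_diff(1)[OF assms(2,3)]] by simp

lemma ell2_zero: "(\<lambda>n. 0) \<in> ell2" "ell2_norm (\<lambda>n. 0) = 0"
  by (simp_all add: ell2_def ell2_norm_def)

lemma ell2_coord_le: "u \<in> ell2 \<Longrightarrow> cmod (u n) \<le> ell2_norm u"
proof -
  assume u: "u \<in> ell2"
  have "(cmod (u n))\<^sup>2 \<le> (\<Sum>k<Suc n. (cmod (u k))\<^sup>2)" by (intro member_le_sum[of n "{..<Suc n}" "\<lambda>k. (cmod (u k))\<^sup>2"]) auto
  also have "\<dots> \<le> (ell2_norm u)\<^sup>2" using u by (rule ell2_partial_sum_le)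
  finally show ?thesis using ell2_norm_nonneg[OF u] by (rule power2_le_imp_le)
qed

lemma ell2_tail_tendsto_0:
  assumes "u \<in> ell2"
  shows "(\<lambda>N. ell2_norm (\<lambda>n. u n - (if n < N then u n else 0))) \<longlonglongrightarrow> 0"
proof -
  let ?a = "\<lambda>n. (cmod (u n))\<^sup>2"
  have "(\<lambda>n. (cmod (u n - (if n < N then u n else 0)))\<^sup>2) sums (suminf ?a - sum ?a {..<N})" for N
  proof -
    have "(\<lambda>n. ?a n - (if n \<in> {..<N} then ?a n else 0)) sums (suminf ?a - sum ?a {..<N})"
      using ell2_summable[OF assms] by (intro sums_diff summable_sums sums_If_finite_set) auto
    then show ?thesis by (rule sums_cong[THEN iffD1, rotated]) auto
  qed
  then have "ell2_norm (\<lambda>n. u n - (if n < N then u n else 0)) = sqrt (suminf ?a - sum ?a {..<N})" for N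
    by (simp add: ell2_norm_def sums_iff)
  moreover have "(\<lambda>N. sqrt (suminf ?a - sum ?a {..<N})) \<longlonglongrightarrow> sqrt (suminf ?a - suminf ?a)"
    using ell2_summable[OF assms] by (intro tendsto_intros summable_LIMSEQ) 
  ultimately show ?thesis by simp
qed

lemma ell2_finite_support: "(\<lambda>n. if n < N then u n else 0) \<in> ell2"
proof -
  have "summable (\<lambda>n. if n \<in> {..<N} then (cmod (u n))\<^sup>2 else 0)" by (rule summable_If_finite_set) simp
  then show ?thesis unfolding ell2_def mem_Collect_eq by (rule summable_cong[THEN iffD1, rotated]) (simp add: eventually_sequentially)
qed

lemma ell2_delta: "(\<lambda>n. if n = m then 1 else 0) \<in> ell2" "ell2_norm (\<lambda>n. if n = m then 1 else 0) = 1"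
proof -
  have "(\<lambda>n. (cmod (if n = m then 1 else 0))\<^sup>2) sums 1"
    using sums_single[of m "\<lambda>_. 1 :: real"] by (rule sums_cong[THEN iffD1, rotated]) simp
  then show "(\<lambda>n. if n = m then 1 else 0) \<in> ell2" "ell2_norm (\<lambda>n. if n = m then 1 else 0) = 1"
    by (auto simp: ell2_def ell2_norm_def sums_iff)
qed

text \<open>The Weierstrass test makes the differentiated series converge uniformly; for the series
  itself pointwise summability is enough.\<close>

lemma has_vector_derivative_suminf:
  fixes f f' :: "nat \<Rightarrow> real \<Rightarrow> 'a::banach"
  assumes "convex S" "open S"
    and der: "\<And>n t. t \<in> S \<Longrightarrow> (f n has_vector_derivative f' n t) (at t)"
    and M: "\<And>n t. t \<in> S \<Longrightarrow> norm (f' n t) \<le> M n" "summable M"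
    and sf: "\<And>t. t \<in> S \<Longrightarrow> summable (\<lambda>n. f n t)" and t: "t \<in> S"
  shows "((\<lambda>t. \<Sum>n. f n t) has_vector_derivative (\<Sum>n. f' n t)) (at t)"
proof -
  have ul: "uniform_limit S (\<lambda>n x. \<Sum>i<n. f' i x) (\<lambda>x. suminf (\<lambda>i. f' i x)) sequentially"
    using M by (intro Weierstrass_m_test) auto
  have "\<exists>g. \<forall>x\<in>S. (\<lambda>n. f n x) sums g x \<and> (g has_derivative (\<lambda>h. h *\<^sub>R (\<Sum>i. f' i x))) (at x within S)"
  proof (rule has_derivative_series[OF \<open>convex S\<close> _ _ t])
    show "(f n has_derivative (\<lambda>h. h *\<^sub>R f' n x)) (at x within S)" if "x \<in> S" for n x
      using der[OF that, of n] unfolding has_vector_derivative_def by (rule has_derivative_at_withinI)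
    show "(\<lambda>n. f n t) sums (\<Sum>n. f n t)" using sf[OF t] by (rule summable_sums)
    fix e :: real assume "e > 0"
    then have "\<forall>\<^sub>F n in sequentially. \<forall>x\<in>S. dist (\<Sum>i<n. f' i x) (suminf (\<lambda>i. f' i x)) < e"
      using ul by (simp add: uniform_limit_iff)
    then show "\<forall>\<^sub>F n in sequentially. \<forall>x\<in>S. \<forall>h. norm ((\<Sum>i<n. h *\<^sub>R f' i x) - h *\<^sub>R (\<Sum>i. f' i x)) \<le> e * norm h"
    proof eventually_elim
      case (elim n)
      show ?case
      proof (intro ballI allI)
        fix x h assume "x \<in> S"
        then have "norm ((\<Sum>i<n. f' i x) - (\<Sum>i. f' i x)) \<le> e" using elim by (force simp: dist_norm)
        then have "norm (h *\<^sub>R ((\<Sum>i<n. f' i x) - (\<Sum>i. f' i x))) \<le> e * norm h"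
          unfolding norm_scaleR mult.commute[of e] real_norm_def by (rule mult_left_mono) simp
        then show "norm ((\<Sum>i<n. h *\<^sub>R f' i x) - h *\<^sub>R (\<Sum>i. f' i x)) \<le> e * norm h"
          by (simp add: scaleR_right_diff_distrib scaleR_sum_right)
      qed
    qed
  qed
  then obtain g where g: "\<And>x. x \<in> S \<Longrightarrow> (\<lambda>n. f n x) sums g x"
    "\<And>x. x \<in> S \<Longrightarrow> (g has_derivative (\<lambda>h. h *\<^sub>R (\<Sum>i. f' i x))) (at x within S)" by blast
  have "(g has_derivative (\<lambda>h. h *\<^sub>R (\<Sum>i. f' i t))) (at t)"
    using g(2)[OF t] at_within_open[OF t \<open>open S\<close>] by simp
  then have "((\<lambda>t. \<Sum>n. f n t) has_derivative (\<lambda>h. h *\<^sub>R (\<Sum>i. f' i t))) (at t)"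
    by (rule has_derivative_transform_within_open[OF _ \<open>open S\<close> t]) (use g(1) in \<open>simp add: sums_iff\<close>)
  then show ?thesis by (simp add: has_vector_derivative_def)
qed

section \<open>The kernel of the propagator\<close>

text \<open>The square is the coefficient of x^n in (1 - x)^(-\<beta>). Conjugation by these numbers
  makes the three-term recurrence of \<open>lag_Q\<close> symmetric.\<close>

definition lag_c :: "real \<Rightarrow> nat \<Rightarrow> real" where
  "lag_c \<beta> n = sqrt (pochhammer \<beta> n / fact n)"

text \<open>The truncated exponent for \<open>j > n\<close> is harmless because the binomial coefficient vanishes there.\<close>

definition binom_mono :: "complex \<Rightarrow> nat \<Rightarrow> nat \<Rightarrow> complex" where
  "binom_mono s n j = of_nat (n choose j) * s ^ (n - j)"

text \<open>Applying the flow to the reproducing kernel \<open>(1 - z w)\<^bsup>-\<beta>\<^esup>\<close> gives, with \<open>\<tau> = 1 / (1 + i t)\<close> and \<open>\<sigma> = \<tau> - 1\<close>,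
  the generating function \<open>\<tau>\<^bsup>\<beta>\<^esup> \<Sum>j. ((\<beta>)\<^sub>j / j!) (\<tau>\<^sup>2 z w)\<^bsup>j\<^esup> ((1 - \<sigma> z) (1 - \<sigma> w))\<^bsup>-\<beta>-j\<^esup>\<close> of the numbers
  \<open>c\<^sub>n c\<^sub>m G t n m\<close>, where \<open>c\<^sub>n = lag_c \<beta> n\<close>; expanding it yields \<open>G t n m = c\<^sub>n c\<^sub>m lag_Q \<beta> n m \<tau>\<close>.\<close>

definition lag_Q :: "real \<Rightarrow> nat \<Rightarrow> nat \<Rightarrow> complex \<Rightarrow> complex" where
  "lag_Q \<beta> n m z = z powr of_real \<beta> *
     (\<Sum>j\<le>m. of_real (fact j / pochhammer \<beta> j) * z ^ (2 * j) * (binom_mono (z - 1) n j * binom_mono (z - 1) m j))"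

definition lag_tau :: "real \<Rightarrow> complex" where
  "lag_tau t = 1 / (1 + \<i> * of_real t)"

definition lag_kernel :: "real \<Rightarrow> real \<Rightarrow> nat \<Rightarrow> nat \<Rightarrow> complex" where
  "lag_kernel \<alpha> t n m = of_real (lag_c (\<alpha> + 1) n * lag_c (\<alpha> + 1) m) * lag_Q (\<alpha> + 1) n m (lag_tau t)"

section \<open>Coefficient relations and the differential-difference equation\<close>

text \<open>\<open>binom_mono s n j\<close> is the coefficient of x^j in (s + x)^n. The relation
  says that d/ds and d/dx agree on this power.\<close>

lemma binom_mono_pred: "of_nat n * binom_mono s (n - 1) j = of_nat (Suc j) * binom_mono s n (Suc j)"
proof (cases n)
  case (Suc k)
  have "of_nat (Suc k * (k choose j)) = (of_nat (Suc j * (Suc k choose Suc j)) :: complex)"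
    by (metis binomial_absorption diff_Suc_1)
  then have "(of_nat (Suc k) * of_nat (k choose j) :: complex) = of_nat (Suc j) * of_nat (Suc k choose Suc j)"
    by (simp only: of_nat_mult)
  then show ?thesis by (simp only: binom_mono_def Suc mult.assoc[symmetric] diff_Suc_1 diff_Suc_Suc)
qed (simp add: binom_mono_def)

text \<open>Euler's relation s d/ds = n - x d/dx for the homogeneous polynomial (s + x)^n.\<close>

lemma binom_mono_mult_left:
  "of_nat n * (s * binom_mono s (n - 1) j) = (of_nat n - of_nat j) * binom_mono s n j"
proof (cases "j < n")
  case True
  have "real (n * (n - 1 choose j)) = real ((n - j) * (n choose j))"
    using binomial_absorb_comp[of n j] by (simp only: mult.commute)
  then have "complex_of_real (real n * real (n - 1 choose j)) = complex_of_real ((real n - real j) * real (n choose j))"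
    using True by (simp add: of_nat_diff)
  moreover have "s * s ^ (n - 1 - j) = s ^ (n - j)"
    using True by (metis Suc_diff_Suc Suc_eq_plus1 diff_diff_left diff_commute power_Suc)
  moreover have "of_nat n * (s * binom_mono s (n - 1) j) =
      complex_of_real (real n * real (n - 1 choose j)) * (s * s ^ (n - 1 - j))"
    by (simp add: binom_mono_def mult_ac)
  ultimately show ?thesis by (simp only: binom_mono_def) simp
next
  case False
  then show ?thesis by (cases n; cases "j = n") (auto simp: binom_mono_def binomial_eq_0)
qed

text \<open>Euler's relation with d/ds replaced by d/dx. The left factor is n + 1 - i for i =
  \<open>Suc j\<close>, the shape in which it meets the predecessor of the index i.\<close>

lemma binom_mono_mult_pred:
  "(of_nat n + 1 - of_nat (Suc j)) * binom_mono s n j = of_nat (Suc j) * (s * binom_mono s n (Suc j))"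
proof (cases "j < n")
  case True
  have "s * s ^ (n - Suc j) = s ^ (n - j)"
    using True by (metis Suc_diff_Suc power_Suc)
  moreover have "real ((n - j) * (n choose j)) = real (Suc j * (n choose Suc j))"
    by (metis binomial_absorb_comp binomial_absorption mult.commute)
  then have "complex_of_real ((real n - real j) * real (n choose j)) = complex_of_real (real (Suc j) * real (n choose Suc j))"
    using True by (simp only: of_nat_mult of_nat_diff less_imp_le)
  moreover have "of_nat (Suc j) * (s * binom_mono s n (Suc j)) =
      complex_of_real (real (Suc j) * real (n choose Suc j)) * (s * s ^ (n - Suc j))"
    by (simp add: binom_mono_def mult_ac)
  ultimately show ?thesis by (simp only: binom_mono_def) simp
next
  case False
  then show ?thesis by (cases "j = n") (auto simp: binom_mono_def binomial_eq_0)
qed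

lemma binom_mono_Suc_Suc: "binom_mono s (Suc n) (Suc j) = s * binom_mono s n (Suc j) + binom_mono s n j"
proof (cases "j < n")
  case True
  have "s * s ^ (n - Suc j) = s ^ (n - j)"
    using True by (metis Suc_diff_Suc power_Suc)
  then show ?thesis by (simp add: binom_mono_def algebra_simps)
next
  case False
  then show ?thesis by (cases "j = n") (auto simp: binom_mono_def binomial_eq_0)
qed

lemma binom_mono_Suc_0: "binom_mono s (Suc n) 0 = s * binom_mono s n 0"
  by (simp add: binom_mono_def)

lemma DERIV_binom_mono:
  "((\<lambda>z. binom_mono (z - 1) n j) has_field_derivative of_nat n * binom_mono (z - 1) (n - 1) j) (at z)"
proof (cases "j < n")
  case True
  have "((\<lambda>z. binom_mono (z - 1) n j) has_field_derivative
     of_nat (n choose j) * (of_nat (n - j) * (z - 1) ^ (n - j - 1))) (at z)"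
    unfolding binom_mono_def by (auto intro!: derivative_eq_intros)
  also have "of_nat (n choose j) * (of_nat (n - j) * (z - 1) ^ (n - j - 1)) = of_nat n * binom_mono (z - 1) (n - 1) j"
  proof -
    have "(of_nat ((n - j) * (n choose j)) :: complex) = of_nat (n * (n - 1 choose j))"
      by (simp only: binomial_absorb_comp)
    then show ?thesis by (simp add: binom_mono_def mult_ac)
  qed
  finally show ?thesis .
next
  case False
  then have "(\<lambda>z. binom_mono (z - 1) n j) = (\<lambda>z. if j = n then 1 else 0)"
    by (auto simp: binom_mono_def binomial_eq_0)
  moreover have "of_nat n * binom_mono (z - 1) (n - 1) j = 0"
    using False by (cases n) (auto simp: binom_mono_def binomial_eq_0)
  ultimately show ?thesis by (simp only:) simp
qed

text \<open>The identity at one index j, once the shifted term \<open>pred\<close> is in place.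
  Writing (1 + s)^2 x = x + (2 + s) (s x) and removing s x by Euler's relation leaves precisely the
  relation between neighbouring indices.\<close>

lemma lag_Q_pointwise:
  fixes s \<beta> :: complex
  defines "pred \<equiv> \<lambda>n j. if j = 0 then 0 else binom_mono s n (j - 1)"
  shows "(\<beta> + 2 * of_nat j) * (1 + s) * binom_mono s n j + (1 + s)\<^sup>2 * (of_nat n * binom_mono s (n - 1) j)
      + (\<beta> + of_nat j - 1) * pred n j
    = of_nat n * binom_mono s (n - 1) j + (2 * of_nat n + \<beta>) * binom_mono s n j + (of_nat n + \<beta>) * binom_mono s (Suc n) j"
proof -
  define x where "x = of_nat n * binom_mono s (n - 1) j"
  define b where "b = binom_mono s n j"
  have 1: "s * x = (of_nat n - of_nat j) * b"
    unfolding x_def b_def using binom_mono_mult_left[of n s j] by (simp add: mult_ac)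
  have 2: "binom_mono s (Suc n) j = s * b + pred n j"
    by (cases j) (simp_all add: b_def pred_def binom_mono_Suc_0 binom_mono_Suc_Suc)
  have 3: "(of_nat n + 1 - of_nat j) * pred n j = of_nat j * (s * b)"
    by (cases j) (simp_all add: b_def pred_def binom_mono_mult_pred del: of_nat_Suc)
  have "(1 + s)\<^sup>2 * x = x + (2 + s) * (s * x)" by (simp add: power2_eq_square algebra_simps)
  then have "(\<beta> + 2 * of_nat j) * (1 + s) * b + (1 + s)\<^sup>2 * x + (\<beta> + of_nat j - 1) * pred n j
     - (x + (2 * of_nat n + \<beta>) * b + (of_nat n + \<beta>) * (s * b + pred n j)) =
     of_nat j * (s * b) - (of_nat n + 1 - of_nat j) * pred n j"
    by (simp only: 1) (simp add: algebra_simps)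
  also have "\<dots> = 0" using 3 by simp
  finally show ?thesis by (simp add: 2 x_def b_def)
qed

text \<open>Derivative and three-term operator agree only after summation over j. Where the
  derivative falls on the factor with m, the term of index j is \<open>Y (Suc j)\<close>; shifting
  it back makes the identity hold index by index.\<close>

lemma lag_Q_sum_identity:
  fixes s :: complex and \<beta> :: real
  assumes "\<beta> > 0"
  defines "r \<equiv> \<lambda>j. complex_of_real (fact j / pochhammer \<beta> j)"
  shows "(\<Sum>j\<le>m. r j * (1 + s) ^ (2 * j) * ((of_real \<beta> + 2 * of_nat j) * (1 + s) * (binom_mono s n j * binom_mono s m j)
      + (1 + s)\<^sup>2 * (of_nat n * binom_mono s (n - 1) j * binom_mono s m j + binom_mono s n j * (of_nat m * binom_mono s (m - 1) j))))
    = (\<Sum>j\<le>m. r j * (1 + s) ^ (2 * j) * ((of_nat n * binom_mono s (n - 1) j + (2 * of_nat n + of_real \<beta>) * binom_mono s n j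
      + (of_nat n + of_real \<beta>) * binom_mono s (Suc n) j) * binom_mono s m j))"
    (is "(\<Sum>j\<le>m. ?A j) = (\<Sum>j\<le>m. ?B j)")
proof -
  define Y where "Y j = r j * (of_real \<beta> + of_nat j - 1) * (1 + s) ^ (2 * j) * (if j = 0 then 0 else binom_mono s n (j - 1)) * binom_mono s m j" for j
  have rec: "r j * of_nat (Suc j) = r (Suc j) * (of_real \<beta> + of_nat j)" for j
  proof -
    have "pochhammer \<beta> j > 0" "\<beta> + real j > 0" using assms by (auto intro: pochhammer_pos)
    then have "fact j / pochhammer \<beta> j * real (Suc j) = fact (Suc j) / pochhammer \<beta> (Suc j) * (\<beta> + real j)"
      unfolding pochhammer_Suc fact_Suc by simp
    then have "complex_of_real (fact j / pochhammer \<beta> j * real (Suc j)) = complex_of_real (fact (Suc j) / pochhammer \<beta> (Suc j) * (\<beta> + real j))"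
      by (simp only:)
    then show ?thesis by (simp only: r_def of_real_mult of_real_add of_real_of_nat_eq)
  qed
  have shift: "r j * (1 + s) ^ (2 * j) * ((1 + s)\<^sup>2 * (binom_mono s n j * (of_nat m * binom_mono s (m - 1) j))) = Y (Suc j)" for j
  proof -
    have "r j * (1 + s) ^ (2 * j) * ((1 + s)\<^sup>2 * (binom_mono s n j * (of_nat m * binom_mono s (m - 1) j)))
       = (r j * of_nat (Suc j)) * (1 + s) ^ (2 * Suc j) * binom_mono s n j * binom_mono s m (Suc j)"
      unfolding binom_mono_pred by (simp add: power2_eq_square mult_ac del: of_nat_Suc)
    also have "\<dots> = Y (Suc j)" unfolding rec Y_def by simp
    finally show ?thesis .
  qed
  \<comment> \<open>Both boundary terms vanish: \<open>Y 0\<close> by its definition,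
    \<open>Y (Suc m)\<close> because m choose m + 1 is 0.\<close>
  have "(\<Sum>j\<le>m. Y (Suc j)) + Y 0 = (\<Sum>j\<le>Suc m. Y j)" by (simp add: sum.atMost_Suc_shift del: sum.atMost_Suc)
  then have telescope: "(\<Sum>j\<le>m. Y (Suc j)) = (\<Sum>j\<le>m. Y j)" by (simp add: Y_def binom_mono_def)
  have "(\<Sum>j\<le>m. ?A j) = (\<Sum>j\<le>m. r j * (1 + s) ^ (2 * j) * ((of_real \<beta> + 2 * of_nat j) * (1 + s) * (binom_mono s n j * binom_mono s m j)
      + (1 + s)\<^sup>2 * (of_nat n * binom_mono s (n - 1) j * binom_mono s m j)) + Y (Suc j))"
    by (intro sum.cong refl) (simp only: shift[symmetric] ring_distribs add.assoc)
  also have "\<dots> = (\<Sum>j\<le>m. r j * (1 + s) ^ (2 * j) * ((of_real \<beta> + 2 * of_nat j) * (1 + s) * (binom_mono s n j * binom_mono s m j)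
      + (1 + s)\<^sup>2 * (of_nat n * binom_mono s (n - 1) j * binom_mono s m j)) + Y j)"
    by (simp only: sum.distrib telescope)
  also have "\<dots> = (\<Sum>j\<le>m. ?B j)"
  proof (intro sum.cong refl)
    fix j
    have "?B j = r j * (1 + s) ^ (2 * j) * (((of_real \<beta> + 2 * of_nat j) * (1 + s) * binom_mono s n j + (1 + s)\<^sup>2 * (of_nat n * binom_mono s (n - 1) j)
      + (of_real \<beta> + of_nat j - 1) * (if j = 0 then 0 else binom_mono s n (j - 1))) * binom_mono s m j)"
      by (simp only: lag_Q_pointwise)
    then show "r j * (1 + s) ^ (2 * j) * ((of_real \<beta> + 2 * of_nat j) * (1 + s) * (binom_mono s n j * binom_mono s m j)
      + (1 + s)\<^sup>2 * (of_nat n * binom_mono s (n - 1) j * binom_mono s m j)) + Y j = ?B j"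
      by (simp only: Y_def) (simp only: ring_distribs mult_ac)
  qed
  finally show ?thesis .
qed

text \<open>In the variable z the evolution is z^2 d/dz, acting on the index n with coefficients n,
  2 n + \<beta>, n + \<beta>. The slit plane is where the principal power is differentiable.\<close>

lemma DERIV_lag_Q:
  assumes "\<beta> > 0" and z: "z \<notin> \<real>\<^sub>\<le>\<^sub>0"
  shows "(lag_Q \<beta> n m has_field_derivative
    (of_nat n * lag_Q \<beta> (n - 1) m z + (2 * of_nat n + of_real \<beta>) * lag_Q \<beta> n m z + (of_nat n + of_real \<beta>) * lag_Q \<beta> (Suc n) m z) / z\<^sup>2) (at z)"
proof -
  have z0: "z \<noteq> 0" using z by auto
  define r where "r j = complex_of_real (fact j / pochhammer \<beta> j)" for j
  define s where "s = z - 1"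
  let ?b = "binom_mono s"
  define S where "S n z = (\<Sum>j\<le>m. r j * z ^ (2 * j) * (binom_mono (z - 1) n j * binom_mono (z - 1) m j))" for n z
  have Q: "lag_Q \<beta> n m z = z powr of_real \<beta> * S n z" for n z
    by (simp add: lag_Q_def S_def r_def)
  let ?D = "\<Sum>j\<le>m. r j * z ^ (2 * j) * (2 * of_nat j * (?b n j * ?b m j) / z +
      (of_nat n * ?b (n - 1) j * ?b m j + ?b n j * (of_nat m * ?b (m - 1) j)))"
  have "(S n has_field_derivative ?D) (at z)"
    unfolding S_def[abs_def]
  proof (intro DERIV_sum)
    fix j
    have 1: "((\<lambda>z. r j * z ^ (2 * j)) has_field_derivative r j * z ^ (2 * j) * (2 * of_nat j / z)) (at z)"
    proof -
      have "((\<lambda>z. r j * z ^ (2 * j)) has_field_derivative r j * (of_nat (2 * j) * z ^ (2 * j - 1))) (at z)"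
        by (auto intro!: derivative_eq_intros)
      also have "r j * (of_nat (2 * j) * z ^ (2 * j - 1)) = r j * z ^ (2 * j) * (2 * of_nat j / z)"
        using z0 by (cases j) (simp_all add: field_simps)
      finally show ?thesis .
    qed
    have "((\<lambda>z. r j * z ^ (2 * j) * (binom_mono (z - 1) n j * binom_mono (z - 1) m j)) has_field_derivative
        r j * z ^ (2 * j) * (2 * of_nat j / z) * (?b n j * ?b m j) +
        (of_nat n * ?b (n - 1) j * ?b m j + of_nat m * ?b (m - 1) j * ?b n j) * (r j * z ^ (2 * j))) (at z)"
      unfolding s_def by (intro DERIV_mult 1 DERIV_binom_mono)
    also have "r j * z ^ (2 * j) * (2 * of_nat j / z) * (?b n j * ?b m j) +
        (of_nat n * ?b (n - 1) j * ?b m j + of_nat m * ?b (m - 1) j * ?b n j) * (r j * z ^ (2 * j)) =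
      r j * z ^ (2 * j) * (2 * of_nat j * (?b n j * ?b m j) / z +
      (of_nat n * ?b (n - 1) j * ?b m j + ?b n j * (of_nat m * ?b (m - 1) j)))"
      by (simp add: algebra_simps)
    finally show "((\<lambda>z. r j * z ^ (2 * j) * (binom_mono (z - 1) n j * binom_mono (z - 1) m j)) has_field_derivative
      r j * z ^ (2 * j) * (2 * of_nat j * (?b n j * ?b m j) / z +
      (of_nat n * ?b (n - 1) j * ?b m j + ?b n j * (of_nat m * ?b (m - 1) j)))) (at z)" .
  qed
  then have "((\<lambda>z. z powr of_real \<beta> * S n z) has_field_derivative
     (of_real \<beta> * z powr (of_real \<beta> - 1)) * S n z + ?D * z powr of_real \<beta>) (at z)"
    by (intro DERIV_mult has_field_derivative_powr z)
  also have "(of_real \<beta> * z powr (of_real \<beta> - 1)) * S n z + ?D * z powr of_real \<beta> =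
     z powr of_real \<beta> * (of_real \<beta> * z * S n z + z\<^sup>2 * ?D) / z\<^sup>2"
    using z0 by (simp add: powr_diff field_simps power2_eq_square)
  also have "of_real \<beta> * z * S n z + z\<^sup>2 * ?D =
    (\<Sum>j\<le>m. r j * (1 + s) ^ (2 * j) * ((of_real \<beta> + 2 * of_nat j) * (1 + s) * (?b n j * ?b m j)
      + (1 + s)\<^sup>2 * (of_nat n * ?b (n - 1) j * ?b m j + ?b n j * (of_nat m * ?b (m - 1) j))))"
    unfolding S_def sum_distrib_left sum.distrib[symmetric]
  proof (intro sum.cong refl)
    fix j
    have "of_real \<beta> * z * (A * B) + z\<^sup>2 * (A * (2 * J * B / z + C)) = A * ((of_real \<beta> + 2 * J) * z * B + z\<^sup>2 * C)" for A B C J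
      using z0 by (simp add: field_simps power2_eq_square)
    moreover have "z = 1 + s" by (simp add: s_def)
    ultimately show "of_real \<beta> * z * (r j * z ^ (2 * j) * (binom_mono (z - 1) n j * binom_mono (z - 1) m j)) +
       z\<^sup>2 * (r j * z ^ (2 * j) * (2 * of_nat j * (?b n j * ?b m j) / z + (of_nat n * ?b (n - 1) j * ?b m j + ?b n j * (of_nat m * ?b (m - 1) j)))) =
      r j * (1 + s) ^ (2 * j) * ((of_real \<beta> + 2 * of_nat j) * (1 + s) * (?b n j * ?b m j)
      + (1 + s)\<^sup>2 * (of_nat n * ?b (n - 1) j * ?b m j + ?b n j * (of_nat m * ?b (m - 1) j)))"
      by (metis s_def)
  qed
  also have "\<dots> = (\<Sum>j\<le>m. r j * (1 + s) ^ (2 * j) * ((of_nat n * ?b (n - 1) j + (2 * of_nat n + of_real \<beta>) * ?b n j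
      + (of_nat n + of_real \<beta>) * ?b (Suc n) j) * ?b m j))"
    unfolding r_def by (rule lag_Q_sum_identity) fact
  also have "\<dots> = of_nat n * S (n - 1) z + (2 * of_nat n + of_real \<beta>) * S n z + (of_nat n + of_real \<beta>) * S (Suc n) z"
    unfolding S_def sum_distrib_left sum.distrib[symmetric] by (intro sum.cong refl) (simp add: s_def algebra_simps)
  finally show ?thesis
    unfolding Q[abs_def] by (simp add: algebra_simps)
qed

section \<open>Schroedinger equation and symmetries of the kernel\<close>

lemma one_plus_ii_nonzero: "1 + \<i> * complex_of_real t \<noteq> 0"
  by (auto simp: complex_eq_iff)

lemma lag_tau_0 [simp]: "lag_tau 0 = 1"
  by (simp add: lag_tau_def)

lemma lag_tau_nonzero: "lag_tau t \<noteq> 0"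
  using one_plus_ii_nonzero by (simp add: lag_tau_def)

lemma lag_tau_altdef: "lag_tau t = of_real (1 / (1 + t\<^sup>2)) * (1 - \<i> * of_real t)"
proof -
  have "(1 - \<i> * of_real t) * (1 + \<i> * of_real t) = complex_of_real (1 + t\<^sup>2)"
    by (simp add: algebra_simps power2_eq_square)
  moreover have "complex_of_real (1 + t\<^sup>2) \<noteq> 0"
    using sum_power2_gt_zero_iff[of 1 t] by (simp only: of_real_eq_0_iff) simp
  ultimately show ?thesis
    using one_plus_ii_nonzero[of t] by (simp add: lag_tau_def nonzero_divide_eq_eq)
qed

lemma Re_lag_tau: "Re (lag_tau t) = 1 / (1 + t\<^sup>2)"
  by (simp add: lag_tau_altdef)

lemma lag_tau_pos: "Re (lag_tau t) > 0"
  unfolding Re_lag_tau by (simp add: add_pos_nonneg)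

lemma lag_tau_nonpos_Reals: "lag_tau t \<notin> \<real>\<^sub>\<le>\<^sub>0"
  using lag_tau_pos[of t] by (auto simp: complex_nonpos_Reals_iff)

lemma norm_lag_tau: "(cmod (lag_tau t))\<^sup>2 = 1 / (1 + t\<^sup>2)"
  by (simp add: lag_tau_def norm_divide power_divide cmod_power2)

lemma lag_tau_minus_1: "lag_tau t - 1 = - \<i> * of_real t * lag_tau t"
  using one_plus_ii_nonzero[of t] by (simp add: lag_tau_def field_simps)

lemma norm_lag_tau_minus_1: "(cmod (lag_tau t - 1))\<^sup>2 = t\<^sup>2 / (1 + t\<^sup>2)"
  by (simp add: lag_tau_minus_1 norm_mult power_mult_distrib norm_lag_tau)

lemma cnj_lag_tau: "cnj (lag_tau t) = lag_tau (- t)"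
  by (simp add: lag_tau_def)

text \<open>This Riccati equation turns z^2 d/dz in \<open>DERIV_lag_Q\<close> into i d/dt.\<close>

lemma lag_tau_vector_derivative: "(lag_tau has_vector_derivative - \<i> * (lag_tau t)\<^sup>2) (at t)"
proof -
  have "((\<lambda>z. 1 / (1 + \<i> * z)) has_field_derivative - \<i> * (lag_tau t)\<^sup>2) (at (of_real t))"
    using one_plus_ii_nonzero[of t]
    by (auto intro!: derivative_eq_intros simp: lag_tau_def power2_eq_square)
  then show ?thesis
    unfolding lag_tau_def[abs_def] by (rule has_vector_derivative_real_field)
qed

lemma norm_powr_of_real:
  assumes "z \<noteq> 0"
  shows "cmod (z powr of_real x) = cmod z powr x"
  using assms by (simp add: powr_def)

lemma lag_c_pos: "\<beta> > 0 \<Longrightarrow> lag_c \<beta> n > 0"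
  by (simp add: lag_c_def pochhammer_pos)

lemma lag_c_square: "\<beta> > 0 \<Longrightarrow> (lag_c \<beta> n)\<^sup>2 = pochhammer \<beta> n / fact n"
  by (simp add: lag_c_def pochhammer_pos less_imp_le)

lemma lag_c_Suc: "lag_c \<beta> (Suc n) = lag_c \<beta> n * sqrt ((\<beta> + real n) / (real n + 1))"
  unfolding lag_c_def real_sqrt_mult[symmetric]
  by (rule arg_cong[of _ _ sqrt]) (simp add: pochhammer_Suc add.commute)

text \<open>Together with \<open>lag_c_Suc_right\<close> this changes the coefficients n + \<beta>
  and n of the recurrence into the square roots of the Jacobi matrix.\<close>

lemma lag_c_Suc_left:
  "\<beta> > 0 \<Longrightarrow> sqrt ((real n + 1) * (real n + \<beta>)) * lag_c \<beta> (Suc n) = (real n + \<beta>) * lag_c \<beta> n"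
  by (simp add: lag_c_Suc real_sqrt_mult real_sqrt_divide add.commute)

lemma lag_c_Suc_right:
  "\<beta> > 0 \<Longrightarrow> sqrt ((real n + 1) * (real n + \<beta>)) * lag_c \<beta> n = (real n + 1) * lag_c \<beta> (Suc n)"
proof -
  have "(real n + 1) * (lag_c \<beta> n * (sqrt (\<beta> + real n) / sqrt (real n + 1))) =
      lag_c \<beta> n * sqrt (\<beta> + real n) * ((real n + 1) / sqrt (real n + 1))"
    by simp
  also have "(real n + 1) / sqrt (real n + 1) = sqrt (real n + 1)" by (rule real_div_sqrt) simp
  finally show ?thesis by (simp add: lag_c_Suc real_sqrt_mult real_sqrt_divide add.commute)
qed

lemma lag_kernel_vector_derivative:
  assumes "\<alpha> \<ge> 0"
  shows "((\<lambda>t. lag_kernel \<alpha> t n m) has_vector_derivative - \<i> * laguerre_op \<alpha> (\<lambda>k. lag_kernel \<alpha> t k m) n) (at t)"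
proof -
  define \<beta> where "\<beta> = \<alpha> + 1"
  have \<beta>: "\<beta> > 0" using assms by (simp add: \<beta>_def)
  let ?c = "\<lambda>k. complex_of_real (lag_c \<beta> k)"
  let ?q = "\<lambda>k. lag_Q \<beta> k m (lag_tau t)"
  let ?R = "of_nat n * ?q (n - 1) + (2 * of_nat n + of_real \<beta>) * ?q n + (of_nat n + of_real \<beta>) * ?q (Suc n)"
  have "((lag_Q \<beta> n m \<circ> lag_tau) has_vector_derivative (- \<i> * (lag_tau t)\<^sup>2) * (?R / (lag_tau t)\<^sup>2)) (at t)"
    by (intro field_vector_diff_chain_at lag_tau_vector_derivative DERIV_lag_Q \<beta> lag_tau_nonpos_Reals)
  moreover have "(- \<i> * (lag_tau t)\<^sup>2) * (?R / (lag_tau t)\<^sup>2) = - \<i> * ?R"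
    using lag_tau_nonzero[of t] by (simp only: times_divide_eq_right) simp
  ultimately have "((\<lambda>t. lag_Q \<beta> n m (lag_tau t)) has_vector_derivative - \<i> * ?R) (at t)"
    by (simp only: o_def)
  then have "((\<lambda>t. of_real (lag_c \<beta> n * lag_c \<beta> m) * lag_Q \<beta> n m (lag_tau t)) has_vector_derivative
      of_real (lag_c \<beta> n * lag_c \<beta> m) * (- \<i> * ?R)) (at t)"
    by (rule has_vector_derivative_mult_right)
  also have "of_real (lag_c \<beta> n * lag_c \<beta> m) * (- \<i> * ?R) = - \<i> * laguerre_op \<alpha> (\<lambda>k. lag_kernel \<alpha> t k m) n"
  proof -
    have up: "complex_of_real (sqrt ((real n + 1) * (real n + 1 + \<alpha>))) * ?c (n + 1) = (of_nat n + of_real \<beta>) * ?c n"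
    proof -
      have "real n + 1 + \<alpha> = real n + \<beta>" by (simp add: \<beta>_def)
      then have "complex_of_real (sqrt ((real n + 1) * (real n + 1 + \<alpha>)) * lag_c \<beta> (n + 1)) =
          complex_of_real ((real n + \<beta>) * lag_c \<beta> n)"
        using lag_c_Suc_left[OF \<beta>, of n] by (simp only: Suc_eq_plus1)
      then show ?thesis by (simp only: of_real_mult of_real_add of_real_of_nat_eq)
    qed
    have down: "complex_of_real (sqrt (real n * (real n + \<alpha>))) * (if n = 0 then 0 else ?c (n - 1) * x) = of_nat n * (?c n * x)" for x
    proof (cases n)
      case (Suc k)
      have "real (Suc k) = real k + 1" "real (Suc k) + \<alpha> = real k + \<beta>" by (simp_all add: \<beta>_def)
      then have "sqrt (real (Suc k) * (real (Suc k) + \<alpha>)) * lag_c \<beta> k = real (Suc k) * lag_c \<beta> (Suc k)"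
        using lag_c_Suc_right[OF \<beta>, of k] by (simp only:)
      then have "complex_of_real (sqrt (real (Suc k) * (real (Suc k) + \<alpha>))) * ?c k = of_nat (Suc k) * ?c (Suc k)"
        by (metis of_real_mult of_real_of_nat_eq)
      then show ?thesis unfolding Suc by (simp add: mult.assoc[symmetric] del: of_nat_Suc)
    qed simp
    have "laguerre_op \<alpha> (\<lambda>k. lag_kernel \<alpha> t k m) n =
      complex_of_real (sqrt (real n * (real n + \<alpha>))) * (if n = 0 then 0 else ?c (n - 1) * (?c m * ?q (n - 1))) +
      of_real (2 * real n + 1 + \<alpha>) * (?c n * ?c m * ?q n) +
      (complex_of_real (sqrt ((real n + 1) * (real n + 1 + \<alpha>))) * ?c (n + 1)) * (?c m * ?q (n + 1))"
      by (simp add: laguerre_op_def lag_kernel_def \<beta>_def)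
    also have "\<dots> = of_real (lag_c \<beta> n * lag_c \<beta> m) * ?R"
      unfolding up down by (simp add: \<beta>_def algebra_simps)
    finally show ?thesis by simp
  qed
  finally show ?thesis by (simp add: lag_kernel_def[abs_def] \<beta>_def)
qed

lemma lag_Q_commute: "lag_Q \<beta> n m z = lag_Q \<beta> m n z"
proof -
  have *: "(\<Sum>j\<le>m. of_real (fact j / pochhammer \<beta> j) * z ^ (2 * j) * (binom_mono (z - 1) n j * binom_mono (z - 1) m j)) =
    (\<Sum>j\<le>min n m. of_real (fact j / pochhammer \<beta> j) * z ^ (2 * j) * (binom_mono (z - 1) n j * binom_mono (z - 1) m j))" for n m
    by (rule sum.mono_neutral_right) (auto simp: binom_mono_def binomial_eq_0)
  show ?thesis unfolding lag_Q_def * by (simp only: min.commute[of n m] mult.commute[of "binom_mono (z - 1) n _"])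
qed

lemma lag_kernel_commute: "lag_kernel \<alpha> t n m = lag_kernel \<alpha> t m n"
  by (simp add: lag_kernel_def lag_Q_commute[of _ n m] mult_ac)

text \<open>With the symmetry in n and m, the adjoint at time t is the matrix at time -t, so the
  group law will contain unitarity. The positive real part of \<open>lag_tau\<close> keeps the power
  off its branch cut.\<close>

lemma cnj_lag_kernel: "cnj (lag_kernel \<alpha> t n m) = lag_kernel \<alpha> (- t) n m"
proof -
  have "cnj (lag_tau t powr of_real (\<alpha> + 1)) = lag_tau (- t) powr of_real (\<alpha> + 1)"
    using lag_tau_pos[of t] by (subst cnj_powr) (auto simp: cnj_lag_tau)
  then show ?thesis
    by (simp add: lag_kernel_def lag_Q_def binom_mono_def cnj_lag_tau del: of_real_add)
qed

text \<open>At \<tau> = 1 the base \<tau> - 1 of the powers is 0, so only the term j = n = m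
  survives.\<close>

lemma lag_kernel_0:
  assumes "\<alpha> \<ge> 0"
  shows "lag_kernel \<alpha> 0 n m = (if n = m then 1 else 0)"
proof -
  have b: "binom_mono 0 n j = (if j = n then 1 else 0)" for n j
    by (auto simp: binom_mono_def binomial_eq_0 power_0_left)
  have "lag_Q (\<alpha> + 1) n m 1 = (\<Sum>j\<le>m. if j = m then (if n = m then of_real (fact m / pochhammer (\<alpha> + 1) m) else 0) else 0)"
    unfolding lag_Q_def powr_one_eq_one mult_1_left by (intro sum.cong refl) (simp add: b)
  then have "lag_kernel \<alpha> 0 n m = (if n = m then of_real ((lag_c (\<alpha> + 1) m)\<^sup>2 * (fact m / pochhammer (\<alpha> + 1) m)) else 0)"
    by (simp add: lag_kernel_def power2_eq_square)
  also have "(lag_c (\<alpha> + 1) m)\<^sup>2 * (fact m / pochhammer (\<alpha> + 1) m) = 1"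
    using assms pochhammer_pos[of "\<alpha> + 1" m] by (simp add: lag_c_square)
  finally show ?thesis by simp
qed

section \<open>Geometric decay of the kernel columns\<close>

lemma poly_times_geometric_bounded:
  fixes x :: real
  assumes "0 < x" "x < 1"
  shows "\<exists>B>0. \<forall>n. (real n + 1) ^ k * x ^ n \<le> B"
  using assms
proof (induction k arbitrary: x)
  case 0
  then show ?case by (intro exI[of _ 1]) (auto simp: power_le_one)
next
  case (Suc k)
  define y where "y = sqrt x"
  have y: "0 < y" "y < 1" "x = y * y" using Suc.prems by (auto simp: y_def)
  obtain B where B: "B > 0" "\<And>n. (real n + 1) ^ k * y ^ n \<le> B" using Suc.IH[of y] y by blast
  have "(\<lambda>n. real n * y ^ n) \<longlonglongrightarrow> 0" using y powser_times_n_limit_0[of y] by simp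
  moreover have "(\<lambda>n. y ^ n) \<longlonglongrightarrow> 0" using y by (intro LIMSEQ_realpow_zero) auto
  ultimately have "(\<lambda>n. real n * y ^ n + y ^ n) \<longlonglongrightarrow> 0 + 0" by (rule tendsto_add)
  then have "Bseq (\<lambda>n. real n * y ^ n + y ^ n)" by (intro convergent_imp_Bseq convergentI)
  then obtain K where K: "K > 0" "\<And>n. \<bar>real n * y ^ n + y ^ n\<bar> \<le> K" by (auto simp: Bseq_def)
  have "(real n + 1) ^ Suc k * x ^ n \<le> B * K" for n
  proof -
    have "(real n + 1) ^ Suc k * x ^ n = ((real n + 1) ^ k * y ^ n) * (real n * y ^ n + y ^ n)"
      unfolding y(3) power_mult_distrib by (simp add: algebra_simps)
    also have "\<dots> \<le> B * K"
      using B K(2)[of n] y by (intro mult_mono) auto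
    finally show ?thesis .
  qed
  then show ?case using B K by (intro exI[of _ "B * K"]) auto
qed

text \<open>Bernoulli's inequality gives (\<beta> + n) / (n + 1) \<le> ((n + 2) / (n + 1))^k, and
  the product of the right sides telescopes.\<close>

lemma lag_c_le:
  assumes "\<beta> > 0" "\<beta> \<le> real k"
  shows "lag_c \<beta> n \<le> (real n + 1) ^ k"
proof -
  have "pochhammer \<beta> n / fact n \<le> (real n + 1) ^ k"
  proof (induction n)
    case (Suc n)
    have "pochhammer \<beta> (Suc n) / fact (Suc n) = pochhammer \<beta> n / fact n * ((\<beta> + real n) / (real n + 1))"
      by (simp add: pochhammer_Suc add.commute)
    also have "\<dots> \<le> (real n + 1) ^ k * ((real n + 2) / (real n + 1)) ^ k"
    proof (intro mult_mono Suc.IH)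
      have "(\<beta> + real n) / (real n + 1) \<le> (1 + real n + real k) / (real n + 1)"
        using assms by (intro divide_right_mono) auto
      also have "\<dots> = 1 + real k * (1 / (real n + 1))" by (simp add: field_simps)
      also have "\<dots> \<le> (1 + 1 / (real n + 1)) ^ k" by (rule Bernoulli_inequality) (simp add: field_simps)
      also have "1 + 1 / (real n + 1) = (real n + 2) / (real n + 1)" by (simp add: field_simps)
      finally show "(\<beta> + real n) / (real n + 1) \<le> ((real n + 2) / (real n + 1)) ^ k" .
    qed (use assms in auto)
    also have "\<dots> = (real (Suc n) + 1) ^ k" by (simp add: power_mult_distrib[symmetric] add_ac)
    finally show ?case .
  qed simp
  then have "lag_c \<beta> n \<le> sqrt ((real n + 1) ^ k)" unfolding lag_c_def by (rule real_sqrt_le_mono)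
  also have "\<dots> \<le> (real n + 1) ^ k"
    by (rule real_le_lsqrt) (auto simp: power2_eq_square)
  finally show ?thesis .
qed

lemma norm_binom_mono_le:
  assumes "cmod s \<le> \<rho>" "0 < \<rho>" "\<rho> \<le> 1" "j \<le> m"
  shows "cmod (binom_mono s n j) \<le> (real n + 1) ^ m * \<rho> ^ n / \<rho> ^ m"
proof (cases "j \<le> n")
  case True
  have "real (n choose j) \<le> real n ^ j"
    using binomial_le_pow[OF True] by (metis of_nat_le_iff of_nat_power)
  also have "\<dots> \<le> (real n + 1) ^ j" by (intro power_mono) auto
  also have "\<dots> \<le> (real n + 1) ^ m" using assms by (intro power_increasing) auto
  finally have 1: "real (n choose j) \<le> (real n + 1) ^ m" .
  have "cmod s ^ (n - j) \<le> \<rho> ^ (n - j)" using assms by (intro power_mono) auto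
  also have "\<dots> = \<rho> ^ n / \<rho> ^ j" using assms True by (simp add: power_diff)
  also have "\<dots> \<le> \<rho> ^ n / \<rho> ^ m"
    using assms by (intro divide_left_mono power_decreasing) auto
  finally have 2: "cmod s ^ (n - j) \<le> \<rho> ^ n / \<rho> ^ m" .
  show ?thesis unfolding binom_mono_def norm_mult norm_power norm_of_nat
    using mult_mono[OF 1 2] assms by simp
next
  case False
  then show ?thesis using assms by (simp add: binom_mono_def binomial_eq_0)
qed

lemma frac_one_plus_mono:
  fixes x y :: real
  assumes "0 \<le> x" "x \<le> y"
  shows "x / (1 + x) \<le> y / (1 + y)"
proof -
  have "x / (1 + x) = 1 - 1 / (1 + x)" "y / (1 + y) = 1 - 1 / (1 + y)" using assms by (simp_all add: field_simps)
  moreover have "1 / (1 + y) \<le> 1 / (1 + x)" using assms by (intro frac_le) auto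
  ultimately show ?thesis by linarith
qed

text \<open>The index n enters through the powers (\<tau> - 1)^(n - j) with j \<le> m, and |\<tau> -
  1|^2 = t^2 / (1 + t^2) stays away from 1 for bounded t. Uniformity on [-R, R] is what
  differentiation under the sum requires.\<close>

lemma lag_kernel_decay:
  assumes "\<alpha> \<ge> 0"
  obtains C r where "0 < r" "r < 1" "0 < C" "\<And>t n. \<bar>t\<bar> \<le> R \<Longrightarrow> cmod (lag_kernel \<alpha> t n m) \<le> C * r ^ n"
proof -
  define \<beta> where "\<beta> = \<alpha> + 1"
  have \<beta>: "\<beta> > 0" using assms by (simp add: \<beta>_def)
  \<comment> \<open>\<open>S\<close> \<ge> 1 keeps \<open>\<rho>\<close> positive for every R, so
    division by \<open>\<rho> ^ m\<close> is legitimate.\<close>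
  define S where "S = \<bar>R\<bar> + 1"
  define \<rho> where "\<rho> = sqrt (S\<^sup>2 / (1 + S\<^sup>2))"
  have \<rho>: "0 < \<rho>" "\<rho> < 1" unfolding \<rho>_def S_def by (auto simp: add_pos_nonneg field_simps)
  \<comment> \<open>Of the two factors in \<rho>^n = r^n r^n, one absorbs the polynomial growth and
    the other remains as the decay.\<close>
  define r where "r = sqrt \<rho>"
  have r: "0 < r" "r < 1" "\<rho> = r * r" using \<rho> by (auto simp: r_def)
  obtain k where k: "\<beta> \<le> real k" using real_arch_simple by blast
  obtain B where B: "B > 0" "\<And>n. (real n + 1) ^ (k + m) * r ^ n \<le> B"
    using poly_times_geometric_bounded[OF r(1,2)] by blast
  define K where "K = (\<Sum>j\<le>m. fact j / pochhammer \<beta> j * ((real m + 1) ^ m * \<rho> ^ m / \<rho> ^ m)) / \<rho> ^ m"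
  have r_nonneg: "fact j / pochhammer \<beta> j > 0" for j using \<beta> by (auto intro!: divide_pos_pos pochhammer_pos)
  have K: "K > 0" unfolding K_def using \<rho> \<beta>
    by (intro divide_pos_pos sum_pos mult_pos_pos) (auto intro!: pochhammer_pos)
  have "cmod (lag_kernel \<alpha> t n m) \<le> (lag_c \<beta> m * K * B) * r ^ n" if t: "\<bar>t\<bar> \<le> R" for t n
  proof -
    let ?z = "lag_tau t"
    have z1: "cmod ?z \<le> 1"
    proof -
      have "(cmod ?z)\<^sup>2 \<le> 1\<^sup>2" unfolding norm_lag_tau by (simp add: add_pos_nonneg)
      then show ?thesis by (rule power2_le_imp_le) simp
    qed
    have s1: "cmod (?z - 1) \<le> \<rho>"
    proof -
      have "t\<^sup>2 \<le> S\<^sup>2" using t by (simp add: S_def abs_le_square_iff[symmetric])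
      then have "t\<^sup>2 / (1 + t\<^sup>2) \<le> S\<^sup>2 / (1 + S\<^sup>2)"
        by (intro frac_one_plus_mono) auto
      then have "sqrt ((cmod (?z - 1))\<^sup>2) \<le> \<rho>" unfolding norm_lag_tau_minus_1 \<rho>_def by (rule real_sqrt_le_mono)
      then show ?thesis by simp
    qed
    have "cmod (lag_Q \<beta> n m ?z) \<le> 1 * (\<Sum>j\<le>m. fact j / pochhammer \<beta> j * 1 * (((real n + 1) ^ m * \<rho> ^ n / \<rho> ^ m) * ((real m + 1) ^ m * \<rho> ^ m / \<rho> ^ m)))"
      unfolding lag_Q_def norm_mult
    proof (intro mult_mono sum_norm_le)
      show "cmod (?z powr of_real \<beta>) \<le> 1"
        unfolding norm_powr_of_real[OF lag_tau_nonzero] using z1 \<beta> by (intro powr_le1) auto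
      fix j assume j: "j \<in> {..m}"
      show "cmod (of_real (fact j / pochhammer \<beta> j) * ?z ^ (2 * j) * (binom_mono (?z - 1) n j * binom_mono (?z - 1) m j)) \<le>
         fact j / pochhammer \<beta> j * 1 * (((real n + 1) ^ m * \<rho> ^ n / \<rho> ^ m) * ((real m + 1) ^ m * \<rho> ^ m / \<rho> ^ m))"
        unfolding norm_mult norm_power norm_of_real abs_of_pos[OF r_nonneg]
        using j \<rho> r_nonneg[of j] z1 s1 less_imp_le[OF r_nonneg[of j]]
        by (intro mult_mono norm_binom_mono_le power_le_one) auto
    qed (auto intro!: sum_nonneg)
    also have "\<dots> = (real n + 1) ^ m * \<rho> ^ n * K"
      unfolding K_def by (simp add: sum_distrib_left sum_distrib_right sum_divide_distrib mult_ac)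
    finally have Q: "cmod (lag_Q \<beta> n m ?z) \<le> (real n + 1) ^ m * \<rho> ^ n * K" .
    have "cmod (lag_kernel \<alpha> t n m) = lag_c \<beta> n * lag_c \<beta> m * cmod (lag_Q \<beta> n m ?z)"
      unfolding lag_kernel_def norm_mult norm_of_real using lag_c_pos[OF \<beta>] by (simp add: \<beta>_def abs_mult less_imp_le abs_of_pos)
    also have "\<dots> \<le> ((real n + 1) ^ k * lag_c \<beta> m) * ((real n + 1) ^ m * \<rho> ^ n * K)"
      using Q lag_c_pos[OF \<beta>] lag_c_le[OF \<beta> k] K \<rho> by (intro mult_mono) (auto simp: less_imp_le)
    also have "\<dots> = lag_c \<beta> m * K * ((real n + 1) ^ (k + m) * r ^ n) * r ^ n"
      unfolding r(3) power_mult_distrib power_add by (simp add: mult_ac)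
    also have "\<dots> \<le> lag_c \<beta> m * K * B * r ^ n"
      using B lag_c_pos[OF \<beta>, of m] K r by (intro mult_right_mono mult_left_mono) auto
    finally show ?thesis .
  qed
  moreover have "lag_c \<beta> m * K * B > 0" using lag_c_pos[OF \<beta>] K B by auto
  ultimately show ?thesis using that r by blast
qed

lemma poly_times_geometric_le:
  fixes r :: real
  assumes "0 < r" "r < 1"
  obtains B where "B > 0" "\<And>n. (real n + 1) * r ^ n \<le> B * sqrt r ^ n"
proof -
  define s where "s = sqrt r"
  have s: "0 < s" "s < 1" "r = s * s" using assms by (auto simp: s_def)
  obtain B where B: "B > 0" "\<And>n. (real n + 1) ^ 1 * s ^ n \<le> B"
    using poly_times_geometric_bounded[OF s(1,2), of 1] by blast
  have "(real n + 1) * r ^ n \<le> B * s ^ n" for n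
    using mult_right_mono[OF B(2)[of n], of "s ^ n"] s by (simp add: power_mult_distrib mult_ac)
  then show ?thesis using that B by (simp add: s_def)
qed

lemma summable_poly_times_geometric:
  fixes r :: real
  assumes "0 < r" "r < 1"
  shows "summable (\<lambda>n. (real n + 1) * r ^ n)"
proof -
  obtain K where K: "K > 0" "\<And>n. (real n + 1) * r ^ n \<le> K * sqrt r ^ n" using poly_times_geometric_le[OF assms] by blast
  have "summable (\<lambda>n. K * sqrt r ^ n)" using assms by (intro summable_mult summable_geometric) simp
  then show ?thesis by (rule summable_comparison_test'[where N = 0]) (use K assms in simp)
qed

section \<open>Moving the Jacobi matrix between factors, and the group law\<close>

lemma sqrt_mult_le:
  assumes "0 \<le> x" "x \<le> y"
  shows "sqrt (x * y) \<le> (y :: real)"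
  using assms by (intro real_le_lsqrt) (auto simp: power2_eq_square mult_right_mono)

text \<open>The coefficients are at most n + \<alpha>, 2 n + 1 + \<alpha> and n + 1 + \<alpha>, with
  sum at most (4 + 3 \<alpha>) (n + 1); the quotient by r pays for the neighbour n - 1.\<close>

lemma laguerre_op_geometric:
  assumes \<alpha>: "\<alpha> \<ge> 0" and r: "0 < r" "r < 1" and g: "\<And>n. cmod (g n) \<le> C * r ^ n"
  shows "cmod (laguerre_op \<alpha> g n) \<le> (4 + 3 * \<alpha>) * C / r * ((real n + 1) * r ^ n)"
proof -
  have C: "C \<ge> 0" using order_trans[OF norm_ge_zero g[of 0]] by simp
  have up: "r ^ n \<le> r ^ n / r" "r ^ Suc n \<le> r ^ n / r"
  proof -
    have "r ^ n * 1 \<le> r ^ n * (1 / r)" using r by (intro mult_left_mono) auto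
    then show "r ^ n \<le> r ^ n / r" by simp
    then show "r ^ Suc n \<le> r ^ n / r" using r power_decreasing[of n "Suc n" r] by linarith
  qed
  let ?X = "C * (r ^ n / r)"
  have "cmod (of_real (sqrt (real n * (real n + \<alpha>))) * (if n = 0 then 0 else g (n - 1))) \<le> (real n + \<alpha>) * ?X"
  proof (cases n)
    case (Suc k)
    have "cmod (g k) \<le> ?X" using g[of k] r by (simp add: Suc)
    then show ?thesis using \<alpha> C r sqrt_mult_le[of "real n" "real n + \<alpha>"]
      unfolding norm_mult norm_of_real by (intro mult_mono) (auto simp: Suc)
  qed (use \<alpha> C r in simp)
  moreover have "cmod (of_real (2 * real n + 1 + \<alpha>) * g n) \<le> (2 * real n + 1 + \<alpha>) * ?X"
  proof -
    have "cmod (g n) \<le> ?X" using g[of n] mult_left_mono[OF up(1) C] by linarith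
    then show ?thesis using \<alpha> unfolding norm_mult norm_of_real by (intro mult_mono) auto
  qed
  moreover have "cmod (of_real (sqrt ((real n + 1) * (real n + 1 + \<alpha>))) * g (n + 1)) \<le> (real n + 1 + \<alpha>) * ?X"
  proof -
    have "cmod (g (n + 1)) \<le> ?X" using g[of "n + 1"] mult_left_mono[OF up(2) C] by simp
    then show ?thesis using \<alpha> C r sqrt_mult_le[of "real n + 1" "real n + 1 + \<alpha>"]
      unfolding norm_mult norm_of_real by (intro mult_mono) auto
  qed
  ultimately have "cmod (laguerre_op \<alpha> g n) \<le> (real n + \<alpha>) * ?X + (2 * real n + 1 + \<alpha>) * ?X + (real n + 1 + \<alpha>) * ?X"
    unfolding laguerre_op_def by (intro norm_triangle_le[OF add_mono[OF norm_triangle_le[OF add_mono]]]) auto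
  also have "\<dots> = (4 * real n + 2 + 3 * \<alpha>) * ?X" by (simp only: distrib_right[symmetric]) simp
  also have "\<dots> \<le> ((4 + 3 * \<alpha>) * (real n + 1)) * ?X"
    using \<alpha> C r by (intro mult_right_mono) (auto simp: algebra_simps)
  finally show ?thesis by (simp add: mult_ac)
qed

text \<open>Summation by parts for a symmetric tridiagonal matrix. The decay of g allows u to be
  merely bounded, so no domain condition on u enters. The common value S expresses convergence and
  equality at once.\<close>

lemma laguerre_op_transpose:
  assumes \<alpha>: "\<alpha> \<ge> 0" and r: "0 < r" "r < 1" and g: "\<And>n. cmod (g n) \<le> C * r ^ n" and u: "\<And>n. cmod (u n) \<le> B"
  shows "\<exists>S. (\<lambda>n. laguerre_op \<alpha> g n * u n) sums S \<and> (\<lambda>n. g n * laguerre_op \<alpha> u n) sums S"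
proof -
  have C: "C \<ge> 0" using order_trans[OF norm_ge_zero g[of 0]] by simp
  have B: "B \<ge> 0" by (rule order_trans[OF norm_ge_zero u[of 0]])
  define A where "A n = complex_of_real (sqrt (real n * (real n + \<alpha>)))" for n
  define D where "D n = complex_of_real (2 * real n + 1 + \<alpha>)" for n
  have A1: "complex_of_real (sqrt ((real n + 1) * (real n + 1 + \<alpha>))) = A (n + 1)" for n
    by (simp add: A_def add_ac)
  have op: "laguerre_op \<alpha> v n = A n * (if n = 0 then 0 else v (n - 1)) + D n * v n + A (n + 1) * v (n + 1)" for v n
    by (simp only: laguerre_op_def A1) (simp only: A_def D_def)
  have A_le: "cmod (A (n + 1)) \<le> (2 + \<alpha>) * (real n + 1)" for n
  proof -
    have "cmod (A (n + 1)) \<le> real n + 1 + \<alpha>"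
      using sqrt_mult_le[of "real n + 1" "real n + 1 + \<alpha>"] \<alpha> by (simp add: A_def add_ac)
    also have "\<dots> \<le> (2 + \<alpha>) * (real n + 1)" using \<alpha> by (simp add: algebra_simps)
    finally show ?thesis .
  qed
  have D_le: "cmod (D n) \<le> (2 + \<alpha>) * (real n + 1)" for n
  proof -
    have "cmod (D n) = 2 * real n + 1 + \<alpha>" using \<alpha> by (simp only: D_def norm_of_real)
    also have "\<dots> \<le> (2 + \<alpha>) * (real n + 1)" using \<alpha> by (simp add: algebra_simps)
    finally show ?thesis .
  qed
  have gS: "cmod (g (n + 1)) \<le> C * r ^ n" for n
  proof -
    have "C * r ^ (n + 1) \<le> C * r ^ n" using C r by (intro mult_left_mono power_decreasing) auto
    then show ?thesis using g[of "n + 1"] by linarith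
  qed
  have sumI: "summable (\<lambda>n. x n * y n * v n)"
    if "\<And>n. cmod (x n) \<le> (2 + \<alpha>) * (real n + 1)" "\<And>n. cmod (y n) \<le> C * r ^ n" "\<And>n. cmod (v n) \<le> B" for x y v :: seq
  proof (rule summable_comparison_test'[where N = 0])
    show "summable (\<lambda>n. (2 + \<alpha>) * C * B * ((real n + 1) * r ^ n))"
      by (intro summable_mult summable_poly_times_geometric r)
    fix n
    have "norm (x n * y n * v n) \<le> ((2 + \<alpha>) * (real n + 1)) * (C * r ^ n) * B"
      unfolding norm_mult using that[of n] \<alpha> C r B by (intro mult_mono) auto
    then show "norm (x n * y n * v n) \<le> (2 + \<alpha>) * C * B * ((real n + 1) * r ^ n)" by (simp add: mult_ac)
  qed
  \<comment> \<open>Products along the three diagonals; each of the two series is the sum of all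
    three with one off-diagonal shifted by one index.\<close>
  define X where "X n = A (n + 1) * g (n + 1) * u n" for n
  define Y where "Y n = D n * g n * u n" for n
  define Z where "Z n = A (n + 1) * g n * u (n + 1)" for n
  have s: "summable X" "summable Y" "summable Z"
    unfolding X_def[abs_def] Y_def[abs_def] Z_def[abs_def]
    by (rule sumI[of "\<lambda>n. A (n + 1)" "\<lambda>n. g (n + 1)" u] sumI[of D g u] sumI[of "\<lambda>n. A (n + 1)" g "\<lambda>n. u (n + 1)"]; (rule A_le D_le g gS u))+
  have sh: "(\<lambda>n. if n = 0 then 0 else V (n - 1)) sums suminf V" if "summable V" for V :: seq
    using sums_Suc[of "\<lambda>n. if n = 0 then 0 else V (n - 1)" "suminf V"] summable_sums[OF that] by simp
  have 1: "(\<lambda>n. (if n = 0 then 0 else Z (n - 1)) + Y n + X n) sums (suminf Z + suminf Y + suminf X)"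
    using s by (intro sums_add sh summable_sums)
  have 2: "(\<lambda>n. (if n = 0 then 0 else X (n - 1)) + Y n + Z n) sums (suminf X + suminf Y + suminf Z)"
    using s by (intro sums_add sh summable_sums)
  have "(\<lambda>n. laguerre_op \<alpha> g n * u n) sums (suminf Z + suminf Y + suminf X)"
    by (rule sums_cong[THEN iffD1, OF _ 1])
       (simp add: op X_def Y_def Z_def algebra_simps)
  moreover have "(\<lambda>n. g n * laguerre_op \<alpha> u n) sums (suminf X + suminf Y + suminf Z)"
    by (rule sums_cong[THEN iffD1, OF _ 2])
       (simp add: op X_def Y_def Z_def algebra_simps)
  ultimately show ?thesis by (auto simp: add_ac)
qed

lemma summable_lag_kernel_mult:
  assumes \<alpha>: "\<alpha> \<ge> 0" and u: "\<And>n. cmod (u n) \<le> B"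
  shows "summable (\<lambda>m. lag_kernel \<alpha> t n m * u m)"
proof -
  obtain C r where Cr: "0 < r" "r < 1" "0 < C" "\<And>s m. \<bar>s\<bar> \<le> \<bar>t\<bar> \<Longrightarrow> cmod (lag_kernel \<alpha> s m n) \<le> C * r ^ m"
    using lag_kernel_decay[OF \<alpha>, of "\<bar>t\<bar>" n] by metis
  have "summable (\<lambda>m. C * B * r ^ m)" using Cr by (intro summable_mult summable_geometric) simp
  then show ?thesis
  proof (rule summable_comparison_test'[where N = 0])
    fix m
    have "cmod (lag_kernel \<alpha> t n m * u m) \<le> (C * r ^ m) * B"
      unfolding norm_mult lag_kernel_commute[of _ _ n m] using Cr(4)[of t m] u[of m] Cr(1,3) by (intro mult_mono) auto
    then show "cmod (lag_kernel \<alpha> t n m * u m) \<le> C * B * r ^ m" by (simp add: mult_ac)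
  qed
qed

text \<open>H first acts on the kernel column under the sum and is then moved onto u, although H u
  may be neither square summable nor bounded. This generality is what identifies the maximal domain
  later.\<close>

lemma lag_propagator_coord_derivative:
  assumes \<alpha>: "\<alpha> \<ge> 0" and u: "\<And>n. cmod (u n) \<le> B"
  shows "((\<lambda>t. \<Sum>m. lag_kernel \<alpha> t n m * u m) has_vector_derivative
    - \<i> * (\<Sum>m. lag_kernel \<alpha> t n m * laguerre_op \<alpha> u m)) (at t)"
proof -
  define R where "R = \<bar>t\<bar> + 1"
  obtain C r where Cr: "0 < r" "r < 1" "0 < C" "\<And>s m. \<bar>s\<bar> \<le> R \<Longrightarrow> cmod (lag_kernel \<alpha> s m n) \<le> C * r ^ m"
    using lag_kernel_decay[OF \<alpha>, of R n] by metis
  let ?M = "\<lambda>m. (4 + 3 * \<alpha>) * C / r * ((real m + 1) * r ^ m) * B"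
  let ?f' = "\<lambda>m s. - \<i> * (laguerre_op \<alpha> (\<lambda>k. lag_kernel \<alpha> s k n) m * u m)"
  have "((\<lambda>t. \<Sum>m. lag_kernel \<alpha> t n m * u m) has_vector_derivative (\<Sum>m. ?f' m t)) (at t)"
  proof (rule has_vector_derivative_suminf[where S = "{-R<..<R}" and M = ?M])
    fix m s assume s: "s \<in> {-R<..<R}"
    have "((\<lambda>t. lag_kernel \<alpha> t m n * u m) has_vector_derivative (- \<i> * laguerre_op \<alpha> (\<lambda>k. lag_kernel \<alpha> s k n) m) * u m) (at s)"
      by (intro has_vector_derivative_mult_left lag_kernel_vector_derivative \<alpha>)
    then show "((\<lambda>t. lag_kernel \<alpha> t n m * u m) has_vector_derivative ?f' m s) (at s)"
      by (simp add: lag_kernel_commute[of _ _ n m] mult.assoc)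
    have "cmod (laguerre_op \<alpha> (\<lambda>k. lag_kernel \<alpha> s k n) m) \<le> (4 + 3 * \<alpha>) * C / r * ((real m + 1) * r ^ m)"
      using s by (intro laguerre_op_geometric \<alpha> Cr) auto
    then show "norm (?f' m s) \<le> ?M m"
      using u[of m] order_trans[OF norm_ge_zero u[of m]] unfolding norm_mult by (simp add: mult_mono' del: times_divide_eq_left)
  next
    show "summable ?M" using Cr by (intro summable_mult2 summable_mult summable_poly_times_geometric)
  qed (use \<alpha> u in \<open>auto intro!: summable_lag_kernel_mult simp: R_def abs_if\<close>)
  also have "(\<Sum>m. ?f' m t) = - \<i> * (\<Sum>m. lag_kernel \<alpha> t n m * laguerre_op \<alpha> u m)"
  proof -
    have "\<And>m. cmod (lag_kernel \<alpha> t m n) \<le> C * r ^ m" using Cr(4)[of t] by (simp add: R_def)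
    from laguerre_op_transpose[where u = u, OF \<alpha> Cr(1,2) this u] obtain S where
      S: "(\<lambda>m. laguerre_op \<alpha> (\<lambda>k. lag_kernel \<alpha> t k n) m * u m) sums S"
         "(\<lambda>m. lag_kernel \<alpha> t m n * laguerre_op \<alpha> u m) sums S" by (elim exE conjE) (rule that)
    have "(\<lambda>m. ?f' m t) sums (- \<i> * S)" using S(1) by (rule sums_mult)
    moreover have "(\<lambda>m. lag_kernel \<alpha> t n m * laguerre_op \<alpha> u m) sums S"
      using S(2) by (simp add: lag_kernel_commute[of _ _ n])
    ultimately show ?thesis by (simp add: sums_iff)
  qed
  finally show ?thesis .
qed

lemma lag_kernel_group_law:
  assumes \<alpha>: "\<alpha> \<ge> 0"
  shows "(\<lambda>k. lag_kernel \<alpha> s n k * lag_kernel \<alpha> t k m) sums lag_kernel \<alpha> (s + t) n m"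
proof -
  define r where "r = s + t"
  \<comment> \<open>By symmetry both factors are written as columns, where decay is known. Constancy
    is used between t and 0, where the second factor is the identity matrix and only k = m
    remains.\<close>
  define \<phi> where "\<phi> x = (\<Sum>k. lag_kernel \<alpha> (r - x) k n * lag_kernel \<alpha> x k m)" for x
  have summ: "summable (\<lambda>k. lag_kernel \<alpha> y k n * lag_kernel \<alpha> x k m)" for x y
  proof -
    obtain C q where Cr: "0 < q" "q < 1" "0 < C" "\<And>y k. \<bar>y\<bar> \<le> \<bar>x\<bar> \<Longrightarrow> cmod (lag_kernel \<alpha> y k m) \<le> C * q ^ k"
      using lag_kernel_decay[OF \<alpha>, of "\<bar>x\<bar>" m] by metis
    have "cmod (lag_kernel \<alpha> x k m) \<le> C" for k
    proof -
      have "C * q ^ k \<le> C" using Cr by (simp add: mult_left_le power_le_one)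
      then show ?thesis using Cr(4)[of x k] by simp
    qed
    from summable_lag_kernel_mult[OF \<alpha> this, of y n] show ?thesis by (simp add: lag_kernel_commute[of _ _ n])
  qed
  have "(\<phi> has_vector_derivative 0) (at x)" for x
  proof -
    define R where "R = \<bar>x\<bar> + 1"
    obtain C1 q1 where 1: "0 < q1" "q1 < 1" "0 < C1" "\<And>y k. \<bar>y\<bar> \<le> \<bar>r\<bar> + R \<Longrightarrow> cmod (lag_kernel \<alpha> y k n) \<le> C1 * q1 ^ k"
      using lag_kernel_decay[OF \<alpha>, of "\<bar>r\<bar> + R" n] by metis
    obtain C2 q2 where 2: "0 < q2" "q2 < 1" "0 < C2" "\<And>y k. \<bar>y\<bar> \<le> R \<Longrightarrow> cmod (lag_kernel \<alpha> y k m) \<le> C2 * q2 ^ k"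
      using lag_kernel_decay[OF \<alpha>, of R m] by metis
    have le: "C * q ^ k \<le> C" if "0 < C" "0 < q" "q < 1" for C q :: real and k
      using that by (simp add: mult_left_le power_le_one)
    let ?L1 = "\<lambda>y. laguerre_op \<alpha> (\<lambda>k. lag_kernel \<alpha> (r - y) k n)"
    let ?L2 = "\<lambda>y. laguerre_op \<alpha> (\<lambda>k. lag_kernel \<alpha> y k m)"
    let ?f' = "\<lambda>k y. \<i> * (?L1 y k * lag_kernel \<alpha> y k m) - \<i> * (lag_kernel \<alpha> (r - y) k n * ?L2 y k)"
    let ?M = "\<lambda>k. (4 + 3 * \<alpha>) * C1 / q1 * ((real k + 1) * q1 ^ k) * C2 + C1 * ((4 + 3 * \<alpha>) * C2 / q2 * ((real k + 1) * q2 ^ k))"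
    have "(\<phi> has_vector_derivative (\<Sum>k. ?f' k x)) (at x)"
      unfolding \<phi>_def[abs_def]
    proof (rule has_vector_derivative_suminf[where S = "{-R<..<R}" and M = ?M])
      fix k y assume y: "y \<in> {-R<..<R}"
      have "((\<lambda>y. r - y) has_vector_derivative - 1) (at y)"
        by (auto intro!: derivative_eq_intros)
      from vector_diff_chain_at[OF this lag_kernel_vector_derivative[OF \<alpha>, of k n "r - y"]]
      have "((\<lambda>y. lag_kernel \<alpha> (r - y) k n) has_vector_derivative \<i> * ?L1 y k) (at y)"
        by (simp add: o_def)
      from has_vector_derivative_mult[OF this lag_kernel_vector_derivative[OF \<alpha>, of k m y]]
      show "((\<lambda>y. lag_kernel \<alpha> (r - y) k n * lag_kernel \<alpha> y k m) has_vector_derivative ?f' k y) (at y)"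
        by (simp add: algebra_simps)
      have y': "\<bar>y\<bar> \<le> R" "\<bar>r - y\<bar> \<le> \<bar>r\<bar> + R" using y by auto
      have "cmod (?L1 y k) \<le> (4 + 3 * \<alpha>) * C1 / q1 * ((real k + 1) * q1 ^ k)"
        "cmod (?L2 y k) \<le> (4 + 3 * \<alpha>) * C2 / q2 * ((real k + 1) * q2 ^ k)"
        using y' by (intro laguerre_op_geometric \<alpha> 1 2; simp)+
      moreover have "cmod (lag_kernel \<alpha> y k m) \<le> C2" "cmod (lag_kernel \<alpha> (r - y) k n) \<le> C1"
        using 1(4)[OF y'(2), of k] le[OF 1(3,1,2), of k] 2(4)[OF y'(1), of k] le[OF 2(3,1,2), of k] by linarith+
      ultimately have "cmod (?L1 y k * lag_kernel \<alpha> y k m) + cmod (lag_kernel \<alpha> (r - y) k n * ?L2 y k) \<le> ?M k"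
        unfolding norm_mult using 1 2 \<alpha> by (intro add_mono mult_mono) auto
      then show "norm (?f' k y) \<le> ?M k"
        by (intro order_trans[OF norm_triangle_ineq4]) (simp add: norm_mult)
    next
      show "summable ?M" using 1 2 by (intro summable_add summable_mult2 summable_mult summable_poly_times_geometric)
    qed (auto intro!: summ simp: R_def abs_if)
    also have "(\<Sum>k. ?f' k x) = 0"
    proof -
      have "\<And>k. cmod (lag_kernel \<alpha> (r - x) k n) \<le> C1 * q1 ^ k" "\<And>k. cmod (lag_kernel \<alpha> x k m) \<le> C2"
        using 1(4)[of "r - x"] 2(4)[of x] le[OF 2(3,1,2)] by (fastforce simp: R_def intro: order_trans)+
      from laguerre_op_transpose[where g = "\<lambda>k. lag_kernel \<alpha> (r - x) k n" and u = "\<lambda>k. lag_kernel \<alpha> x k m", OF \<alpha> 1(1,2) this] obtain S where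
        "(\<lambda>k. ?L1 x k * lag_kernel \<alpha> x k m) sums S" "(\<lambda>k. lag_kernel \<alpha> (r - x) k n * ?L2 x k) sums S" by (elim exE conjE) (rule that)
      then have "(\<lambda>k. ?f' k x) sums (\<i> * S - \<i> * S)" by (intro sums_diff sums_mult)
      then show ?thesis by (simp add: sums_iff)
    qed
    finally show ?thesis .
  qed
  then obtain c where "\<And>x. \<phi> x = c"
    using has_vector_derivative_zero_constant[of UNIV \<phi>] by (metis UNIV_I convex_UNIV has_vector_derivative_at_within)
  then have "\<phi> t = \<phi> 0" by simp
  also have "\<phi> 0 = lag_kernel \<alpha> r m n"
  proof -
    have "(\<lambda>k. if k = m then lag_kernel \<alpha> r k n else 0) sums lag_kernel \<alpha> r m n" by (rule sums_single)
    then show ?thesis unfolding \<phi>_def lag_kernel_0[OF \<alpha>] by (simp add: sums_iff if_distrib cong: if_cong)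
  qed
  finally have "(\<Sum>k. lag_kernel \<alpha> s k n * lag_kernel \<alpha> t k m) = lag_kernel \<alpha> (s + t) m n"
    by (simp add: \<phi>_def r_def)
  then show ?thesis using summ[of s t] by (simp add: sums_iff lag_kernel_commute[of _ _ n])
qed

section \<open>Unitary groups on square summable sequences\<close>

lemma unitary_on_ell2D:
  assumes "unitary_on_ell2 V"
  shows "u \<in> ell2 \<Longrightarrow> V u \<in> ell2"
    and "u \<in> ell2 \<Longrightarrow> v \<in> ell2 \<Longrightarrow> V (\<lambda>n. u n + v n) = (\<lambda>n. V u n + V v n)"
    and "u \<in> ell2 \<Longrightarrow> V (\<lambda>n. c * u n) = (\<lambda>n. c * V u n)"
    and "u \<in> ell2 \<Longrightarrow> ell2_norm (V u) = ell2_norm u"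
    and "u \<notin> ell2 \<Longrightarrow> V u = undefined"
  using assms unfolding unitary_on_ell2_def by (auto simp: bij_betw_def extensional_def)

lemma unitary_on_ell2_diff:
  assumes "unitary_on_ell2 V" "u \<in> ell2" "v \<in> ell2"
  shows "V (\<lambda>n. u n - v n) = (\<lambda>n. V u n - V v n)"
proof -
  have "V (\<lambda>n. u n + (-1) * v n) = (\<lambda>n. V u n + (-1) * V v n)"
    using assms by (simp only: unitary_on_ell2D[OF assms(1)] ell2_scale)
  then show ?thesis by simp
qed

lemma difference_quotient_ell2:
  assumes "u \<in> ell2" "w \<in> ell2" "v \<in> ell2"
  shows "(\<lambda>n. (w n - u n) / of_real h - v n) \<in> ell2"
proof -
  have "(\<lambda>n. inverse (of_real h) * (w n - u n)) \<in> ell2" by (intro ell2_scale ell2_diff assms)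
  from ell2_diff(1)[OF this assms(3)] show ?thesis by (simp add: divide_inverse mult.commute)
qed

text \<open>The right side copies the difference quotient in \<open>unitary_group_of\<close>, so
  that norm limits yield derivatives of the coordinates.\<close>

lemma has_vector_derivative_iff_quotient:
  fixes f :: "real \<Rightarrow> complex"
  shows "(f has_vector_derivative d) (at x) \<longleftrightarrow> ((\<lambda>h. cmod ((f (x + h) - f x) / of_real h - d)) \<longlongrightarrow> 0) (at 0)"
proof -
  have "(f has_vector_derivative d) (at x) \<longleftrightarrow> ((\<lambda>y. norm (f y - f x - (y - x) *\<^sub>R d) / norm (y - x)) \<longlongrightarrow> 0) (at x)"
    by (simp add: has_vector_derivative_def has_derivative_iff_norm bounded_linear_scaleR_left)
  also have "\<dots> \<longleftrightarrow> ((\<lambda>h. norm (f (x + h) - f x - h *\<^sub>R d) / norm h) \<longlongrightarrow> 0) (at 0)"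
    by (subst LIM_offset_zero_iff[where a = x]) auto
  also have "\<dots> \<longleftrightarrow> ((\<lambda>h. cmod ((f (x + h) - f x) / of_real h - d)) \<longlongrightarrow> 0) (at 0)"
  proof (rule tendsto_cong)
    have "norm (f (x + h) - f x - h *\<^sub>R d) / norm h = cmod ((f (x + h) - f x) / of_real h - d)" if "h \<noteq> 0" for h
    proof -
      have "(f (x + h) - f x) / of_real h - d = (f (x + h) - f x - h *\<^sub>R d) / of_real h"
        using that by (simp add: scaleR_conv_of_real diff_divide_distrib)
      then show ?thesis by (simp add: norm_divide)
    qed
    then show "\<forall>\<^sub>F h in at 0. norm (f (x + h) - f x - h *\<^sub>R d) / norm h = cmod ((f (x + h) - f x) / of_real h - d)"
      by (auto simp: eventually_at_filter)
  qed
  finally show ?thesis .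
qed

locale ell2_group =
  fixes D A U
  assumes group: "unitary_group_of D A U"
    and D_ell2: "D \<subseteq> ell2" and A_ell2: "\<And>u. u \<in> D \<Longrightarrow> A u \<in> ell2"
begin

lemma unitary: "unitary_on_ell2 (U t)"
  using group by (simp add: unitary_group_of_def)

lemmas U_ell2 = unitary_on_ell2D(1)[OF unitary] and U_norm = unitary_on_ell2D(4)[OF unitary]
  and U_scale = unitary_on_ell2D(3)[OF unitary] and U_diff = unitary_on_ell2_diff[OF unitary]

lemma U_0: "u \<in> ell2 \<Longrightarrow> U 0 u = u"
  using group by (simp add: unitary_group_of_def)

lemma U_add: "u \<in> ell2 \<Longrightarrow> U (s + t) u = U s (U t u)"
  using group by (simp add: unitary_group_of_def)

lemma generator:
  assumes "u \<in> ell2" "v \<in> ell2"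
  shows "((\<lambda>h. ell2_norm (\<lambda>n. (U h u n - u n) / of_real h - v n)) \<longlongrightarrow> 0) (at 0)
        \<longleftrightarrow> u \<in> D \<and> v = (\<lambda>n. - \<i> * A u n)"
proof -
  have "\<forall>u\<in>ell2. \<forall>v\<in>ell2.
        ((\<lambda>h. ell2_norm (\<lambda>n. (U h u n - u n) / of_real h - v n)) \<longlongrightarrow> 0) (at 0)
        \<longleftrightarrow> u \<in> D \<and> v = (\<lambda>n. - \<i> * A u n)"
    using group unfolding unitary_group_of_def by (elim conjE) assumption
  from bspec[OF bspec[OF this assms(1)] assms(2)] show ?thesis .
qed

lemma U_quotient:
  assumes "u \<in> ell2" "w \<in> ell2" "v \<in> ell2"
  shows "U s (\<lambda>n. (w n - u n) / of_real h - v n) = (\<lambda>n. (U s w n - U s u n) / of_real h - U s v n)"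
proof -
  have 1: "(\<lambda>n. w n - u n) \<in> ell2" by (intro ell2_diff assms)
  have 2: "(\<lambda>n. inverse (of_real h) * (w n - u n)) \<in> ell2" by (rule ell2_scale[OF 1])
  have "U s (\<lambda>n. inverse (of_real h) * (w n - u n) - v n) = (\<lambda>n. inverse (of_real h) * (U s w n - U s u n) - U s v n)"
    unfolding U_diff[OF 2 assms(3)] U_scale[OF 1] U_diff[OF assms(2,1)] ..
  then show ?thesis by (simp add: divide_inverse mult.commute)
qed

text \<open>\<open>U s\<close> is isometric and commutes with \<open>U h\<close>, so the difference
  quotient at \<open>U s u\<close> has the same error as at \<open>u\<close>, and the generator
  property identifies its limit.\<close>

lemma U_invariant:
  assumes u: "u \<in> D"
  shows "U s u \<in> D" "(\<lambda>n. - \<i> * A (U s u) n) = U s (\<lambda>n. - \<i> * A u n)"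
proof -
  define v where "v = (\<lambda>n. - \<i> * A u n)"
  have ue: "u \<in> ell2" using u D_ell2 by auto
  have ve: "v \<in> ell2" unfolding v_def by (intro ell2_scale A_ell2 u)
  have "((\<lambda>h. ell2_norm (\<lambda>n. (U h u n - u n) / of_real h - v n)) \<longlongrightarrow> 0) (at 0)"
    using generator[OF ue ve] u by (simp add: v_def)
  moreover have "ell2_norm (\<lambda>n. (U h (U s u) n - U s u n) / of_real h - U s v n) =
      ell2_norm (\<lambda>n. (U h u n - u n) / of_real h - v n)" for h
  proof -
    have "U h (U s u) = U s (U h u)" using U_add[OF ue, of h s] U_add[OF ue, of s h] by (simp add: add.commute)
    then have "(\<lambda>n. (U h (U s u) n - U s u n) / of_real h - U s v n) = U s (\<lambda>n. (U h u n - u n) / of_real h - v n)"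
      using U_quotient[OF ue U_ell2[OF ue, of h] ve, of s h] by simp
    then show ?thesis using U_norm[OF difference_quotient_ell2[OF ue U_ell2[OF ue, of h] ve], of s h] by simp
  qed
  ultimately have "((\<lambda>h. ell2_norm (\<lambda>n. (U h (U s u) n - U s u n) / of_real h - U s v n)) \<longlongrightarrow> 0) (at 0)"
    by simp
  with generator[OF U_ell2[OF ue, of s] U_ell2[OF ve, of s]]
  show "U s u \<in> D" "(\<lambda>n. - \<i> * A (U s u) n) = U s (\<lambda>n. - \<i> * A u n)" by (auto simp: v_def)
qed

end

text \<open>For u in D the path U(-s) V(s) u is constant; density of D and isometry extend the
  equality to \<open>ell2\<close>. Constancy is shown coordinate by coordinate, so a scalar
  zero-derivative argument suffices.\<close>

theorem unitary_group_of_unique: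
  assumes U: "unitary_group_of D A U" and V: "unitary_group_of D A V"
    and D: "D \<subseteq> ell2" "\<And>u. u \<in> D \<Longrightarrow> A u \<in> ell2"
    and dense: "\<And>u e. u \<in> ell2 \<Longrightarrow> e > 0 \<Longrightarrow> \<exists>w\<in>D. ell2_norm (\<lambda>n. u n - w n) < e"
  shows "U = V"
proof -
  interpret U: ell2_group D A U by unfold_locales (use U D in auto)
  interpret V: ell2_group D A V by unfold_locales (use V D in auto)
  have on_D: "V s u = U s u" if u: "u \<in> D" for s u
  proof -
    have ue: "u \<in> ell2" using u D by auto
    define w where "w s = U (- s) (V s u)" for s
    have "((\<lambda>s. w s n) has_vector_derivative 0) (at s)" for s n
      unfolding has_vector_derivative_iff_quotient
    proof (rule Lim_null_comparison)
      define x where "x = V s u"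
      have x: "x \<in> D" unfolding x_def by (rule V.U_invariant[OF u])
      have xe: "x \<in> ell2" using x D by auto
      define v where "v = (\<lambda>n. - \<i> * A x n)"
      have ve: "v \<in> ell2" unfolding v_def by (intro ell2_scale D x)
      let ?q = "\<lambda>W h n. (W h x n - x n) / complex_of_real h - v n"
      have "((\<lambda>h. ell2_norm (?q V h)) \<longlongrightarrow> 0) (at 0)" "((\<lambda>h. ell2_norm (?q U h)) \<longlongrightarrow> 0) (at 0)"
        using V.generator[OF xe ve] U.generator[OF xe ve] x by (simp_all add: v_def)
      then show "((\<lambda>h. ell2_norm (?q V h) + ell2_norm (?q U h)) \<longlongrightarrow> 0) (at 0)"
        by (rule tendsto_add_zero)
      \<comment> \<open>Both w(s + h) and w(s) are the isometry U(-s - h) applied to V h x and to U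
        h x. The quotient is thus bounded by the distance of two difference quotients at x with the
        same limit v, in place of a product rule.\<close>
      have "cmod ((w (s + h) n - w s n) / of_real h - 0) \<le> ell2_norm (?q V h) + ell2_norm (?q U h)" for h
      proof -
        have Ve: "V h x \<in> ell2" and Ue: "U h x \<in> ell2" using xe by (auto intro: V.U_ell2 U.U_ell2)
        have "V (s + h) u = V h x" using V.U_add[OF ue, of h s] by (simp add: x_def add.commute)
        then have "w (s + h) = U (- s - h) (V h x)" by (simp add: w_def)
        moreover have "w s = U (- s - h) (U h x)"
          using U.U_add[OF xe, of "- s - h" h] by (simp add: w_def x_def)
        ultimately have "w (s + h) n - w s n = U (- s - h) (\<lambda>n. V h x n - U h x n) n"
          using U.U_diff[OF Ve Ue] by simp
        also have "cmod \<dots> \<le> ell2_norm (\<lambda>n. V h x n - U h x n)"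
          using ell2_coord_le[OF U.U_ell2[OF ell2_diff(1)[OF Ve Ue]], of "- s - h" n]
            U.U_norm[OF ell2_diff(1)[OF Ve Ue], of "- s - h"] by simp
        finally have 1: "cmod (w (s + h) n - w s n) \<le> ell2_norm (\<lambda>n. V h x n - U h x n)" .
        have "cmod ((w (s + h) n - w s n) / of_real h - 0) = cmod (inverse (of_real h)) * cmod (w (s + h) n - w s n)"
          by (simp only: diff_zero divide_inverse norm_mult mult.commute)
        also have "\<dots> \<le> cmod (inverse (of_real h)) * ell2_norm (\<lambda>n. V h x n - U h x n)"
          using 1 by (rule mult_left_mono) simp
        also have "\<dots> = ell2_norm (\<lambda>n. inverse (of_real h) * (V h x n - U h x n))"
          using ell2_scale(2)[OF ell2_diff(1)[OF Ve Ue], of "inverse (of_real h)"] by simp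
        also have "(\<lambda>n. inverse (of_real h) * (V h x n - U h x n)) = (\<lambda>n. ?q V h n - ?q U h n)"
          by (simp add: divide_inverse algebra_simps)
        also have "ell2_norm \<dots> \<le> ell2_norm (?q V h) + ell2_norm (?q U h)"
          by (intro ell2_diff difference_quotient_ell2 xe ve Ve Ue)
        finally show ?thesis .
      qed
      then show "\<forall>\<^sub>F h in at 0. norm (cmod ((w (s + h) n - w s n) / of_real h - 0)) \<le> ell2_norm (?q V h) + ell2_norm (?q U h)"
        by simp
    qed
    then have "w s n = w 0 n" for s n
      using has_vector_derivative_zero_constant[of UNIV "\<lambda>s. w s n"]
      by (metis UNIV_I convex_UNIV has_vector_derivative_at_within)
    then have "w s = u" for s using U.U_0 V.U_0 ue by (auto simp: w_def fun_eq_iff)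
    then have "U s (U (- s) (V s u)) = U s u" by (simp add: w_def)
    moreover have "U s (U (- s) (V s u)) = V s u"
      using U.U_add[OF V.U_ell2[OF ue, of s], of s "- s"] U.U_0[OF V.U_ell2[OF ue, of s]] by simp
    ultimately show ?thesis by simp
  qed
  have "V t u n = U t u n" if ue: "u \<in> ell2" for t u n
  proof (rule ccontr)
    assume ne: "V t u n \<noteq> U t u n"
    define e where "e = cmod (V t u n - U t u n) / 2"
    have "e > 0" using ne by (simp add: e_def)
    then obtain w where w: "w \<in> D" "ell2_norm (\<lambda>n. u n - w n) < e" using dense[OF ue] by blast
    have we: "w \<in> ell2" using w D by auto
    have "cmod (V t u n - V t w n) \<le> ell2_norm (\<lambda>n. u n - w n)"
      using ell2_coord_le[OF V.U_ell2[OF ell2_diff(1)[OF ue we]], of t n] V.U_norm[OF ell2_diff(1)[OF ue we], of t]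
        V.U_diff[OF ue we, of t] by simp
    moreover have "cmod (U t u n - U t w n) \<le> ell2_norm (\<lambda>n. u n - w n)"
      using ell2_coord_le[OF U.U_ell2[OF ell2_diff(1)[OF ue we]], of t n] U.U_norm[OF ell2_diff(1)[OF ue we], of t]
        U.U_diff[OF ue we, of t] by simp
    moreover have "V t u n - U t u n = (V t u n - V t w n) - (U t u n - U t w n)" using on_D[OF w(1), of t] by simp
    then have "cmod (V t u n - U t u n) \<le> cmod (V t u n - V t w n) + cmod (U t u n - U t w n)"
      by (metis norm_triangle_ineq4)
    ultimately show False using w(2) by (simp add: e_def)
  qed
  then have "V t u = U t u" if "u \<in> ell2" for t u using that by (simp add: fun_eq_iff)
  moreover have "V t u = U t u" if "u \<notin> ell2" for t u
    using that unitary_on_ell2D(5)[OF V.unitary] unitary_on_ell2D(5)[OF U.unitary] by simp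
  ultimately show ?thesis by (intro ext) metis
qed

section \<open>The Laguerre propagator\<close>

text \<open>The restriction to \<open>ell2\<close> yields the value \<open>undefined\<close>
  elsewhere that \<open>unitary_on_ell2\<close> demands.\<close>

definition lag_U :: "real \<Rightarrow> real \<Rightarrow> seq \<Rightarrow> seq" where
  "lag_U \<alpha> t = (\<lambda>u\<in>ell2. \<lambda>n. \<Sum>m. lag_kernel \<alpha> t n m * u m)"

definition truncate :: "nat \<Rightarrow> seq \<Rightarrow> seq" where
  "truncate N u = (\<lambda>n. if n < N then u n else 0)"

lemma truncate_ell2: "truncate N u \<in> ell2"
  unfolding truncate_def by (rule ell2_finite_support)

lemma truncate_tendsto: "u \<in> ell2 \<Longrightarrow> (\<lambda>N. ell2_norm (\<lambda>n. u n - truncate N u n)) \<longlonglongrightarrow> 0"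
  unfolding truncate_def by (rule ell2_tail_tendsto_0)

lemma truncate_Suc: "truncate (Suc N) u = (\<lambda>n. truncate N u n + u N * (if n = N then 1 else 0))"
  by (auto simp: truncate_def fun_eq_iff less_Suc_eq)

locale laguerre =
  fixes \<alpha> :: real
  assumes \<alpha>: "\<alpha> \<ge> 0"
begin

abbreviation "G \<equiv> lag_kernel \<alpha>"
abbreviation "U \<equiv> lag_U \<alpha>"
abbreviation "H \<equiv> laguerre_op \<alpha>"

lemma U_apply: "u \<in> ell2 \<Longrightarrow> U t u n = (\<Sum>m. G t n m * u m)"
  by (simp add: lag_U_def)

lemma U_sums: "u \<in> ell2 \<Longrightarrow> (\<lambda>m. G t n m * u m) sums U t u n"
  unfolding U_apply using summable_lag_kernel_mult[OF \<alpha> ell2_coord_le] by (rule summable_sums)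

lemma U_truncate: "U t (truncate N u) n = (\<Sum>m<N. G t n m * u m)"
proof -
  have "(\<lambda>m. if m \<in> {..<N} then G t n m * u m else 0) sums (\<Sum>m<N. G t n m * u m)"
    by (rule sums_If_finite_set) simp
  then have "(\<lambda>m. G t n m * truncate N u m) sums (\<Sum>m<N. G t n m * u m)"
    by (rule sums_cong[THEN iffD1, rotated]) (simp add: truncate_def)
  then show ?thesis using U_sums[OF truncate_ell2] sums_unique2 by blast
qed

lemma kernel_orthonormal: "(\<lambda>k. cnj (G t k n) * G t k m) sums (if n = m then 1 else 0)"
  using lag_kernel_group_law[OF \<alpha>, of "- t" n t m]
  by (simp add: cnj_lag_kernel lag_kernel_0[OF \<alpha>] lag_kernel_commute[of _ _ _ n])

text \<open>Parseval on finitely supported sequences, from the orthonormality of the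
  columns.\<close>

lemma U_truncate_norm_sums:
  "(\<lambda>k. (cmod (\<Sum>m<N. G t k m * u m))\<^sup>2) sums (\<Sum>m<N. (cmod (u m))\<^sup>2)"
proof -
  have "(\<lambda>k. \<Sum>m<N. \<Sum>l<N. cnj (u m) * u l * (cnj (G t k m) * G t k l)) sums
     (\<Sum>m<N. \<Sum>l<N. cnj (u m) * u l * (if m = l then 1 else 0))"
    by (intro sums_sum sums_mult kernel_orthonormal)
  also have "(\<Sum>m<N. \<Sum>l<N. cnj (u m) * u l * (if m = l then 1 else 0)) = complex_of_real (\<Sum>m<N. (cmod (u m))\<^sup>2)"
    unfolding of_real_sum
  proof (intro sum.cong refl)
    fix m assume "m \<in> {..<N}"
    then have "(\<Sum>l<N. cnj (u m) * u l * (if m = l then 1 else 0)) = cnj (u m) * u m"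
      by (simp add: if_distrib cong: if_cong)
    then show "(\<Sum>l<N. cnj (u m) * u l * (if m = l then 1 else 0)) = complex_of_real ((cmod (u m))\<^sup>2)"
      by (simp only: complex_norm_square mult.commute)
  qed
  also have "(\<lambda>k. \<Sum>m<N. \<Sum>l<N. cnj (u m) * u l * (cnj (G t k m) * G t k l)) =
     (\<lambda>k. complex_of_real ((cmod (\<Sum>m<N. G t k m * u m))\<^sup>2))"
  proof
    fix k
    have "complex_of_real ((cmod (\<Sum>m<N. G t k m * u m))\<^sup>2) = (\<Sum>m<N. cnj (G t k m * u m)) * (\<Sum>l<N. G t k l * u l)"
      unfolding complex_norm_square cnj_sum by (rule mult.commute)
    also have "\<dots> = (\<Sum>m<N. \<Sum>l<N. cnj (u m) * u l * (cnj (G t k m) * G t k l))"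
      unfolding sum_product by (intro sum.cong refl) simp
    finally show "(\<Sum>m<N. \<Sum>l<N. cnj (u m) * u l * (cnj (G t k m) * G t k l)) =
        complex_of_real ((cmod (\<Sum>m<N. G t k m * u m))\<^sup>2)" by simp
  qed
  finally show ?thesis unfolding sums_of_real_iff .
qed

text \<open>For a fixed number K of coordinates the truncation level N tends to infinity, as in
  Fatou's lemma, so only an inequality survives. Equality of norms follows in \<open>U_norm\<close>
  by applying it to the inverse U(-t) as well.\<close>

lemma U_contraction:
  assumes u: "u \<in> ell2"
  shows "U t u \<in> ell2" "ell2_norm (U t u) \<le> ell2_norm u"
proof -
  have "(\<Sum>k<K. (cmod (U t u k))\<^sup>2) \<le> (ell2_norm u)\<^sup>2" for K
  proof (rule LIMSEQ_le_const2)
    have "(\<lambda>N. \<Sum>m<N. G t k m * u m) \<longlonglongrightarrow> U t u k" for k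
      using U_sums[OF u] by (simp add: sums_def)
    then show "(\<lambda>N. \<Sum>k<K. (cmod (\<Sum>m<N. G t k m * u m))\<^sup>2) \<longlonglongrightarrow> (\<Sum>k<K. (cmod (U t u k))\<^sup>2)"
      by (intro tendsto_intros)
    have "(\<Sum>k<K. (cmod (\<Sum>m<N. G t k m * u m))\<^sup>2) \<le> (ell2_norm u)\<^sup>2" for N
    proof -
      have "(\<Sum>k<K. (cmod (\<Sum>m<N. G t k m * u m))\<^sup>2) \<le> (\<Sum>m<N. (cmod (u m))\<^sup>2)"
        using U_truncate_norm_sums[of t u N] sum_le_suminf[of "\<lambda>k. (cmod (\<Sum>m<N. G t k m * u m))\<^sup>2" "{..<K}"]
        by (auto simp: sums_iff)
      also have "\<dots> \<le> (ell2_norm u)\<^sup>2" using u by (rule ell2_partial_sum_le)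
      finally show ?thesis .
    qed
    then show "\<exists>N0. \<forall>N\<ge>N0. (\<Sum>k<K. (cmod (\<Sum>m<N. G t k m * u m))\<^sup>2) \<le> (ell2_norm u)\<^sup>2" by blast
  qed
  from ell2_boundedI[OF ell2_norm_nonneg[OF u] this] show "U t u \<in> ell2" "ell2_norm (U t u) \<le> ell2_norm u" by auto
qed

lemma U_plus: "u \<in> ell2 \<Longrightarrow> v \<in> ell2 \<Longrightarrow> U t (\<lambda>n. u n + v n) = (\<lambda>n. U t u n + U t v n)"
  using sums_add[OF U_sums U_sums, of u v t _ t] U_sums[OF ell2_add(1), of u v t]
  by (intro ext) (auto simp: distrib_left intro: sums_unique2)

lemma U_scale: "u \<in> ell2 \<Longrightarrow> U t (\<lambda>n. c * u n) = (\<lambda>n. c * U t u n)"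
  using sums_mult[OF U_sums, of u c t] U_sums[OF ell2_scale(1), of u t _ c]
  by (intro ext) (auto simp: mult.left_commute[of c] intro: sums_unique2)

lemma U_minus: "u \<in> ell2 \<Longrightarrow> v \<in> ell2 \<Longrightarrow> U t (\<lambda>n. u n - v n) = (\<lambda>n. U t u n - U t v n)"
  using U_plus[OF _ ell2_scale(1)[of v "-1"], of u t] U_scale[of v t "-1"] by simp

lemma U_0: "u \<in> ell2 \<Longrightarrow> U 0 u = u"
proof
  fix n assume u: "u \<in> ell2"
  have "(\<lambda>m. if m = n then u m else 0) sums u n" by (rule sums_single)
  then have "(\<lambda>m. G 0 n m * u m) sums u n"
    by (rule sums_cong[THEN iffD1, rotated]) (simp add: lag_kernel_0[OF \<alpha>])
  then show "U 0 u n = u n" using U_sums[OF u] sums_unique2 by blast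
qed

lemma U_group_truncate: "U s (U t (truncate N u)) n = U (s + t) (truncate N u) n"
proof -
  have "(\<lambda>k. \<Sum>m<N. (G s n k * G t k m) * u m) sums (\<Sum>m<N. G (s + t) n m * u m)"
    by (intro sums_sum sums_mult2 lag_kernel_group_law \<alpha>)
  then have "(\<lambda>k. G s n k * U t (truncate N u) k) sums (\<Sum>m<N. G (s + t) n m * u m)"
    unfolding U_truncate by (simp add: sum_distrib_left mult.assoc)
  then show ?thesis
    using U_sums[OF U_contraction(1)[OF truncate_ell2]] sums_unique2 unfolding U_truncate[of "s + t"] by blast
qed

text \<open>On truncations the sums may be exchanged and the law is the one for matrix entries;
  since all operators are contractions, it passes to the limit in each coordinate.\<close>

lemma U_add:
  assumes u: "u \<in> ell2"
  shows "U (s + t) u = U s (U t u)"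
proof
  fix n
  have "cmod (U s (U t u) n - U (s + t) u n) \<le> 0"
  proof (rule LIMSEQ_le_const)
    show "(\<lambda>N. ell2_norm (\<lambda>n. u n - truncate N u n) + ell2_norm (\<lambda>n. u n - truncate N u n)) \<longlonglongrightarrow> 0"
      using tendsto_add[OF truncate_tendsto[OF u] truncate_tendsto[OF u]] by simp
    have "cmod (U s (U t u) n - U (s + t) u n) \<le> ell2_norm (\<lambda>n. u n - truncate N u n) + ell2_norm (\<lambda>n. u n - truncate N u n)" for N
    proof -
      let ?v = "truncate N u"
      let ?d = "\<lambda>n. u n - ?v n"
      have v: "?v \<in> ell2" by (rule truncate_ell2)
      have d: "?d \<in> ell2" using u v by (rule ell2_diff)
      have 1: "U s (U t u) n - U s (U t ?v) n = U s (U t ?d) n"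
        using U_minus[OF U_contraction(1)[OF u] U_contraction(1)[OF v], of s t t] U_minus[OF u v, of t] by simp
      have 2: "U (s + t) u n - U (s + t) ?v n = U (s + t) ?d n"
        using U_minus[OF u v, of "s + t"] by simp
      have "U s (U t u) n - U (s + t) u n = U s (U t ?d) n - U (s + t) ?d n"
        using 1 2 U_group_truncate[of s t N u n] by (simp add: algebra_simps)
      also have "cmod \<dots> \<le> cmod (U s (U t ?d) n) + cmod (U (s + t) ?d n)" by (rule norm_triangle_ineq4)
      also have "cmod (U s (U t ?d) n) \<le> ell2_norm ?d"
        using ell2_coord_le[OF U_contraction(1)[OF U_contraction(1)[OF d]], of s t n]
          U_contraction(2)[OF U_contraction(1)[OF d], of s t] U_contraction(2)[OF d, of t] by linarith
      also have "cmod (U (s + t) ?d n) \<le> ell2_norm ?d"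
        using ell2_coord_le[OF U_contraction(1)[OF d], of "s + t" n] U_contraction(2)[OF d, of "s + t"] by linarith
      finally show ?thesis by simp
    qed
    then show "\<exists>N0. \<forall>N\<ge>N0. cmod (U s (U t u) n - U (s + t) u n) \<le> ell2_norm (\<lambda>n. u n - truncate N u n) + ell2_norm (\<lambda>n. u n - truncate N u n)"
      by blast
  qed
  then show "U (s + t) u n = U s (U t u) n" by simp
qed

lemma U_inverse: "u \<in> ell2 \<Longrightarrow> U (- t) (U t u) = u" "u \<in> ell2 \<Longrightarrow> U t (U (- t) u) = u"
  using U_add[of u "- t" t] U_add[of u t "- t"] U_0[of u] by simp_all

lemma U_norm:
  assumes "u \<in> ell2"
  shows "ell2_norm (U t u) = ell2_norm u"
  using U_contraction(2)[OF assms, of t] U_contraction(2)[OF U_contraction(1)[OF assms], of "- t" t] U_inverse(1)[OF assms, of t]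
  by simp

lemma unitary_U: "unitary_on_ell2 (U t)"
  unfolding unitary_on_ell2_def
proof (intro conjI ballI allI)
  show "U t \<in> extensional ell2" by (simp add: lag_U_def)
  show "bij_betw (U t) ell2 ell2"
    by (rule bij_betw_byWitness[where f' = "U (- t)"]) (auto simp: U_inverse intro: U_contraction)
qed (auto simp: U_plus U_scale U_norm)

lemma U_delta: "U t (\<lambda>n. if n = m then 1 else 0) n = G t n m"
proof -
  have "(\<lambda>k. if k = m then G t n k else 0) sums G t n m" by (rule sums_single)
  then have "(\<lambda>k. G t n k * (if k = m then 1 else 0)) sums G t n m"
    by (rule sums_cong[THEN iffD1, rotated]) simp
  then show ?thesis using U_sums[OF ell2_delta(1)] sums_unique2 by blast
qed

text \<open>The column has norm 1, so its squared distance from the unit vector is 2 - 2 Re G h m m,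
  and continuity of one diagonal entry suffices.\<close>

lemma U_continuous_delta:
  "((\<lambda>h. ell2_norm (\<lambda>n. U h (\<lambda>n. if n = m then 1 else 0) n - (if n = m then 1 else 0))) \<longlongrightarrow> 0) (at 0)"
proof -
  have "ell2_norm (\<lambda>n. U h (\<lambda>n. if n = m then 1 else 0) n - (if n = m then 1 else 0)) = sqrt (2 - 2 * Re (G h m m))" for h
  proof -
    have "(\<lambda>k. (cmod (G h k m))\<^sup>2) sums 1"
    proof -
      have "(\<lambda>k. complex_of_real ((cmod (G h k m))\<^sup>2)) sums complex_of_real 1"
        using kernel_orthonormal[of h m m] by (simp only: complex_norm_square mult.commute simp_thms if_True of_real_1)
      then show ?thesis unfolding sums_of_real_iff .
    qed
    then have "(\<lambda>k. (cmod (G h k m))\<^sup>2 + (if k = m then 1 - 2 * Re (G h k m) else 0)) sums (1 + (1 - 2 * Re (G h m m)))"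
      by (intro sums_add sums_single)
    moreover have "(cmod (G h k m))\<^sup>2 + (if k = m then 1 - 2 * Re (G h k m) else 0) = (cmod (G h k m - (if k = m then 1 else 0)))\<^sup>2" for k
      unfolding cmod_power2 by (simp add: power2_eq_square algebra_simps)
    ultimately show ?thesis by (simp add: ell2_norm_def U_delta sums_iff)
  qed
  moreover have "((\<lambda>h. sqrt (2 - 2 * Re (G h m m))) \<longlongrightarrow> sqrt (2 - 2 * Re (G 0 m m))) (at 0)"
  proof -
    have "isCont (\<lambda>h. G h m m) 0"
      using has_vector_derivative_continuous[OF lag_kernel_vector_derivative[OF \<alpha>, of m m 0]] .
    then show ?thesis by (intro tendsto_intros) (simp add: isCont_def)
  qed
  ultimately show ?thesis by (simp add: lag_kernel_0[OF \<alpha>])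
qed

lemma U_continuous_truncate:
  "((\<lambda>h. ell2_norm (\<lambda>n. U h (truncate N u) n - truncate N u n)) \<longlongrightarrow> 0) (at 0)"
proof (induction N)
  case 0
  have "truncate 0 u = (\<lambda>n. 0)" by (simp add: truncate_def)
  moreover have "U h (\<lambda>n. 0) = (\<lambda>n. 0)" for h using U_scale[OF ell2_zero(1), of h 0] by simp
  ultimately show ?case by (simp add: ell2_zero)
next
  case (Suc N)
  let ?d = "\<lambda>n. if n = N then 1 else 0 :: complex"
  have "((\<lambda>h. ell2_norm (\<lambda>n. U h (truncate N u) n - truncate N u n) + cmod (u N) * ell2_norm (\<lambda>n. U h ?d n - ?d n)) \<longlongrightarrow> 0) (at 0)"
    using tendsto_add[OF Suc.IH tendsto_mult[OF tendsto_const U_continuous_delta]] by simp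
  then show ?case
  proof (rule Lim_null_comparison[rotated])
    have "ell2_norm (\<lambda>n. U h (truncate (Suc N) u) n - truncate (Suc N) u n) \<le>
      ell2_norm (\<lambda>n. U h (truncate N u) n - truncate N u n) + cmod (u N) * ell2_norm (\<lambda>n. U h ?d n - ?d n)" for h
    proof -
      have "U h (truncate (Suc N) u) = (\<lambda>n. U h (truncate N u) n + u N * U h ?d n)"
        unfolding truncate_Suc U_plus[OF truncate_ell2 ell2_scale(1)[OF ell2_delta(1)]] U_scale[OF ell2_delta(1)] ..
      then have e: "(\<lambda>n. U h (truncate (Suc N) u) n - truncate (Suc N) u n) =
         (\<lambda>n. (U h (truncate N u) n - truncate N u n) + u N * (U h ?d n - ?d n))"
        unfolding truncate_Suc by (simp add: algebra_simps)
      have A: "(\<lambda>n. U h (truncate N u) n - truncate N u n) \<in> ell2" and B: "(\<lambda>n. U h ?d n - ?d n) \<in> ell2"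
        by (intro ell2_diff U_contraction truncate_ell2 ell2_delta)+
      show ?thesis
        unfolding e using ell2_add(2)[OF A ell2_scale(1)[OF B, of "u N"]] unfolding ell2_scale(2)[OF B] .
    qed
    moreover have "ell2_norm (\<lambda>n. U h (truncate (Suc N) u) n - truncate (Suc N) u n) \<ge> 0" for h
      by (intro ell2_norm_nonneg ell2_diff U_contraction truncate_ell2)
    ultimately show "\<forall>\<^sub>F h in at 0. norm (ell2_norm (\<lambda>n. U h (truncate (Suc N) u) n - truncate (Suc N) u n)) \<le>
      ell2_norm (\<lambda>n. U h (truncate N u) n - truncate N u n) + cmod (u N) * ell2_norm (\<lambda>n. U h ?d n - ?d n)"
      by simp
  qed
qed

lemma U_continuous_0:
  assumes u: "u \<in> ell2"
  shows "((\<lambda>h. ell2_norm (\<lambda>n. U h u n - u n)) \<longlongrightarrow> 0) (at 0)"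
proof (rule tendstoI)
  fix e :: real assume "e > 0"
  obtain N where N: "ell2_norm (\<lambda>n. u n - truncate N u n) < e / 3"
    using order_tendstoD(2)[OF truncate_tendsto[OF u], of "e / 3"] \<open>e > 0\<close>
    by (auto simp: eventually_sequentially)
  let ?v = "truncate N u"
  have v: "?v \<in> ell2" by (rule truncate_ell2)
  have "\<forall>\<^sub>F h in at 0. ell2_norm (\<lambda>n. U h ?v n - ?v n) < e / 3"
    using order_tendstoD(2)[OF U_continuous_truncate[of N u], of "e / 3"] \<open>e > 0\<close> by simp
  then show "\<forall>\<^sub>F h in at 0. dist (ell2_norm (\<lambda>n. U h u n - u n)) 0 < e"
  proof eventually_elim
    case (elim h)
    have "ell2_norm (\<lambda>n. U h u n - u n) \<le> ell2_norm (\<lambda>n. U h u n - U h ?v n) + ell2_norm (\<lambda>n. U h ?v n - u n)"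
      by (intro ell2_norm_triangle_diff U_contraction u v)
    also have "(\<lambda>n. U h u n - U h ?v n) = U h (\<lambda>n. u n - ?v n)" by (simp add: U_minus u v)
    also have "ell2_norm \<dots> = ell2_norm (\<lambda>n. u n - ?v n)" by (intro U_norm ell2_diff u v)
    also have "ell2_norm (\<lambda>n. U h ?v n - u n) \<le> ell2_norm (\<lambda>n. U h ?v n - ?v n) + ell2_norm (\<lambda>n. ?v n - u n)"
      by (intro ell2_norm_triangle_diff U_contraction u v)
    also have "ell2_norm (\<lambda>n. ?v n - u n) = ell2_norm (\<lambda>n. u n - ?v n)" by (rule ell2_norm_minus_commute)
    finally have "ell2_norm (\<lambda>n. U h u n - u n) < e" using N elim by simp
    moreover have "ell2_norm (\<lambda>n. U h u n - u n) \<ge> 0" by (intro ell2_norm_nonneg ell2_diff U_contraction u)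
    ultimately show ?case by simp
  qed
qed

lemma U_continuous:
  assumes u: "u \<in> ell2"
  shows "((\<lambda>t. ell2_norm (\<lambda>n. U t u n - U s u n)) \<longlongrightarrow> 0) (at s)"
proof (subst LIM_offset_zero_iff[where a = s])
  have "ell2_norm (\<lambda>n. U (s + h) u n - U s u n) = ell2_norm (\<lambda>n. U h u n - u n)" for h
  proof -
    have "(\<lambda>n. U (s + h) u n - U s u n) = U s (\<lambda>n. U h u n - u n)"
      by (simp add: U_add u U_minus U_contraction)
    then show ?thesis by (simp add: U_norm ell2_diff U_contraction u)
  qed
  then show "((\<lambda>h. ell2_norm (\<lambda>n. U (s + h) u n - U s u n)) \<longlongrightarrow> 0) (at 0)"
    using U_continuous_0[OF u] by simp
qed simp

end

section \<open>Identification of the generator and of the propagator\<close>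

context laguerre
begin

lemma coord_derivative:
  assumes u: "u \<in> ell2" and Hu: "H u \<in> ell2"
  shows "((\<lambda>s. U s u n) has_vector_derivative U s (\<lambda>n. - \<i> * H u n) n) (at s)"
proof -
  have "((\<lambda>s. \<Sum>m. G s n m * u m) has_vector_derivative - \<i> * (\<Sum>m. G s n m * H u m)) (at s)"
    by (rule lag_propagator_coord_derivative[OF \<alpha> ell2_coord_le[OF u]])
  moreover have "- \<i> * (\<Sum>m. G s n m * H u m) = U s (\<lambda>n. - \<i> * H u n) n"
    unfolding U_scale[OF Hu] by (simp add: U_apply Hu)
  ultimately show ?thesis by (simp add: U_apply[OF u, abs_def])
qed

lemma coord_derivative_0:
  assumes u: "u \<in> ell2"
  shows "((\<lambda>s. U s u n) has_vector_derivative - \<i> * H u n) (at 0)"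
proof -
  have "(\<lambda>m. if m = n then H u m else 0) sums H u n" by (rule sums_single)
  then have "(\<lambda>m. G 0 n m * H u m) sums H u n"
    by (rule sums_cong[THEN iffD1, rotated]) (simp add: lag_kernel_0[OF \<alpha>])
  then have "(\<Sum>m. G 0 n m * H u m) = H u n" by (simp add: sums_iff)
  then show ?thesis
    using lag_propagator_coord_derivative[where u = u and n = n and t = 0, OF \<alpha> ell2_coord_le[OF u]] by (simp add: U_apply[OF u, abs_def])
qed

text \<open>Derivatives of coordinates must be upgraded to norm convergence. The error of the
  difference quotient, cut to K coordinates, is tested against itself; this gives a scalar function
  of time whose linearisation error is controlled by the norm of U s v - v, uniformly in K. The
  argument replaces the formula U h u - u = integral of U s v over [0, h].\<close>

lemma generator_laguerre:
  assumes u: "u \<in> ell2" and v: "v \<in> ell2" and Hu: "v = (\<lambda>n. - \<i> * H u n)" "H u \<in> ell2"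
  shows "((\<lambda>h. ell2_norm (\<lambda>n. (U h u n - u n) / of_real h - v n)) \<longlongrightarrow> 0) (at 0)"
proof (rule tendstoI)
  fix e :: real assume e: "e > 0"
  have "\<forall>\<^sub>F s in at 0. ell2_norm (\<lambda>n. U s v n - v n) < e / 2"
    using order_tendstoD(2)[OF U_continuous_0[OF v], of "e / 2"] e by simp
  then obtain d where d: "d > 0" "\<And>s. s \<noteq> 0 \<Longrightarrow> \<bar>s\<bar> < d \<Longrightarrow> ell2_norm (\<lambda>n. U s v n - v n) < e / 2"
    by (auto simp: eventually_at)
  have d': "ell2_norm (\<lambda>n. U s v n - v n) \<le> e / 2" if "\<bar>s\<bar> < d" for s
    using d(2)[of s] that e by (cases "s = 0") (simp_all add: U_0 v ell2_zero less_imp_le)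
  have le: "ell2_norm (\<lambda>n. (U h u n - u n) / of_real h - v n) \<le> e / 2" if h: "h \<noteq> 0" "\<bar>h\<bar> < d" for h
  proof (rule ell2_boundedI_L2_set)
    fix K
    define w where "w n = (U h u n - u n) / of_real h - v n" for n
    define S where "S = L2_set (\<lambda>n. cmod (w n)) {..<K}"
    \<comment> \<open>Testing against \<open>w\<close> makes the linearisation error exactly h S^2,
      while the mean value bound is |h| S e / 2; hence S \<le> e / 2.\<close>
    define \<Psi> where "\<Psi> s = (\<Sum>n<K. cnj (w n) * U s u n)" for s
    have der: "(\<Psi> has_vector_derivative (\<Sum>n<K. cnj (w n) * U s v n)) (at s)" for s
      unfolding \<Psi>_def[abs_def] Hu(1)
      by (intro has_vector_derivative_sum has_vector_derivative_mult_right coord_derivative u Hu)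
    have "norm (\<Psi> h - \<Psi> 0 - (h - 0) *\<^sub>R (\<Sum>n<K. cnj (w n) * U 0 v n)) \<le> norm (h - 0) * (S * (e / 2))"
    proof (rule vector_differentiable_bound_linearization[where S = "{-d<..<d}"])
      show "(\<Psi> has_vector_derivative (\<Sum>n<K. cnj (w n) * U s v n)) (at s within {-d<..<d})" for s
        by (rule has_vector_derivative_at_within[OF der])
      show "closed_segment 0 h \<subseteq> {-d<..<d}" using h d by (auto simp: closed_segment_eq_real_ivl)
      show "0 \<in> {-d<..<d}" using d by simp
      fix s assume s: "s \<in> {-d<..<d}"
      have "norm ((\<Sum>n<K. cnj (w n) * U s v n) - (\<Sum>n<K. cnj (w n) * U 0 v n)) = norm (\<Sum>n<K. cnj (w n) * (U s v n - v n))"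
        by (simp add: U_0 v sum_subtractf right_diff_distrib)
      also have "\<dots> \<le> (\<Sum>n<K. \<bar>cmod (w n)\<bar> * \<bar>cmod (U s v n - v n)\<bar>)"
        by (rule order_trans[OF norm_sum]) (simp add: norm_mult)
      also have "\<dots> \<le> S * L2_set (\<lambda>n. cmod (U s v n - v n)) {..<K}"
        unfolding S_def by (rule L2_set_mult_ineq)
      also have "\<dots> \<le> S * (e / 2)"
      proof (rule mult_left_mono)
        have 1: "L2_set (\<lambda>n. cmod (U s v n - v n)) {..<K} \<le> ell2_norm (\<lambda>n. U s v n - v n)"
          by (intro ell2_L2_set_le ell2_diff U_contraction v)
        have 2: "\<bar>s\<bar> < d" using s by auto
        show "L2_set (\<lambda>n. cmod (U s v n - v n)) {..<K} \<le> e / 2" by (rule order_trans[OF 1 d'[OF 2]])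
      qed (simp add: S_def L2_set_nonneg)
      finally show "norm ((\<Sum>n<K. cnj (w n) * U s v n) - (\<Sum>n<K. cnj (w n) * U 0 v n)) \<le> S * (e / 2)" .
    qed
    moreover have "\<Psi> h - \<Psi> 0 - (h - 0) *\<^sub>R (\<Sum>n<K. cnj (w n) * U 0 v n) = of_real (h * S\<^sup>2)"
    proof -
      have "\<Psi> h - \<Psi> 0 - (h - 0) *\<^sub>R (\<Sum>n<K. cnj (w n) * U 0 v n) = (\<Sum>n<K. cnj (w n) * (U h u n - u n - of_real h * v n))"
        by (simp add: \<Psi>_def U_0 u v scaleR_conv_of_real sum_distrib_left sum_subtractf sum.distrib algebra_simps)
      also have "\<dots> = (\<Sum>n<K. of_real h * complex_of_real ((cmod (w n))\<^sup>2))"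
      proof (intro sum.cong refl)
        fix n
        have "U h u n - u n - of_real h * v n = of_real h * w n" using h by (simp add: w_def field_simps)
        then show "cnj (w n) * (U h u n - u n - of_real h * v n) = of_real h * complex_of_real ((cmod (w n))\<^sup>2)"
          by (simp only: complex_norm_square) (simp only: mult_ac)
      qed
      also have "\<dots> = of_real (h * S\<^sup>2)"
        by (simp add: S_def L2_set_def sum_nonneg sum_distrib_left)
      finally show ?thesis .
    qed
    ultimately have "\<bar>h\<bar> * S\<^sup>2 \<le> \<bar>h\<bar> * (S * (e / 2))" by (simp only: norm_of_real) (simp add: abs_mult)
    then have "S\<^sup>2 \<le> S * (e / 2)" using h by simp
    moreover have "S \<ge> 0" by (simp add: S_def L2_set_nonneg)
    ultimately have "S \<le> e / 2" using e by (cases "S = 0") (simp_all add: power2_eq_square)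
    then show "L2_set (\<lambda>n. cmod ((U h u n - u n) / of_real h - v n)) {..<K} \<le> e / 2" by (simp add: S_def w_def)
  qed
  have "dist (ell2_norm (\<lambda>n. (U h u n - u n) / of_real h - v n)) 0 < e" if "h \<noteq> 0" "\<bar>h\<bar> < d" for h
  proof -
    have "ell2_norm (\<lambda>n. (U h u n - u n) / of_real h - v n) \<ge> 0"
      by (intro ell2_norm_nonneg difference_quotient_ell2 u v U_contraction)
    then have "dist (ell2_norm (\<lambda>n. (U h u n - u n) / of_real h - v n)) 0 \<le> e / 2"
      using le[OF that] by (simp only: dist_real_def diff_zero abs_of_nonneg)
    then show ?thesis using e by linarith
  qed
  then show "\<forall>\<^sub>F h in at 0. dist (ell2_norm (\<lambda>n. (U h u n - u n) / of_real h - v n)) 0 < e"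
    unfolding eventually_at using d(1) by (intro exI[of _ d]) auto
qed

lemma unitary_group_of_U: "unitary_group_of (laguerre_dom \<alpha>) H U"
  unfolding unitary_group_of_def
proof (intro conjI allI ballI)
  show "unitary_on_ell2 (U t)" for t by (rule unitary_U)
  show "U 0 u = u" if "u \<in> ell2" for u using that by (rule U_0)
  show "U (s + t) u = U s (U t u)" if "u \<in> ell2" for s t u using that by (rule U_add)
  show "((\<lambda>t. ell2_norm (\<lambda>n. U t u n - U s u n)) \<longlongrightarrow> 0) (at s)" if "u \<in> ell2" for u s
    using that by (rule U_continuous)
  fix u v assume u: "u \<in> ell2" and v: "v \<in> ell2"
  show "((\<lambda>h. ell2_norm (\<lambda>n. (U h u n - u n) / of_real h - v n)) \<longlongrightarrow> 0) (at 0)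
      \<longleftrightarrow> u \<in> laguerre_dom \<alpha> \<and> v = (\<lambda>n. - \<i> * H u n)"
  proof
    assume lim: "((\<lambda>h. ell2_norm (\<lambda>n. (U h u n - u n) / of_real h - v n)) \<longlongrightarrow> 0) (at 0)"
    \<comment> \<open>The coordinate derivative at 0 is - i H u for every u in \<open>ell2\<close>,
      so a norm limit v forces H u = i v to be square summable: this is the maximality of the
      domain.\<close>
    have vn: "v n = - \<i> * H u n" for n
    proof -
      have "((\<lambda>h. cmod ((U (0 + h) u n - U 0 u n) / of_real h - v n)) \<longlongrightarrow> 0) (at 0)"
      proof (rule Lim_null_comparison[OF always_eventually lim], rule allI)
        fix h
        show "norm (cmod ((U (0 + h) u n - U 0 u n) / of_real h - v n)) \<le> ell2_norm (\<lambda>n. (U h u n - u n) / of_real h - v n)"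
          using ell2_coord_le[OF difference_quotient_ell2[OF u U_contraction(1)[OF u] v]] by (simp add: U_0 u)
      qed
      then have "((\<lambda>s. U s u n) has_vector_derivative v n) (at 0)"
        by (simp add: has_vector_derivative_iff_quotient)
      then show ?thesis using coord_derivative_0[OF u, of n] by (rule vector_derivative_unique_at)
    qed
    have "H u = (\<lambda>n. \<i> * v n)" by (simp add: vn fun_eq_iff)
    then have "H u \<in> ell2" using ell2_scale(1)[OF v] by simp
    then show "u \<in> laguerre_dom \<alpha> \<and> v = (\<lambda>n. - \<i> * H u n)" using u vn by (auto simp: laguerre_dom_def)
  next
    assume "u \<in> laguerre_dom \<alpha> \<and> v = (\<lambda>n. - \<i> * H u n)"
    then show "((\<lambda>h. ell2_norm (\<lambda>n. (U h u n - u n) / of_real h - v n)) \<longlongrightarrow> 0) (at 0)"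
      using u v by (intro generator_laguerre) (auto simp: laguerre_dom_def)
  qed
qed

text \<open>H is tridiagonal and spreads the support by at most one index; the truncations supply
  the density of the domain for the uniqueness theorem.\<close>

lemma truncate_in_dom: "truncate N u \<in> laguerre_dom \<alpha>"
proof -
  have "H (truncate N u) = truncate (Suc N) (H (truncate N u))"
    by (auto simp: fun_eq_iff truncate_def laguerre_op_def)
  then have "H (truncate N u) \<in> ell2" using truncate_ell2 by metis
  then show ?thesis by (simp add: laguerre_dom_def truncate_ell2)
qed

theorem propagator_eq: "laguerre_propagator \<alpha> = U"
  unfolding laguerre_propagator_def exp_minus_it_def
proof (rule the_equality)
  show "unitary_group_of (laguerre_dom \<alpha>) H U" by (rule unitary_group_of_U)
  fix V assume V: "unitary_group_of (laguerre_dom \<alpha>) H V"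
  show "V = U"
  proof (rule unitary_group_of_unique[OF V unitary_group_of_U])
    show "laguerre_dom \<alpha> \<subseteq> ell2" "\<And>u. u \<in> laguerre_dom \<alpha> \<Longrightarrow> H u \<in> ell2" by (auto simp: laguerre_dom_def)
    fix u and e :: real assume "u \<in> ell2" "e > 0"
    then have "\<forall>\<^sub>F N in sequentially. ell2_norm (\<lambda>n. u n - truncate N u n) < e"
      using order_tendstoD(2)[OF truncate_tendsto, of u e] by simp
    then obtain N where "ell2_norm (\<lambda>n. u n - truncate N u n) < e" by (auto simp: eventually_sequentially)
    then show "\<exists>w\<in>laguerre_dom \<alpha>. ell2_norm (\<lambda>n. u n - w n) < e" using truncate_in_dom by blast
  qed
qed

section \<open>Operator norm and kernel entries\<close>

lemma opnorm_ge: "ereal (cmod (G t n m)) \<le> opnorm_1_inf (laguerre_propagator \<alpha> t)"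
proof -
  let ?d = "\<lambda>n. if n = m then 1 else 0 :: complex"
  have "(\<lambda>n. cmod (?d n)) sums 1"
    using sums_single[of m "\<lambda>_. 1 :: real"] by (rule sums_cong[THEN iffD1, rotated]) simp
  then have d: "?d \<in> {u \<in> ell1. ell1_norm u \<le> 1}" by (simp add: ell1_def ell1_norm_def sums_iff)
  have "ereal (cmod (G t n m)) \<le> ell_inf_norm (U t ?d)"
    unfolding ell_inf_norm_def by (rule SUP_upper2[of n]) (simp_all add: U_delta)
  then show ?thesis unfolding opnorm_1_inf_def propagator_eq by (rule SUP_upper2[OF d])
qed

lemma opnorm_le:
  assumes B: "\<And>n m. cmod (G t n m) \<le> B"
  shows "opnorm_1_inf (laguerre_propagator \<alpha> t) \<le> ereal B"
  unfolding opnorm_1_inf_def propagator_eq ell_inf_norm_def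
proof (intro SUP_least)
  fix u n assume "u \<in> {u \<in> ell1. ell1_norm u \<le> 1}"
  then have s: "summable (\<lambda>n. cmod (u n))" and le: "(\<Sum>n. cmod (u n)) \<le> 1"
    by (auto simp: ell1_def ell1_norm_def)
  have u1: "cmod (u k) \<le> 1" for k
    using sum_le_suminf[OF s, of "{k}"] le by simp
  \<comment> \<open>Entries of modulus at most 1 have squares dominated by their moduli, so the
    propagator acts on u by its defining series.\<close>
  have u: "u \<in> ell2"
    unfolding ell2_def mem_Collect_eq
    by (rule summable_comparison_test'[OF s, of 0]) (use u1 in \<open>simp add: power2_eq_square mult_left_le\<close>)
  have B0: "B \<ge> 0" by (rule order_trans[OF norm_ge_zero B])
  have le': "cmod (G t n m * u m) \<le> B * cmod (u m)" for m
    unfolding norm_mult using B by (rule mult_right_mono) simp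
  have s': "summable (\<lambda>m. B * cmod (u m))" using s by (rule summable_mult)
  have s'': "summable (\<lambda>m. cmod (G t n m * u m))"
    by (rule summable_comparison_test'[OF s', of 0]) (use le' in simp)
  have "cmod (U t u n) \<le> (\<Sum>m. cmod (G t n m * u m))"
    unfolding U_apply[OF u] using s'' by (rule summable_norm)
  also have "\<dots> \<le> (\<Sum>m. B * cmod (u m))" using le' s'' s' by (rule suminf_le)
  also have "\<dots> = B * (\<Sum>m. cmod (u m))" using s by (rule suminf_mult)
  also have "\<dots> \<le> B" using le B0 by (rule mult_left_le)
  finally show "ereal (cmod (U t u n)) \<le> ereal B" by simp
qed

end

section \<open>Dispersive estimate\<close>

lemma jacobi_bernstein_nat:
  assumes "n \<le> m" "\<alpha> \<ge> 0"
  shows "(\<Sum>j\<le>n. (-1) ^ j * real (n choose j) * y ^ j * (1 - y) ^ (n - j) * (fact j / pochhammer (\<alpha> + 1) j * real (m choose j)))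
    = fact m * Gamma (\<alpha> + 1) * jacobi_bernstein n (real (m - n)) \<alpha> y"
  unfolding jacobi_bernstein_def sum_distrib_left
proof (intro sum.cong refl)
  fix j assume "j \<in> {..n}"
  then have j: "j \<le> n" "j \<le> m" using assms by auto
  have p: "pochhammer (\<alpha> + 1) j = Gamma (\<alpha> + 1 + real j) / Gamma (\<alpha> + 1)"
    using assms by (intro pochhammer_Gamma_pos) auto
  have b: "real (m choose j) = fact m / (fact j * fact (m - j))" using j by (intro binomial_fact)
  have "real (m - n) + 1 + real (n - j) = real (m - j) + 1" using j assms by (simp add: of_nat_diff)
  then have g: "Gamma (real (m - n) + 1 + real (n - j)) = fact (m - j)"
    by (simp only: Gamma_fact[symmetric] add.commute)
  have "X * (f / (A / B) * (M / (f * D))) = M * B * (X / (A * D))" if "f \<noteq> 0" for X f A B M D :: real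
    using that by simp
  from this[OF fact_nonzero] show "(-1) ^ j * real (n choose j) * y ^ j * (1 - y) ^ (n - j) * (fact j / pochhammer (\<alpha> + 1) j * real (m choose j)) =
    fact m * Gamma (\<alpha> + 1) * ((-1) ^ j * real (n choose j) * y ^ j * (1 - y) ^ (n - j) /
      (Gamma (\<alpha> + 1 + real j) * Gamma (real (m - n) + 1 + real (n - j))))"
    unfolding p b g .
qed

lemma one_plus_square_bounds:
  fixes t :: real
  assumes "t \<noteq> 0"
  shows "0 < 1 / (1 + t\<^sup>2)" "1 / (1 + t\<^sup>2) < 1" "1 - 1 / (1 + t\<^sup>2) = t\<^sup>2 / (1 + t\<^sup>2)"
proof -
  have "1 + t\<^sup>2 > 0" by (simp add: add_pos_nonneg)
  then show "0 < 1 / (1 + t\<^sup>2)" "1 / (1 + t\<^sup>2) < 1" "1 - 1 / (1 + t\<^sup>2) = t\<^sup>2 / (1 + t\<^sup>2)"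
    using assms by (auto simp: field_simps)
qed

text \<open>Since (\<tau> / (\<tau> - 1))^2 = - 1 / t^2 is real, the common power (\<tau> - 1)^(m +
  n) factors out of the sum and a real sum \<open>S\<close> remains; dividing by t^2 is where t
  \<noteq> 0 enters.\<close>

lemma norm_lag_Q:
  assumes \<alpha>: "\<alpha> \<ge> 0" and nm: "n \<le> m" and t: "t \<noteq> 0"
  defines "y \<equiv> 1 / (1 + t\<^sup>2)"
  shows "(cmod (lag_Q (\<alpha> + 1) n m (lag_tau t)))\<^sup>2 =
    y powr (\<alpha> + 1) * (1 - y) ^ (m - n) * (fact m * Gamma (\<alpha> + 1) * jacobi_bernstein n (real (m - n)) \<alpha> y)\<^sup>2"
proof -
  define \<beta> where "\<beta> = \<alpha> + 1"
  define \<tau> where "\<tau> = lag_tau t"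
  define \<sigma> where "\<sigma> = \<tau> - 1"
  have y: "0 < y" "y < 1" "1 - y = t\<^sup>2 / (1 + t\<^sup>2)"
    unfolding y_def using one_plus_square_bounds[OF t] by auto
  define S where "S = (\<Sum>j\<le>n. fact j / pochhammer \<beta> j * (real (m choose j) * real (n choose j)) * (- (1 / t\<^sup>2)) ^ j)"
  have \<tau>2: "\<tau>\<^sup>2 = of_real (- (1 / t\<^sup>2)) * \<sigma>\<^sup>2"
    using t unfolding \<sigma>_def \<tau>_def lag_tau_minus_1 by (simp add: power_mult_distrib)
  have "lag_Q \<beta> n m \<tau> = lag_Q \<beta> m n \<tau>" by (rule lag_Q_commute)
  also have "\<dots> = \<tau> powr of_real \<beta> * (\<sigma> ^ (m + n) * of_real S)"
    unfolding lag_Q_def S_def of_real_sum sum_distrib_left \<sigma>_def[symmetric]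
  proof (rule sum.cong[OF refl], rule arg_cong2[where f = "(*)", OF refl])
    fix j assume "j \<in> {..n}"
    then have j: "j \<le> n" "j \<le> m" using nm by auto
    have "\<tau> ^ (2 * j) * (\<sigma> ^ (m - j) * \<sigma> ^ (n - j)) = of_real ((- (1 / t\<^sup>2)) ^ j) * (\<sigma> ^ (2 * j) * (\<sigma> ^ (m - j) * \<sigma> ^ (n - j)))"
      unfolding power_mult[of \<tau>] power_mult[of \<sigma>] \<tau>2 power_mult_distrib of_real_power by (simp only: mult.assoc)
    also have "\<sigma> ^ (2 * j) * (\<sigma> ^ (m - j) * \<sigma> ^ (n - j)) = \<sigma> ^ (m + n)"
      using j by (simp add: power_add[symmetric])
    finally have e: "\<tau> ^ (2 * j) * (\<sigma> ^ (m - j) * \<sigma> ^ (n - j)) = of_real ((- (1 / t\<^sup>2)) ^ j) * \<sigma> ^ (m + n)" .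
    have "of_real (fact j / pochhammer \<beta> j) * \<tau> ^ (2 * j) * (binom_mono \<sigma> m j * binom_mono \<sigma> n j) =
      of_real (fact j / pochhammer \<beta> j) * (of_nat (m choose j) * of_nat (n choose j)) * (\<tau> ^ (2 * j) * (\<sigma> ^ (m - j) * \<sigma> ^ (n - j)))"
      by (simp add: binom_mono_def mult_ac)
    also have "\<dots> = \<sigma> ^ (m + n) * of_real (fact j / pochhammer \<beta> j * (real (m choose j) * real (n choose j)) * (- (1 / t\<^sup>2)) ^ j)"
      unfolding e by (simp add: mult_ac)
    finally show "of_real (fact j / pochhammer \<beta> j) * \<tau> ^ (2 * j) * (binom_mono \<sigma> m j * binom_mono \<sigma> n j) =
       \<sigma> ^ (m + n) * of_real (fact j / pochhammer \<beta> j * (real (m choose j) * real (n choose j)) * (- (1 / t\<^sup>2)) ^ j)" .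
  qed
  finally have Q: "lag_Q \<beta> n m \<tau> = \<tau> powr of_real \<beta> * (\<sigma> ^ (m + n) * of_real S)" .
  have n\<tau>: "(cmod \<tau> powr \<beta>)\<^sup>2 = y powr \<beta>"
  proof -
    have "(cmod \<tau> powr \<beta>)\<^sup>2 = (cmod \<tau> * cmod \<tau>) powr \<beta>"
      by (simp only: powr_mult power2_eq_square)
    also have "cmod \<tau> * cmod \<tau> = y"
      using norm_lag_tau[of t] by (simp only: \<tau>_def y_def power2_eq_square)
    finally show ?thesis .
  qed
  have n\<sigma>: "(cmod \<sigma> ^ (m + n))\<^sup>2 = (1 - y) ^ (m + n)"
    unfolding y(3) \<sigma>_def \<tau>_def norm_lag_tau_minus_1[symmetric] by (simp only: power_mult[symmetric] mult.commute)
  have "(cmod (lag_Q \<beta> n m \<tau>))\<^sup>2 = y powr \<beta> * ((1 - y) ^ (m + n) * S\<^sup>2)"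
    unfolding Q norm_mult norm_power norm_powr_of_real[OF lag_tau_nonzero[of t, folded \<tau>_def]] power_mult_distrib n\<tau> n\<sigma> by simp
  also have "(1 - y) ^ (m + n) * S\<^sup>2 = (1 - y) ^ (m - n) * ((1 - y) ^ n * S)\<^sup>2"
  proof -
    have "(1 - y) ^ (m + n) = (1 - y) ^ (m - n) * ((1 - y) ^ n)\<^sup>2"
      using nm by (simp add: power_mult[symmetric] power_add[symmetric] add.commute)
    then show ?thesis by (simp add: power_mult_distrib)
  qed
  \<comment> \<open>Distributing (1 - y)^n over the terms produces the Bernstein form, because (1 -
    y) / t^2 = y.\<close>
  also have "(1 - y) ^ n * S = fact m * Gamma (\<alpha> + 1) * jacobi_bernstein n (real (m - n)) \<alpha> y"
    unfolding jacobi_bernstein_nat[OF nm \<alpha>, symmetric] S_def sum_distrib_left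
  proof (intro sum.cong refl)
    fix j assume "j \<in> {..n}"
    then have e1: "(1 - y) ^ n = (1 - y) ^ (n - j) * (1 - y) ^ j" by (simp add: power_add[symmetric])
    have e2: "(1 - y) ^ j * (- (1 / t\<^sup>2)) ^ j = (-1) ^ j * y ^ j"
    proof -
      have "(1 - y) * (- (1 / t\<^sup>2)) = (-1) * y"
      proof -
        have "(1 - y) * (- (1 / t\<^sup>2)) = t\<^sup>2 / (1 + t\<^sup>2) * (- (1 / t\<^sup>2))" by (simp only: y(3))
        then show ?thesis using t by (simp add: y_def)
      qed
      then show ?thesis by (metis power_mult_distrib)
    qed
    have "(1 - y) ^ n * (X * (B * A) * (- (1 / t\<^sup>2)) ^ j) = (-1) ^ j * A * y ^ j * (1 - y) ^ (n - j) * (X * B)" for A B X :: real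
    proof -
      have "(1 - y) ^ n * (X * (B * A) * (- (1 / t\<^sup>2)) ^ j) =
          (1 - y) ^ (n - j) * ((1 - y) ^ j * (- (1 / t\<^sup>2)) ^ j) * (X * B * A)"
        unfolding e1 by (simp only: mult_ac)
      then show ?thesis unfolding e2 by (simp only: mult_ac)
    qed
    then show "(1 - y) ^ n * (fact j / pochhammer \<beta> j * (real (m choose j) * real (n choose j)) * (- (1 / t\<^sup>2)) ^ j) =
       (-1) ^ j * real (n choose j) * y ^ j * (1 - y) ^ (n - j) * (fact j / pochhammer (\<alpha> + 1) j * real (m choose j))"
      by (simp only: \<beta>_def)
  qed
  finally show ?thesis by (simp only: \<beta>_def \<tau>_def mult.assoc)
qed

text \<open>The factor 1 + t^2 removes one power from y^(\<alpha> + 1), and the squares of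
  \<open>lag_c\<close> supply the Gamma factors of \<open>jacobi_fun_sq\<close>.\<close>

lemma norm_lag_kernel:
  assumes \<alpha>: "\<alpha> \<ge> 0" and nm: "n \<le> m" and t: "t \<noteq> 0"
  shows "(1 + t\<^sup>2) * (cmod (lag_kernel \<alpha> t n m))\<^sup>2 = jacobi_fun_sq n (real (m - n)) \<alpha> (1 / (1 + t\<^sup>2))"
proof -
  define y where "y = 1 / (1 + t\<^sup>2)"
  have y: "0 < y" "y < 1" unfolding y_def using one_plus_square_bounds[OF t] by auto
  have c: "(lag_c (\<alpha> + 1) k)\<^sup>2 = Gamma (real k + \<alpha> + 1) / Gamma (\<alpha> + 1) / fact k" for k
    using \<alpha> by (simp add: lag_c_square pochhammer_Gamma_pos add_ac)
  have "y powr (\<alpha> + 1) = y powr \<alpha> * y" using y by (simp add: powr_add)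
  then have "(1 + t\<^sup>2) * y powr (\<alpha> + 1) = y powr \<alpha>"
  proof -
    have "(1 + t\<^sup>2) * y = 1" using y(1) by (simp add: y_def)
    then show ?thesis using \<open>y powr (\<alpha> + 1) = y powr \<alpha> * y\<close> by (simp add: mult.left_commute)
  qed
  moreover have "(1 - y) powr real (m - n) = (1 - y) ^ (m - n)" using y by (simp add: powr_realpow)
  moreover have "Gamma (real n + real (m - n) + 1) = fact m" using nm by (simp add: Gamma_fact of_nat_diff add.commute)
  moreover have "real n + real (m - n) + \<alpha> + 1 = real m + \<alpha> + 1" using nm by (simp add: of_nat_diff)
  moreover have "Gamma (\<alpha> + 1) \<noteq> 0" using \<alpha> by (intro Gamma_pos_nonzero) simp
  moreover have "(T :: real) * ((gn / g / fn * (gm / g / fm)) * (Y * Z * (fm * g * B)\<^sup>2)) = fm * gn * gm / fn * ((T * Y) * Z * B\<^sup>2)"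
    if "g \<noteq> 0" "fm \<noteq> 0" "fn \<noteq> 0" for T gn g fn gm fm Y Z B
    using that by (simp add: field_simps power2_eq_square)
  ultimately show ?thesis
    unfolding lag_kernel_def norm_mult norm_of_real power_mult_distrib norm_lag_Q[OF assms] jacobi_fun_sq_def y_def[symmetric]
    by (simp add: power_mult_distrib c abs_mult)
qed

lemma norm_lag_kernel_le:
  assumes \<alpha>: "\<alpha> \<ge> 0" and t: "t \<noteq> 0"
  shows "cmod (lag_kernel \<alpha> t n m) \<le> 1 / sqrt (1 + t\<^sup>2)"
proof -
  have *: "cmod (lag_kernel \<alpha> t n m) \<le> 1 / sqrt (1 + t\<^sup>2)" if nm: "n \<le> m" for n m
  proof -
    have p: "1 + t\<^sup>2 > 0" by (simp add: add_pos_nonneg)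
    have "(1 + t\<^sup>2) * (cmod (lag_kernel \<alpha> t n m))\<^sup>2 \<le> 1"
      unfolding norm_lag_kernel[OF \<alpha> nm t] using one_plus_square_bounds[OF t] \<alpha>
      by (intro jacobi_fun_sq_le_1) auto
    then have "(cmod (lag_kernel \<alpha> t n m))\<^sup>2 \<le> 1 / (1 + t\<^sup>2)" using p by (simp add: field_simps)
    then have "sqrt ((cmod (lag_kernel \<alpha> t n m))\<^sup>2) \<le> sqrt (1 / (1 + t\<^sup>2))" by (rule real_sqrt_le_mono)
    then show ?thesis by (simp add: real_sqrt_divide)
  qed
  show ?thesis using *[of n m] *[of m n] lag_kernel_commute[of \<alpha> t n m] by (cases "n \<le> m") auto
qed

section \<open>Confluent limit from Jacobi to Laguerre functions\<close>

lemma gbinomial_laguerre: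
  assumes "\<alpha> \<ge> 0" "i \<le> k"
  shows "(real k + \<alpha>) gchoose (k - i) = Gamma (real k + \<alpha> + 1) / (fact (k - i) * Gamma (real i + \<alpha> + 1))"
proof -
  have "real k + \<alpha> + 1 \<notin> \<int>\<^sub>\<le>\<^sub>0" using assms by (auto elim!: nonpos_Ints_cases)
  then have "(real k + \<alpha>) gchoose (k - i) = Gamma (real k + \<alpha> + 1) / (fact (k - i) * Gamma (real k + \<alpha> - real (k - i) + 1))"
    by (rule gbinomial_Gamma)
  also have "real k + \<alpha> - real (k - i) + 1 = real i + \<alpha> + 1" using assms by (simp add: of_nat_diff)
  finally show ?thesis .
qed

text \<open>The sum is 1F1(-k; \<alpha> + 1; u), the confluent counterpart of the sum defining
  \<open>jacobi_poly\<close>.\<close>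

lemma laguerre_poly_eq:
  assumes "\<alpha> \<ge> 0"
  shows "laguerre_poly k \<alpha> u = Gamma (real k + \<alpha> + 1) / (fact k * Gamma (\<alpha> + 1)) *
    (\<Sum>i\<le>k. (-1) ^ i * real (k choose i) / pochhammer (\<alpha> + 1) i * u ^ i)"
  unfolding laguerre_poly_def sum_distrib_left
proof (intro sum.cong refl)
  fix i assume "i \<in> {..k}"
  then have i: "i \<le> k" by simp
  have p: "pochhammer (\<alpha> + 1) i = Gamma (real i + \<alpha> + 1) / Gamma (\<alpha> + 1)"
    using assms by (subst pochhammer_Gamma_pos) (auto simp: add_ac)
  have b: "real (k choose i) = fact k / (fact i * fact (k - i))" using i by (intro binomial_fact)
  have "s * (g / (d * h)) * U / fi = g / (fk * G) * (s * (fk / (fi * d)) / (h / G) * U)"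
    if "fk \<noteq> 0" "G \<noteq> 0" for s g d h U fi fk G :: real
    using that by (simp add: mult_ac)
  from this[OF fact_nonzero[of k] Gamma_pos_nonzero[of "\<alpha> + 1"]] assms
  show "(-1) ^ i * (real k + \<alpha> gchoose (k - i)) * u ^ i / fact i =
    Gamma (real k + \<alpha> + 1) / (fact k * Gamma (\<alpha> + 1)) * ((-1) ^ i * real (k choose i) / pochhammer (\<alpha> + 1) i * u ^ i)"
    unfolding gbinomial_laguerre[OF assms i] p b by simp
qed

lemma rpow_half_square: "u \<ge> 0 \<Longrightarrow> (rpow u (\<alpha> / 2))\<^sup>2 = rpow u \<alpha>"
  by (simp add: rpow_def power2_eq_square powr_add[symmetric])

lemma laguerre_fun_square:
  assumes "\<alpha> \<ge> 0" "u \<ge> 0"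
  shows "(laguerre_fun k \<alpha> u)\<^sup>2 = Gamma (real k + \<alpha> + 1) / (fact k * (Gamma (\<alpha> + 1))\<^sup>2) *
    (rpow u \<alpha> * exp (- u) * (\<Sum>i\<le>k. (-1) ^ i * real (k choose i) / pochhammer (\<alpha> + 1) i * u ^ i)\<^sup>2)"
proof -
  have g: "Gamma (real k + \<alpha> + 1) > 0" using assms by (intro Gamma_real_pos) simp
  have e: "(exp (- u / 2))\<^sup>2 = exp (- u)" by (simp add: power2_eq_square exp_add[symmetric])
  have q: "(sqrt (fact k / Gamma (real k + \<alpha> + 1)))\<^sup>2 = fact k / Gamma (real k + \<alpha> + 1)"
    using g by simp
  have alg: "f / g * r * e * ((g / (f * G))\<^sup>2 * S) = g / (f * G\<^sup>2) * (r * e * S)" if "f \<noteq> 0" "g \<noteq> 0" for f g r e G S :: real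
    using that by (simp add: power2_eq_square mult_ac)
  show ?thesis
    unfolding laguerre_fun_def laguerre_poly_eq[OF assms(1)] power_mult_distrib rpow_half_square[OF assms(2)] e q
    by (rule alg) (use g in auto)
qed

text \<open>\<open>Gamma_series \<beta> n\<close> = n! n^\<beta> / (\<beta>)_(n + 1) tends to
  Gamma(\<beta>). The factor n / (n + \<beta>) removes the last factor of the Pochhammer symbol and
  one power of n.\<close>

lemma Gamma_ratio_tendsto:
  fixes \<alpha> :: real
  assumes "\<alpha> \<ge> 0"
  shows "(\<lambda>n. Gamma (real n + \<alpha> + 1) / (fact n * real n powr \<alpha>)) \<longlonglongrightarrow> 1"
proof -
  define \<beta> where "\<beta> = \<alpha> + 1"
  have \<beta>: "\<beta> > 0" using assms by (simp add: \<beta>_def)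
  have "(\<lambda>n. Gamma \<beta> / Gamma_series \<beta> n * (real n / (real n + \<beta>))) \<longlonglongrightarrow> Gamma \<beta> / Gamma \<beta> * 1"
  proof (intro tendsto_intros)
    show "(\<lambda>n. real n / (real n + \<beta>)) \<longlonglongrightarrow> 1"
    proof (rule Lim_transform_eventually)
      have "(\<lambda>n. 1 / (1 + \<beta> / real n)) \<longlonglongrightarrow> 1 / (1 + 0)"
        by (intro tendsto_intros lim_const_over_n) auto
      then show "(\<lambda>n. 1 / (1 + \<beta> / real n)) \<longlonglongrightarrow> 1" by simp
      show "\<forall>\<^sub>F n in sequentially. 1 / (1 + \<beta> / real n) = real n / (real n + \<beta>)"
        using eventually_gt_at_top[of 0] by eventually_elim (use \<beta> in \<open>simp add: field_simps\<close>)
    qed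
  qed (use Gamma_pos_nonzero[OF \<beta>] in auto)
  then have "(\<lambda>n. Gamma \<beta> / Gamma_series \<beta> n * (real n / (real n + \<beta>))) \<longlonglongrightarrow> 1"
    using Gamma_pos_nonzero[OF \<beta>] by simp
  then show ?thesis
  proof (rule Lim_transform_eventually)
    show "\<forall>\<^sub>F n in sequentially. Gamma \<beta> / Gamma_series \<beta> n * (real n / (real n + \<beta>)) = Gamma (real n + \<alpha> + 1) / (fact n * real n powr \<alpha>)"
      using eventually_gt_at_top[of 0]
    proof eventually_elim
      case (elim n)
      have pos: "real n + \<beta> > 0" using \<beta> by simp
      have "Gamma (\<beta> + real (Suc n)) = (real n + \<beta>) * Gamma (real n + \<beta>)"
        using Gamma_plus1_pos[OF pos] by (simp add: add_ac)
      then have "pochhammer \<beta> (n + 1) = (real n + \<beta>) * Gamma (real n + \<beta>) / Gamma \<beta>"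
        using \<beta> by (simp add: pochhammer_Gamma_pos)
      moreover have "exp (\<beta> * ln (real n)) = real n * real n powr \<alpha>"
        using elim by (simp add: \<beta>_def powr_def exp_add distrib_right)
      ultimately have "Gamma_series \<beta> n = fact n * (real n * real n powr \<alpha>) / ((real n + \<beta>) * Gamma (real n + \<beta>) / Gamma \<beta>)"
        unfolding Gamma_series_def by (simp only: of_real_eq_id id_apply)
      moreover have "g / (f * (N * p) / (x * h / g)) * (N / x) = h / (f * p)" if "g \<noteq> 0" "N \<noteq> 0" "x \<noteq> 0" for g f N p x h :: real
        using that by simp
      ultimately show ?case
        using Gamma_pos_nonzero[OF \<beta>] elim pos by (simp add: \<beta>_def add_ac)
    qed
  qed
qed

text \<open>Each single factor (x + i) y tends to u.\<close>

lemma pochhammer_scaled_tendsto: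
  fixes x y :: "'a \<Rightarrow> real"
  assumes "((\<lambda>t. x t * y t) \<longlongrightarrow> u) F" "(y \<longlongrightarrow> 0) F"
  shows "((\<lambda>t. pochhammer (x t) i * y t ^ i) \<longlongrightarrow> u ^ i) F"
proof (induction i)
  case (Suc i)
  have "((\<lambda>t. (pochhammer (x t) i * y t ^ i) * (x t * y t + real i * y t)) \<longlongrightarrow> u ^ i * (u + real i * 0)) F"
    by (intro tendsto_intros Suc.IH assms)
  then show ?case by (simp add: pochhammer_Suc algebra_simps)
qed simp

text \<open>At u = 0 with \<alpha> > 0 the index m need not tend to infinity and the Gamma
  asymptotics may fail, hence the second condition on u.\<close>

lemma jacobi_fun_sq_tendsto:
  fixes y :: "'a \<Rightarrow> real" and m :: "'a \<Rightarrow> nat"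
  assumes \<alpha>: "\<alpha> \<ge> 0" and u: "u \<ge> 0" "u > 0 \<or> \<alpha> = 0"
    and y: "(y \<longlongrightarrow> 0) F" "\<forall>\<^sub>F t in F. 0 < y t \<and> y t < 1"
    and my: "((\<lambda>t. real (m t) * y t) \<longlongrightarrow> u) F" and mk: "\<And>t. k \<le> m t"
  shows "((\<lambda>t. jacobi_fun_sq k (real (m t - k)) \<alpha> (y t)) \<longlongrightarrow> (laguerre_fun k \<alpha> u)\<^sup>2) F"
proof -
  have P: "((\<lambda>t. Gamma (real (m t) + \<alpha> + 1) / fact (m t) * y t powr \<alpha>) \<longlongrightarrow> rpow u \<alpha>) F"
  proof (cases "\<alpha> = 0")
    \<comment> \<open>Here the Gamma ratio is exactly 1, so m may stay bounded.\<close>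
    case True
    have "\<forall>\<^sub>F t in F. 1 = Gamma (real (m t) + \<alpha> + 1) / fact (m t) * y t powr \<alpha>"
      using y(2) by eventually_elim (simp add: True Gamma_fact add.commute)
    then show ?thesis using True by (auto simp: rpow_def intro: Lim_transform_eventually[OF tendsto_const])
  next
    case False
    then have u0: "u > 0" using u by simp
    have "filterlim (\<lambda>t. inverse (y t)) at_top F"
      using y by (intro filterlim_inverse_at_top) (auto elim: eventually_mono)
    then have "filterlim (\<lambda>t. real (m t) * y t * inverse (y t)) at_top F"
      by (rule filterlim_tendsto_pos_mult_at_top[OF my u0])
    moreover have "\<forall>\<^sub>F t in F. real (m t) * y t * inverse (y t) = real (m t)"
      using y(2) by eventually_elim simp
    ultimately have mr: "filterlim (\<lambda>t. real (m t)) at_top F" by (simp cong: filterlim_cong)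
    then have m: "filterlim m sequentially F" by (simp add: filterlim_sequentially_iff_filterlim_real)
    have "((\<lambda>t. Gamma (real (m t) + \<alpha> + 1) / (fact (m t) * real (m t) powr \<alpha>) * (real (m t) * y t) powr \<alpha>) \<longlongrightarrow> 1 * u powr \<alpha>) F"
      using u0 by (intro tendsto_mult filterlim_compose[OF Gamma_ratio_tendsto[OF \<alpha>] m] tendsto_powr my tendsto_const) auto
    moreover have "\<forall>\<^sub>F t in F. Gamma (real (m t) + \<alpha> + 1) / (fact (m t) * real (m t) powr \<alpha>) * (real (m t) * y t) powr \<alpha> =
        Gamma (real (m t) + \<alpha> + 1) / fact (m t) * y t powr \<alpha>"
      using y(2) filterlim_at_top_dense[THEN iffD1, OF mr, rule_format, of 0]
      by eventually_elim (simp add: powr_mult)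
    ultimately show ?thesis using False by (simp add: rpow_def Lim_transform_eventually)
  qed
  have E: "((\<lambda>t. (1 - y t) powr real (m t - k)) \<longlongrightarrow> exp (- u)) F"
  proof -
    \<comment> \<open>The power is the exponential of (m y - k y) ln(1 - y) / y, and the last
      quotient tends to the derivative -1 of ln(1 - x) at 0.\<close>
    have "((\<lambda>x :: real. ln (1 - x)) has_real_derivative -1) (at 0)"
      by (auto intro!: derivative_eq_intros)
    then have "((\<lambda>x :: real. ln (1 - x) / x) \<longlongrightarrow> -1) (at 0)" by (simp add: DERIV_def)
    moreover have "filterlim y (at 0) F"
      unfolding filterlim_at using y by (auto elim: eventually_mono)
    ultimately have "((\<lambda>t. ln (1 - y t) / y t) \<longlongrightarrow> -1) F" by (rule filterlim_compose)
    then have "((\<lambda>t. exp ((real (m t) * y t - real k * y t) * (ln (1 - y t) / y t))) \<longlongrightarrow> exp ((u - real k * 0) * -1)) F"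
      by (intro tendsto_intros my y)
    moreover have "\<forall>\<^sub>F t in F. exp ((real (m t) * y t - real k * y t) * (ln (1 - y t) / y t)) = (1 - y t) powr real (m t - k)"
      using y(2) by eventually_elim (simp add: powr_def of_nat_diff mk left_diff_distrib[symmetric])
    ultimately show ?thesis by (simp add: Lim_transform_eventually)
  qed
  have S: "((\<lambda>t. poly (jacobi_poly k (real (m t - k)) \<alpha>) (y t)) \<longlongrightarrow>
      (\<Sum>i\<le>k. (-1) ^ i * real (k choose i) / pochhammer (\<alpha> + 1) i * u ^ i)) F"
  proof -
    have "((\<lambda>t. (real (m t) + \<alpha> + 1) * y t) \<longlongrightarrow> u) F"
      using tendsto_add[OF my tendsto_mult[OF tendsto_const[of "\<alpha> + 1"] y(1)]] by (simp add: algebra_simps)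
    then have "((\<lambda>t. \<Sum>i\<le>k. (-1) ^ i * real (k choose i) / pochhammer (\<alpha> + 1) i * (pochhammer (real (m t) + \<alpha> + 1) i * y t ^ i)) \<longlongrightarrow>
       (\<Sum>i\<le>k. (-1) ^ i * real (k choose i) / pochhammer (\<alpha> + 1) i * u ^ i)) F"
      by (intro tendsto_sum tendsto_mult tendsto_const pochhammer_scaled_tendsto y(1))
    then show ?thesis by (simp add: poly_jacobi_poly of_nat_diff mk mult.assoc)
  qed
  have "((\<lambda>t. Gamma (real k + \<alpha> + 1) / (fact k * (Gamma (\<alpha> + 1))\<^sup>2) *
      ((Gamma (real (m t) + \<alpha> + 1) / fact (m t) * y t powr \<alpha>) * (1 - y t) powr real (m t - k) * (poly (jacobi_poly k (real (m t - k)) \<alpha>) (y t))\<^sup>2))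
      \<longlongrightarrow> (laguerre_fun k \<alpha> u)\<^sup>2) F"
    unfolding laguerre_fun_square[OF \<alpha> u(1)] by (intro tendsto_mult tendsto_const P E tendsto_power S)
  moreover have "Gamma (real k + \<alpha> + 1) / (fact k * (Gamma (\<alpha> + 1))\<^sup>2) *
      ((Gamma (real (m t) + \<alpha> + 1) / fact (m t) * y t powr \<alpha>) * (1 - y t) powr real (m t - k) * (poly (jacobi_poly k (real (m t - k)) \<alpha>) (y t))\<^sup>2)
     = jacobi_fun_sq k (real (m t - k)) \<alpha> (y t)" for t
  proof -
    have "Gamma (real k + real (m t - k) + 1) = fact (m t)" "real k + real (m t - k) + \<alpha> + 1 = real (m t) + \<alpha> + 1"
      using mk[of t] by (simp_all add: Gamma_fact of_nat_diff add.commute)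
    then show ?thesis using \<alpha> by (subst jacobi_fun_sq_eq) (simp_all add: mult_ac)
  qed
  ultimately show ?thesis by simp
qed

section \<open>Lower bounds\<close>

lemma falling_ratio_tendsto: "(\<lambda>k. fact k / (fact (k - i) * real k ^ i)) \<longlonglongrightarrow> 1"
proof (induction i)
  case 0
  then show ?case by simp
next
  case (Suc i)
  have "(\<lambda>k. fact k / (fact (k - i) * real k ^ i) * (1 - real i / real k)) \<longlonglongrightarrow> 1 * (1 - 0)"
    by (intro tendsto_intros Suc.IH lim_const_over_n)
  then have "(\<lambda>k. fact k / (fact (k - i) * real k ^ i) * (1 - real i / real k)) \<longlonglongrightarrow> 1" by simp
  then show ?case
  proof (rule Lim_transform_eventually)
    show "\<forall>\<^sub>F k in sequentially. fact k / (fact (k - i) * real k ^ i) * (1 - real i / real k) = fact k / (fact (k - Suc i) * real k ^ Suc i)"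
      using eventually_gt_at_top[of i]
    proof eventually_elim
      case (elim k)
      then have "k - i = Suc (k - Suc i)" by simp
      then have "(fact (k - i) :: real) = (real k - real i) * fact (k - Suc i)"
        using elim by (metis fact_Suc of_nat_diff less_imp_le)
      moreover have "real k - real i > 0" using elim by simp
      moreover have "f / (d * g * p) * (1 - i / k) = f / (g * (k * p))" if "d = k - i" "d > 0" "k > 0" for f d g p i k :: real
      proof -
        have "1 - i / k = d / k" using that by (simp add: field_simps)
        then show ?thesis using that by simp
      qed
      ultimately show ?case using elim by simp
    qed
  qed
qed

lemma falling_ratio_bounds:
  "0 \<le> fact k / (fact (k - i) * real k ^ i)" "i \<le> k \<Longrightarrow> fact k / (fact (k - i) * real k ^ i) \<le> 1"
proof -
  show "0 \<le> fact k / (fact (k - i) * real k ^ i)" by simp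
  assume i: "i \<le> k"
  have "fact k = (fact k div fact (k - i)) * (fact (k - i) :: nat)" by (simp add: fact_dvd)
  also have "\<dots> \<le> k ^ i * fact (k - i)" by (intro mult_right_mono fact_div_fact_le_pow i) simp
  finally have "fact k \<le> real k ^ i * fact (k - i)" by (metis of_nat_fact of_nat_le_iff of_nat_mult of_nat_power)
  then show "fact k / (fact (k - i) * real k ^ i) \<le> 1"
    by (cases "fact (k - i) * real k ^ i = 0") (simp_all add: divide_le_eq mult.commute)
qed

text \<open>The summands are those of the Bessel series times a ratio that tends to 1 in k; padding
  with zeros makes an infinite series, ready for a termwise limit.\<close>

lemma laguerre_fun_scaled:
  assumes \<alpha>: "\<alpha> \<ge> 0" and z: "z \<ge> 0" and k: "k > 0"
  shows "laguerre_fun k \<alpha> ((z / 2)\<^sup>2 / real k) =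
    sqrt (Gamma (real k + \<alpha> + 1) / (fact k * real k powr \<alpha>)) * rpow (z / 2) \<alpha> * exp (- ((z / 2)\<^sup>2 / real k) / 2) *
    (\<Sum>i. if i \<le> k then (-1) ^ i / (fact i * Gamma (real i + \<alpha> + 1)) * (z / 2) ^ (2 * i) * (fact k / (fact (k - i) * real k ^ i)) else 0)"
proof -
  define x where "x = z / 2"
  have x: "x \<ge> 0" using z by (simp add: x_def)
  let ?u = "x\<^sup>2 / real k"
  let ?g = "Gamma (real k + \<alpha> + 1)"
  have g: "?g > 0" using \<alpha> by (intro Gamma_real_pos) simp
  have r: "rpow ?u (\<alpha> / 2) = rpow x \<alpha> / sqrt (real k powr \<alpha>)"
  proof (cases "\<alpha> = 0")
    case False
    have "?u powr (\<alpha> / 2) = (x\<^sup>2) powr (\<alpha> / 2) / real k powr (\<alpha> / 2)"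
      by (simp add: powr_divide)
    also have "(x\<^sup>2) powr (\<alpha> / 2) = x powr \<alpha>"
      using x by (simp add: power2_eq_square powr_mult powr_add[symmetric])
    also have "real k powr (\<alpha> / 2) = sqrt (real k powr \<alpha>)" by (simp add: powr_half_sqrt[symmetric] powr_powr)
    finally show ?thesis using False by (simp add: rpow_def)
  qed (use k in \<open>simp add: rpow_def\<close>)
  have "(\<Sum>i. if i \<le> k then (-1) ^ i / (fact i * Gamma (real i + \<alpha> + 1)) * x ^ (2 * i) * (fact k / (fact (k - i) * real k ^ i)) else 0)
     = (\<Sum>i\<le>k. (-1) ^ i / (fact i * Gamma (real i + \<alpha> + 1)) * x ^ (2 * i) * (fact k / (fact (k - i) * real k ^ i)))"
    using sums_If_finite_set[of "{..k}" "\<lambda>i. (-1) ^ i / (fact i * Gamma (real i + \<alpha> + 1)) * x ^ (2 * i) * (fact k / (fact (k - i) * real k ^ i))"]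
    by (simp add: sums_iff)
  also have "\<dots> = fact k / ?g * laguerre_poly k \<alpha> ?u"
    unfolding laguerre_poly_def sum_distrib_left
  proof (intro sum.cong refl)
    fix i assume "i \<in> {..k}"
    then have i: "i \<le> k" by simp
    have "s / (fi * h) * X * (fk / (d * K)) = fk / g * (s * (g / (d * h)) * (X / K) / fi)" if "g > 0" for s fi h X fk d K g :: real
      using that by (simp add: mult_ac)
    from this[OF g] show "(-1) ^ i / (fact i * Gamma (real i + \<alpha> + 1)) * x ^ (2 * i) * (fact k / (fact (k - i) * real k ^ i)) =
      fact k / ?g * ((-1) ^ i * (real k + \<alpha> gchoose (k - i)) * ?u ^ i / fact i)"
      unfolding gbinomial_laguerre[OF \<alpha> i] power_divide power_mult .
  qed
  finally have S: "(\<Sum>i. if i \<le> k then (-1) ^ i / (fact i * Gamma (real i + \<alpha> + 1)) * x ^ (2 * i) * (fact k / (fact (k - i) * real k ^ i)) else 0)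
      = fact k / ?g * laguerre_poly k \<alpha> ?u" .
  have "sqrt (fact k / ?g) = sqrt (?g / fact k) * (fact k / ?g)"
  proof -
    have "sqrt (fact k / ?g) = sqrt (?g / fact k * (fact k / ?g)\<^sup>2)" using g by (simp add: power2_eq_square)
    also have "\<dots> = sqrt (?g / fact k) * sqrt ((fact k / ?g)\<^sup>2)" by (rule real_sqrt_mult)
    also have "sqrt ((fact k / ?g)\<^sup>2) = fact k / ?g"
      unfolding real_sqrt_abs by (rule abs_of_pos) (use g in simp)
    finally show ?thesis .
  qed
  then show ?thesis
    unfolding laguerre_fun_def x_def[symmetric] S r by (simp add: real_sqrt_divide real_sqrt_mult mult_ac)
qed

text \<open>Tannery's theorem with majorant (z/2)^(2 i) / (i! Gamma(\<alpha> + 1)). It dominates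
  because Pochhammer symbols of \<alpha> + 1 \<ge> 1 are at least 1, so Gamma(i + \<alpha> + 1)
  \<ge> Gamma(\<alpha> + 1).\<close>

lemma Mehler_Heine:
  assumes \<alpha>: "\<alpha> \<ge> 0" and z: "z \<ge> 0"
  shows "(\<lambda>k. laguerre_fun k \<alpha> ((z / 2)\<^sup>2 / real k)) \<longlonglongrightarrow> bessel_J \<alpha> z"
proof -
  define x where "x = z / 2"
  define t where "t i = (-1) ^ i / (fact i * Gamma (real i + \<alpha> + 1)) * x ^ (2 * i)" for i
  define a where "a i k = (if i \<le> k then t i * (fact k / (fact (k - i) * real k ^ i)) else 0)" for i k
  define M where "M i = (x\<^sup>2) ^ i / fact i / Gamma (\<alpha> + 1)" for i
  have t_le: "\<bar>t i\<bar> \<le> M i" for i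
  proof -
    have p: "pochhammer (\<alpha> + 1) i \<ge> 1"
    proof (induction i)
      case (Suc i)
      show ?case unfolding pochhammer_Suc using mult_mono[OF Suc.IH, of 1 "\<alpha> + 1 + real i"] \<alpha> Suc.IH by simp
    qed simp
    have G: "Gamma (\<alpha> + 1) > 0" using \<alpha> by (intro Gamma_real_pos) simp
    have "Gamma (real i + \<alpha> + 1) = pochhammer (\<alpha> + 1) i * Gamma (\<alpha> + 1)"
      using \<alpha> Gamma_pos_nonzero[of "\<alpha> + 1"] by (subst pochhammer_Gamma_pos) (simp_all add: add_ac)
    then have "Gamma (real i + \<alpha> + 1) \<ge> Gamma (\<alpha> + 1)" using mult_right_mono[OF p, of "Gamma (\<alpha> + 1)"] G by simp
    then have "1 / Gamma (real i + \<alpha> + 1) \<le> 1 / Gamma (\<alpha> + 1)" using G by (intro divide_left_mono mult_pos_pos) auto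
    then have "(x\<^sup>2) ^ i / fact i * (1 / Gamma (real i + \<alpha> + 1)) \<le> (x\<^sup>2) ^ i / fact i * (1 / Gamma (\<alpha> + 1))"
      by (intro mult_left_mono) auto
    moreover have "\<bar>t i\<bar> = (x\<^sup>2) ^ i / fact i * (1 / Gamma (real i + \<alpha> + 1))"
      using \<alpha> by (simp add: t_def abs_mult power_abs power_mult abs_of_pos Gamma_real_pos)
    ultimately show ?thesis by (simp add: M_def)
  qed
  have "(\<lambda>k. suminf (\<lambda>i. a i k)) \<longlonglongrightarrow> suminf t"
  proof (rule tannerys_theorem[THEN conjunct2, THEN conjunct2])
    fix i
    have "(\<lambda>k. t i * (fact k / (fact (k - i) * real k ^ i))) \<longlonglongrightarrow> t i * 1"
      by (intro tendsto_intros falling_ratio_tendsto)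
    then have "(\<lambda>k. t i * (fact k / (fact (k - i) * real k ^ i))) \<longlonglongrightarrow> t i" by simp
    then show "(\<lambda>k. a i k) \<longlonglongrightarrow> t i"
      by (rule Lim_transform_eventually) (use eventually_ge_at_top[of i] in eventually_elim, simp add: a_def)
  next
    have "norm (a i k) \<le> M i" for i k
    proof (cases "i \<le> k")
      case True
      have "\<bar>t i\<bar> * \<bar>fact k / (fact (k - i) * real k ^ i)\<bar> \<le> M i * 1"
      proof (rule mult_mono)
        show "\<bar>fact k / (fact (k - i) * real k ^ i)\<bar> \<le> 1"
          unfolding abs_of_nonneg[OF falling_ratio_bounds(1)] by (rule falling_ratio_bounds(2)[OF True])
      qed (use t_le[of i] order_trans[OF abs_ge_zero t_le[of i]] in simp_all)
      then show ?thesis using True by (simp only: a_def if_True real_norm_def abs_mult mult_1_right)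
    next
      case False
      then show ?thesis using order_trans[OF abs_ge_zero t_le[of i]] by (simp add: a_def)
    qed
    then show "\<forall>\<^sub>F (i, k) in at_top \<times>\<^sub>F sequentially. norm (a i k) \<le> M i" by (intro always_eventually) auto
    show "summable M" unfolding M_def using summable_exp[of "x\<^sup>2"] by (intro summable_divide) (simp add: field_simps)
  qed simp
  moreover have "(\<lambda>k. exp (- (x\<^sup>2 / real k) / 2)) \<longlonglongrightarrow> exp (- 0 / 2)"
    by (intro tendsto_intros lim_const_over_n) auto
  moreover have "(\<lambda>k. sqrt (Gamma (real k + \<alpha> + 1) / (fact k * real k powr \<alpha>))) \<longlonglongrightarrow> sqrt 1"
    by (intro tendsto_intros Gamma_ratio_tendsto \<alpha>)
  ultimately have lim: "(\<lambda>k. sqrt (Gamma (real k + \<alpha> + 1) / (fact k * real k powr \<alpha>)) * rpow x \<alpha> * exp (- (x\<^sup>2 / real k) / 2) * suminf (\<lambda>i. a i k))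
     \<longlonglongrightarrow> sqrt 1 * rpow x \<alpha> * exp (- 0 / 2) * suminf t"
    by (intro tendsto_mult tendsto_const)
  then have "(\<lambda>k. sqrt (Gamma (real k + \<alpha> + 1) / (fact k * real k powr \<alpha>)) * rpow x \<alpha> * exp (- (x\<^sup>2 / real k) / 2) * suminf (\<lambda>i. a i k))
     \<longlonglongrightarrow> bessel_J \<alpha> z"
  proof -
    have "bessel_J \<alpha> z = sqrt 1 * rpow x \<alpha> * exp (- 0 / 2) * suminf t"
      by (simp add: bessel_J_def t_def[abs_def] x_def)
    then show ?thesis using lim by (simp only:)
  qed
  then show ?thesis
  proof (rule Lim_transform_eventually)
    show "\<forall>\<^sub>F k in sequentially. sqrt (Gamma (real k + \<alpha> + 1) / (fact k * real k powr \<alpha>)) * rpow x \<alpha> * exp (- (x\<^sup>2 / real k) / 2) * suminf (\<lambda>i. a i k) =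
       laguerre_fun k \<alpha> ((z / 2)\<^sup>2 / real k)"
      using eventually_gt_at_top[of 0]
      by eventually_elim (simp only: laguerre_fun_scaled[OF \<alpha> z] a_def t_def x_def)
  qed
qed

lemma abs_laguerre_fun_le_Lambda: "u \<ge> 0 \<Longrightarrow> ereal \<bar>laguerre_fun k \<alpha> u\<bar> \<le> Lambda_const \<alpha>"
  unfolding Lambda_const_def by (rule SUP_upper2[of "(k, u)"]) auto

lemma M_le_Lambda:
  assumes "\<alpha> \<ge> 0"
  shows "M_const \<alpha> \<le> Lambda_const \<alpha>"
  unfolding M_const_def
proof (rule SUP_least)
  fix z :: real assume "z \<in> {0..}"
  then have "(\<lambda>k. ereal \<bar>laguerre_fun k \<alpha> ((z / 2)\<^sup>2 / real k)\<bar>) \<longlonglongrightarrow> ereal \<bar>bessel_J \<alpha> z\<bar>"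
    using assms by (intro tendsto_intros Mehler_Heine) auto
  \<comment> \<open>For k = 0 the division by zero gives the argument 0, which is still an
    admissible point of the supremum.\<close>
  then show "ereal \<bar>bessel_J \<alpha> z\<bar> \<le> Lambda_const \<alpha>"
    by (rule LIMSEQ_le_const2) (auto intro!: abs_laguerre_fun_le_Lambda)
qed

lemma A_const_pos: "\<alpha> \<ge> 0 \<Longrightarrow> 0 < A_const \<alpha>"
  using Gamma_real_pos[of "\<alpha> + 1"] by (auto simp: A_const_def)

lemma A_le_Lambda:
  assumes "\<alpha> \<ge> 0"
  shows "ereal (A_const \<alpha>) \<le> Lambda_const \<alpha>"
proof -
  \<comment> \<open>For k = 0 the function is a multiple of u^(\<alpha>/2) exp(-u/2), which is
    largest at u = \<alpha>.\<close>
  have "laguerre_fun 0 \<alpha> \<alpha> = A_const \<alpha>"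
  proof (cases "\<alpha> = 0")
    case False
    have "sqrt (exp (- \<alpha>)) = exp (- \<alpha> / 2)"
      by (rule real_sqrt_unique) (simp_all add: power2_eq_square exp_add[symmetric])
    moreover have "sqrt (\<alpha> powr \<alpha>) = \<alpha> powr (\<alpha> / 2)" by (simp add: powr_half_sqrt[symmetric] powr_powr)
    ultimately show ?thesis using False
      by (simp add: laguerre_fun_def laguerre_poly_def A_const_def rpow_def real_sqrt_mult real_sqrt_divide)
  qed (simp add: laguerre_fun_def laguerre_poly_def A_const_def rpow_def)
  then show ?thesis using abs_laguerre_fun_le_Lambda[OF assms, of 0 \<alpha>] A_const_pos[OF assms] by simp
qed

section \<open>Long-time limits and optimality of the exponent\<close>

lemma inverse_one_plus_square_tendsto: "((\<lambda>t :: real. 1 / (1 + t\<^sup>2)) \<longlongrightarrow> 0) at_infinity"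
proof -
  have "filterlim (\<lambda>t :: real. 1 + norm t ^ 2) at_top at_infinity"
    by (intro filterlim_tendsto_add_at_top[OF tendsto_const] filterlim_pow_at_top filterlim_norm_at_top) auto
  then have "((\<lambda>t :: real. inverse (1 + norm t ^ 2)) \<longlongrightarrow> 0) at_infinity"
    by (rule filterlim_compose[OF tendsto_inverse_0_at_top[OF filterlim_ident]])
  then show ?thesis by (simp add: divide_inverse)
qed

lemma eventually_nonzero_at_infinity: "\<forall>\<^sub>F t :: real in at_infinity. t \<noteq> 0"
  unfolding eventually_at_infinity by (intro exI[of _ 1]) auto

text \<open>The kernel scales with sqrt(1 + t^2), the theorem with |t|. Their ratio is at most 1 and
  tends to 1, so neither bound loses anything.\<close>

lemma abs_over_sqrt: "\<bar>t\<bar> / sqrt (1 + t\<^sup>2) = sqrt (1 - 1 / (1 + t\<^sup>2))" for t :: real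
proof -
  have "1 + t\<^sup>2 > 0" by (simp add: add_pos_nonneg)
  then have "1 - 1 / (1 + t\<^sup>2) = t\<^sup>2 / (1 + t\<^sup>2)" by (simp add: field_simps)
  then show ?thesis by (simp add: real_sqrt_divide)
qed

context laguerre
begin

abbreviation "prop_norm t \<equiv> opnorm_1_inf (laguerre_propagator \<alpha> t)"
abbreviation "scaled_norm t \<equiv> ereal \<bar>t\<bar> * prop_norm t"

lemma opnorm_nonneg: "0 \<le> prop_norm t"
  by (rule order_trans[OF _ opnorm_ge[of t 0 0]]) simp

lemma scaled_opnorm_le_1: "t \<noteq> 0 \<Longrightarrow> scaled_norm t \<le> 1"
proof -
  assume t: "t \<noteq> 0"
  have "scaled_norm t \<le> ereal \<bar>t\<bar> * ereal (1 / sqrt (1 + t\<^sup>2))"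
    by (intro ereal_mult_left_mono opnorm_le norm_lag_kernel_le \<alpha> t) simp
  also have "\<dots> = ereal (sqrt (1 - 1 / (1 + t\<^sup>2)))" using abs_over_sqrt[of t] by simp
  also have "\<dots> \<le> 1" by (simp add: add_pos_nonneg)
  finally show ?thesis .
qed

lemma laguerre_fun_le_Liminf_regular:
  assumes u: "u \<ge> 0" "u > 0 \<or> \<alpha> = 0"
  shows "ereal \<bar>laguerre_fun k \<alpha> u\<bar> \<le>
    Liminf at_infinity scaled_norm"
proof -
  define y where "y t = 1 / (1 + t\<^sup>2)" for t :: real
  \<comment> \<open>The floor makes m y tend to u. Adding k ensures k \<le> m for every t and
    changes m y only by k y, which tends to 0.\<close>
  define m where "m t = nat \<lfloor>u * (1 + t\<^sup>2)\<rfloor> + k" for t :: real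
  have y0: "(y \<longlongrightarrow> 0) at_infinity"
    unfolding y_def by (rule inverse_one_plus_square_tendsto)
  have yb: "0 < y t" "u * (1 + t\<^sup>2) * y t = u" for t by (simp_all add: y_def add_pos_nonneg) (simp add: add_nonneg_eq_0_iff)
  have "((\<lambda>t. real (m t) * y t) \<longlongrightarrow> u) at_infinity"
  proof (rule real_tendsto_sandwich)
    have mb: "u * (1 + t\<^sup>2) - 1 \<le> real (m t)" "real (m t) \<le> u * (1 + t\<^sup>2) + real k" for t
    proof -
      have "u * (1 + t\<^sup>2) \<ge> 0" using u(1) by simp
      then have "real (m t) = of_int \<lfloor>u * (1 + t\<^sup>2)\<rfloor> + real k" by (simp add: m_def)
      then show "u * (1 + t\<^sup>2) - 1 \<le> real (m t)" "real (m t) \<le> u * (1 + t\<^sup>2) + real k"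
        using floor_correct[of "u * (1 + t\<^sup>2)"] by linarith+
    qed
    have "u - y t \<le> real (m t) * y t" for t
      using mult_right_mono[OF mb(1)[of t] less_imp_le[OF yb(1)[of t]]] yb(2)[of t] by (simp only: left_diff_distrib mult_1_left)
    then show "\<forall>\<^sub>F t in at_infinity. u - y t \<le> real (m t) * y t" by (intro always_eventually) simp
    have "real (m t) * y t \<le> u + real k * y t" for t
      using mult_right_mono[OF mb(2)[of t] less_imp_le[OF yb(1)[of t]]] yb(2)[of t] by (simp only: distrib_right)
    then show "\<forall>\<^sub>F t in at_infinity. real (m t) * y t \<le> u + real k * y t" by (intro always_eventually) simp
    show "((\<lambda>t. u - y t) \<longlongrightarrow> u) at_infinity" using tendsto_diff[OF tendsto_const y0, of u] by simp
    show "((\<lambda>t. u + real k * y t) \<longlongrightarrow> u) at_infinity"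
      using tendsto_add[OF tendsto_const tendsto_mult[OF tendsto_const y0], of u "real k"] by simp
  qed
  moreover have "\<forall>\<^sub>F t in at_infinity. 0 < y t \<and> y t < 1"
    using eventually_nonzero_at_infinity by eventually_elim (use one_plus_square_bounds in \<open>simp add: y_def\<close>)
  ultimately have "((\<lambda>t. jacobi_fun_sq k (real (m t - k)) \<alpha> (y t)) \<longlongrightarrow> (laguerre_fun k \<alpha> u)\<^sup>2) at_infinity"
    by (intro jacobi_fun_sq_tendsto \<alpha> u y0) (auto simp: m_def)
  then have "((\<lambda>t. ereal (sqrt (1 - y t) * sqrt (jacobi_fun_sq k (real (m t - k)) \<alpha> (y t)))) \<longlongrightarrow>
      ereal (sqrt (1 - 0) * sqrt ((laguerre_fun k \<alpha> u)\<^sup>2))) at_infinity"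
    by (intro tendsto_intros y0)
  then have "Liminf at_infinity (\<lambda>t. ereal (sqrt (1 - y t) * sqrt (jacobi_fun_sq k (real (m t - k)) \<alpha> (y t)))) =
      ereal \<bar>laguerre_fun k \<alpha> u\<bar>"
    by (intro lim_imp_Liminf) (simp_all add: trivial_limit_at_infinity)
  moreover have "Liminf at_infinity (\<lambda>t. ereal (sqrt (1 - y t) * sqrt (jacobi_fun_sq k (real (m t - k)) \<alpha> (y t)))) \<le>
    Liminf at_infinity scaled_norm"
  proof (rule Liminf_mono)
    show "\<forall>\<^sub>F t in at_infinity. ereal (sqrt (1 - y t) * sqrt (jacobi_fun_sq k (real (m t - k)) \<alpha> (y t))) \<le>
        scaled_norm t"
      using eventually_nonzero_at_infinity
    proof eventually_elim
      case (elim t)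
      have km: "k \<le> m t" by (simp add: m_def)
      have "sqrt (1 - y t) * sqrt (jacobi_fun_sq k (real (m t - k)) \<alpha> (y t)) =
          \<bar>t\<bar> / sqrt (1 + t\<^sup>2) * (sqrt (1 + t\<^sup>2) * cmod (G t k (m t)))"
        unfolding y_def abs_over_sqrt norm_lag_kernel[OF \<alpha> km elim, symmetric] by (simp add: real_sqrt_mult)
      also have "\<dots> = \<bar>t\<bar> * cmod (G t k (m t))"
      proof -
        have "sqrt (1 + t\<^sup>2) > 0" by (simp add: add_pos_nonneg)
        then show ?thesis by simp
      qed
      finally have "ereal (sqrt (1 - y t) * sqrt (jacobi_fun_sq k (real (m t - k)) \<alpha> (y t))) = ereal \<bar>t\<bar> * ereal (cmod (G t k (m t)))"
        by simp
      also have "\<dots> \<le> scaled_norm t"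
        by (intro ereal_mult_left_mono opnorm_ge) simp
      finally show ?case .
    qed
  qed
  ultimately show ?thesis by simp
qed

text \<open>At the remaining point, u = 0 with \<alpha> > 0, the Laguerre function vanishes and
  nonnegativity of the norm suffices.\<close>

lemma laguerre_fun_le_Liminf:
  assumes u: "u \<ge> 0"
  shows "ereal \<bar>laguerre_fun k \<alpha> u\<bar> \<le>
    Liminf at_infinity scaled_norm"
proof (cases "u > 0 \<or> \<alpha> = 0")
  case True
  with u show ?thesis by (intro laguerre_fun_le_Liminf_regular)
next
  case False
  then have "laguerre_fun k \<alpha> u = 0" using u by (simp add: laguerre_fun_def rpow_def)
  moreover have "0 \<le> Liminf at_infinity scaled_norm"
    by (rule Liminf_bounded) (simp add: opnorm_nonneg)
  ultimately show ?thesis by (simp add: zero_ereal_def)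
qed

text \<open>Each pair (k, u) selects its own family of kernel entries, so the supremum is taken
  after the limit and no uniformity is involved.\<close>

lemma Lambda_le_Liminf:
  "Lambda_const \<alpha> \<le> Liminf at_infinity scaled_norm"
  unfolding Lambda_const_def by (rule SUP_least) (auto intro!: laguerre_fun_le_Liminf)

lemma Limsup_le_1:
  "Limsup at_infinity scaled_norm \<le> 1"
  using eventually_nonzero_at_infinity by (intro Limsup_bounded) (auto elim!: eventually_mono intro!: scaled_opnorm_le_1)

lemma decay_1: "decays_with_exponent prop_norm 1"
  unfolding decays_with_exponent_def
proof (intro exI)
  show "\<forall>\<^sub>F t in at_infinity. prop_norm t \<le> ereal (1 * \<bar>t\<bar> powr - 1)"
    using eventually_nonzero_at_infinity
  proof eventually_elim
    case (elim t)
    have "\<bar>t\<bar> \<le> sqrt (1 + t\<^sup>2)" by (rule real_le_rsqrt) simp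
    then have "1 / sqrt (1 + t\<^sup>2) \<le> 1 / \<bar>t\<bar>" using elim by (intro divide_left_mono) (auto simp: add_pos_nonneg)
    also have "1 / \<bar>t\<bar> = 1 * \<bar>t\<bar> powr - 1" using elim by (simp add: powr_minus_divide)
    finally have "ereal (1 / sqrt (1 + t\<^sup>2)) \<le> ereal (1 * \<bar>t\<bar> powr - 1)" by simp
    then show ?case using opnorm_le[OF norm_lag_kernel_le[OF \<alpha> elim]] by (rule order_trans[rotated])
  qed
qed

text \<open>A rate \<gamma> > 1 would bound the scaled norm by C |t|^(1 - \<gamma>), which tends to
  0, against the positive lower bound \<open>A_const \<alpha>\<close>.\<close>

lemma not_decay_faster:
  assumes "\<gamma> > 1"
  shows "\<not> decays_with_exponent prop_norm \<gamma>"
proof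
  assume "decays_with_exponent prop_norm \<gamma>"
  then obtain C where C: "\<forall>\<^sub>F t in at_infinity. prop_norm t \<le> ereal (C * \<bar>t\<bar> powr (- \<gamma>))"
    by (auto simp: decays_with_exponent_def)
  have "Liminf at_infinity scaled_norm \<le>
      Liminf at_infinity (\<lambda>t::real. ereal (C * \<bar>t\<bar> powr (1 - \<gamma>)))"
  proof (rule Liminf_mono)
    show "\<forall>\<^sub>F t in at_infinity. scaled_norm t \<le> ereal (C * \<bar>t\<bar> powr (1 - \<gamma>))"
      using C eventually_nonzero_at_infinity
    proof eventually_elim
      case (elim t)
      have "scaled_norm t \<le> ereal \<bar>t\<bar> * ereal (C * \<bar>t\<bar> powr (- \<gamma>))"
        by (intro ereal_mult_left_mono elim) simp
      also have "\<dots> = ereal (C * \<bar>t\<bar> powr (1 - \<gamma>))" using elim by (simp add: powr_diff powr_minus_divide)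
      finally show ?case .
    qed
  qed
  also have "\<dots> = ereal (C * 0)"
  proof (rule lim_imp_Liminf)
    have "((\<lambda>x :: real. x powr (1 - \<gamma>)) \<longlongrightarrow> 0) at_top"
      using assms by (intro tendsto_neg_powr filterlim_ident) simp
    moreover have "filterlim (\<lambda>t :: real. \<bar>t\<bar>) at_top at_infinity"
      using filterlim_norm_at_top[where 'a = real] by (simp only: real_norm_def[abs_def])
    ultimately have "((\<lambda>t :: real. \<bar>t\<bar> powr (1 - \<gamma>)) \<longlongrightarrow> 0) at_infinity" by (rule filterlim_compose)
    then show "((\<lambda>t :: real. ereal (C * \<bar>t\<bar> powr (1 - \<gamma>))) \<longlongrightarrow> ereal (C * 0)) at_infinity"
      by (intro tendsto_intros)
  qed (simp add: trivial_limit_at_infinity)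
  finally have "ereal (A_const \<alpha>) \<le> ereal (C * 0)"
    by (rule order_trans[OF order_trans[OF A_le_Lambda[OF \<alpha>] Lambda_le_Liminf]])
  then show False using A_const_pos[OF \<alpha>] by simp
qed

end

theorem corollary11p7:
  fixes \<alpha> :: real
  assumes "\<alpha> \<ge> 0"
  shows "0 < A_const \<alpha>
    \<and> ereal (A_const \<alpha>) \<le> Lambda_const \<alpha>
    \<and> Lambda_const \<alpha> \<le>
        Liminf at_infinity (\<lambda>t::real. ereal \<bar>t\<bar> * opnorm_1_inf (laguerre_propagator \<alpha> t))
    \<and> Liminf at_infinity (\<lambda>t::real. ereal \<bar>t\<bar> * opnorm_1_inf (laguerre_propagator \<alpha> t)) \<le>
        Limsup at_infinity (\<lambda>t::real. ereal \<bar>t\<bar> * opnorm_1_inf (laguerre_propagator \<alpha> t))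
    \<and> Limsup at_infinity (\<lambda>t::real. ereal \<bar>t\<bar> * opnorm_1_inf (laguerre_propagator \<alpha> t)) \<le> 1
    \<and> M_const \<alpha> \<le> Lambda_const \<alpha>
    \<and> optimal_decay_exponent (\<lambda>t. opnorm_1_inf (laguerre_propagator \<alpha> t)) 1"
proof -
  interpret laguerre \<alpha> by unfold_locales fact
  show ?thesis
    unfolding optimal_decay_exponent_def
    using A_const_pos[OF assms] A_le_Lambda[OF assms] Lambda_le_Liminf Limsup_le_1 M_le_Lambda[OF assms] decay_1 not_decay_faster
    by (intro conjI allI impI Liminf_le_Limsup) (simp_all add: trivial_limit_at_infinity)
qed

end
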